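(* Let $p$ be a rational prime, let $d\ge1$, let $f$ be an irreducible polynomial in $R_{d,p}=\mathbb{F}_p[u_1^{\pm1},\ldots,u_d^{\pm1}]$, and let $\alpha=\alpha_{R_{d,p}/\langle f\rangle}$ be the algebraic $\mathbb{Z}^d$-action associated to the module $R_{d,p}/\langle f\rangle$. Let $N(f)\subset\mathbb{R}^d$ be the convex hull of the support of $f$. If $N(f)$ is tight, then $\mathcal{S}(\alpha)=\mathcal{M}(\alpha)$.
   Context: For $\mathbf{n}=(n_1,\ldots,n_d)\in\mathbb{Z}^d$ write $\mathbf{u}^{\mathbf{n}}=u_1^{n_1}\cdots u_d^{n_d}$. Writing $f=\sum_{\mathbf{n}\in\mathbb{Z}^d}c_{f,\mathbf{n}}\mathbf{u}^{\mathbf{n}}$ (a finite sum, $c_{f,\mathbf{n}}\in\mathbb{F}_p$), the support of $f$ is $S(f)=\{\mathbf{n}\in\mathbb{Z}^d : c_{f,\mathbf{n}}\ne0\}$. Tightness: a parallel redrawing of a (bounded) convex polyhedron $P$ in $\mathbb{R}^d$ is a convex polyhedron $Q$ in $\mathbb{R}^d$ together with a bijection from the vertices of $P$ to the vertices of $Q$ that carries edges to edges (in both directions) and such that each edge of $Q$ is parallel to the corresponding edge of $P$. The polyhedron $P$ is tight if every parallel redrawing $Q$ of $P$ is homothetic to $P$, that is, $Q=\lambda P+\mathbf{b}$ for some $\lambda\in\mathbb{R}\setminus\{0\}$ and $\mathbf{b}\in\mathbb{R}^d$. Algebraic action: for the module $M=R_{d,p}/\langle f\rangle$, let $X$ be the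 compact abelian Pontryagin dual group of the discrete additive group $M$, let $\mu$ be normalized Haar measure on $X$, and for $\mathbf{n}\in\mathbb{Z}^d$ let $\alpha^{\mathbf{n}}$ be the automorphism of $X$ dual to multiplication by $\mathbf{u}^{\mathbf{n}}$ on $M$. This gives the measure-preserving $\mathbb{Z}^d$-action $\alpha=\alpha_M$ on $(X,\mu)$. Order of mixing: a sequence $(\mathbf{n}_1^{(j)},\ldots,\mathbf{n}_r^{(j)})_{j\ge1}$ in $(\mathbb{Z}^d)^r$ is moving apart if $\mathbf{n}_s^{(j)}-\mathbf{n}_t^{(j)}\to\infty$ as $j\to\infty$ for all $s\ne t$. The action $\alpha$ is $r$-mixing if for every sequence of $r$-tuples that is moving apart and all measurable sets $A_1,\ldots,A_r\subset X$, $$\mu\bigl(\alpha^{-\mathbf{n}_1^{(j)}}(A_1)\cap\cdots\cap\alpha^{-\mathbf{n}_r^{(j)}}(A_r)\bigr)\to\mu(A_1)\cdots\mu(A_r)\quad\text{as } j\to\infty.$$ $\mathcal{M}(\alpha)$ is the maximum $r$ such that $\alpha$ is $r$-mixing ($\infty$ if there is no maximum). Shape order of mixing: a finite set $\{\mathbf{n}_1,\ldots,\mathbf{n}_r\}\subset\mathbb{Z}^d$ of cardinality $r$ is a mixing shape for $\alpha$ if for all measurable $A_1,\ldots,A_r$, $\mu(\alpha^{-k\mathbf{n}_1}(A_1)\cap\cdots\cap\alpha^{-k\mathbf{n}_r}(A_r))\to\mu(A_1)\cdots\mu(A_r)$ as $k\to\infty$. $\mathcal{S}(\alpha)$ is the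 maximum $r$ such that all sets of cardinality $r$ are mixing shapes ($\infty$ if there is no maximum). *)

theory Defs
  imports
    "HOL-Analysis.Analysis"
    "HOL-Library.Poly_Mapping"
    "HOL-Library.Extended_Nat"
    "HOL-Algebra.QuotRing"
    "Berlekamp_Zassenhaus.Finite_Field"
begin

section \<open>Laurent polynomials and their Newton polytopes\<close>

text \<open>
  The ring of Laurent polynomials in finitely many commuting variables, indexed by \<open>'d\<close>, over the
  prime field with \<open>CARD('p)\<close> elements is the group ring of \<open>int ^ 'd\<close>: finitely supported functions
  with convolution as multiplication. The support of \<open>f\<close> is \<open>Poly_Mapping.keys f\<close>.
\<close>

type_synonym ('d, 'p) laurent = "(int ^ 'd) \<Rightarrow>\<^sub>0 'p mod_ring"

definition laurent_monom :: "int ^ 'd \<Rightarrow> ('d::finite, 'p::prime_card) laurent"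
  where "laurent_monom n = Poly_Mapping.single n 1"

definition newton_polytope :: "('d::finite, 'p::prime_card) laurent \<Rightarrow> (real ^ 'd) set"
  where "newton_polytope f = convex hull ((\<lambda>n. \<chi> i. real_of_int (n $ i)) ` Poly_Mapping.keys f)"

text \<open>The type-class ring of Laurent polynomials as a ring object, and its quotient by \<open>\<langle>f\<rangle>\<close>.\<close>

definition laurent_ring :: "('d::finite, 'p::prime_card) laurent ring"
  where "laurent_ring =
    \<lparr>carrier = UNIV, mult = (*), one = 1, zero = 0, add = (+)\<rparr>"

definition principal_quotient :: "('d::finite, 'p::prime_card) laurent \<Rightarrow> ('d, 'p) laurent set ring"
  where "principal_quotient f = laurent_ring Quot (PIdl\<^bsub>laurent_ring\<^esub> f)"


section \<open>Tight polyhedra\<close>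

definition vertices :: "'a::euclidean_space set \<Rightarrow> 'a set"
  where "vertices P = {v. v extreme_point_of P}"

text \<open>
  All polyhedra are bounded. An edge is the closed segment joining its two vertices, so a vertex
  map \<open>\<phi>\<close> sends the edge \<open>closed_segment v w\<close> to \<open>closed_segment (\<phi> v) (\<phi> w)\<close>. Two edges are
  parallel if the lines they span are.
\<close>

definition parallel_redrawing ::
  "'a::euclidean_space set \<Rightarrow> 'a set \<Rightarrow> ('a \<Rightarrow> 'a) \<Rightarrow> bool"
  where "parallel_redrawing P Q \<phi> \<longleftrightarrow>
    polytope Q \<and>
    bij_betw \<phi> (vertices P) (vertices Q) \<and>
    (\<forall>v\<in>vertices P. \<forall>w\<in>vertices P.
      closed_segment v w edge_of P \<longleftrightarrow> closed_segment (\<phi> v) (\<phi> w) edge_of Q) \<and>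
    (\<forall>v\<in>vertices P. \<forall>w\<in>vertices P.
      closed_segment v w edge_of P \<longrightarrow>
        affine_parallel (affine hull closed_segment v w)
          (affine hull closed_segment (\<phi> v) (\<phi> w)))"

definition homothetic :: "'a::real_vector set \<Rightarrow> 'a set \<Rightarrow> bool"
  where "homothetic P Q \<longleftrightarrow> (\<exists>c b. c \<noteq> 0 \<and> Q = (\<lambda>x. c *\<^sub>R x + b) ` P)"

definition tight :: "'a::euclidean_space set \<Rightarrow> bool"
  where "tight P \<longleftrightarrow> (\<forall>Q \<phi>. parallel_redrawing P Q \<phi> \<longrightarrow> homothetic P Q)"


section \<open>Pontryagin duals of discrete abelian groups and Haar measure\<close>

definition circle_group :: "complex monoid"
  where "circle_group = \<lparr>carrier = sphere 0 1, mult = (*), one = 1\<rparr>"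

text \<open>
  Characters are made \<open>extensional\<close> so that each one is represented by exactly one HOL function.
\<close>

definition pontryagin_dual :: "('a, 'm) monoid_scheme \<Rightarrow> ('a \<Rightarrow> complex) monoid"
  where "pontryagin_dual G =
    \<lparr>carrier = hom G circle_group \<inter> extensional (carrier G),
     mult = (\<lambda>\<xi> \<eta>. \<lambda>x\<in>carrier G. \<xi> x * \<eta> x),
     one = (\<lambda>x\<in>carrier G. 1)\<rparr>"

text \<open>
  For discrete \<open>G\<close> the compact-open topology on the dual is the topology of pointwise convergence.
\<close>

definition dual_topology :: "('a, 'm) monoid_scheme \<Rightarrow> ('a \<Rightarrow> complex) topology"
  where "dual_topology G =
    subtopology (product_topology (\<lambda>_. euclidean) (carrier G)) (carrier (pontryagin_dual G))"

text \<open>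
  Normalized Haar measure of a compact group, as a Borel measure. No regularity condition is
  imposed: the groups considered here are duals of countable groups, hence metrizable, and every
  finite Borel measure on a compact metrizable space is regular.
\<close>

definition normalized_haar_measure ::
  "('x, 'm) monoid_scheme \<Rightarrow> 'x topology \<Rightarrow> 'x measure \<Rightarrow> bool"
  where "normalized_haar_measure X T \<mu> \<longleftrightarrow>
    space \<mu> = topspace T \<and>
    sets \<mu> = sigma_sets (topspace T) {U. openin T U} \<and>
    emeasure \<mu> (space \<mu>) = 1 \<and>
    (\<forall>g\<in>carrier X. \<forall>A\<in>sets \<mu>. emeasure \<mu> ((\<lambda>x. g \<otimes>\<^bsub>X\<^esub> x) ` A) = emeasure \<mu> A)"


section \<open>The algebraic action attached to \<open>f\<close>\<close>

definition dual_group :: "('d::finite, 'p::prime_card) laurent \<Rightarrow> (('d, 'p) laurent set \<Rightarrow> complex) monoid"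
  where "dual_group f = pontryagin_dual (add_monoid (principal_quotient f))"

definition dual_group_topology ::
  "('d::finite, 'p::prime_card) laurent \<Rightarrow> (('d, 'p) laurent set \<Rightarrow> complex) topology"
  where "dual_group_topology f = dual_topology (add_monoid (principal_quotient f))"

text \<open>
  The automorphism dual to multiplication by the class of the monomial with exponent \<open>n\<close>.
\<close>

definition algebraic_action ::
  "('d::finite, 'p::prime_card) laurent \<Rightarrow> int ^ 'd \<Rightarrow>
    (('d, 'p) laurent set \<Rightarrow> complex) \<Rightarrow> (('d, 'p) laurent set \<Rightarrow> complex)"
  where "algebraic_action f n \<xi> =
    (\<lambda>m\<in>carrier (principal_quotient f).
      \<xi> ((PIdl\<^bsub>laurent_ring\<^esub> f +>\<^bsub>laurent_ring\<^esub> laurent_monom n) \<otimes>\<^bsub>principal_quotient f\<^esub> m))"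


section \<open>Orders of mixing\<close>

text \<open>
  Tending to infinity in the discrete group \<open>int ^ 'd\<close> means eventually leaving every finite set,
  that is, convergence along \<open>cofinite\<close>. Tuples of length \<open>r\<close> are indexed by \<open>{..<r}\<close>.
\<close>

definition moving_apart :: "nat \<Rightarrow> (nat \<Rightarrow> nat \<Rightarrow> int ^ 'd::finite) \<Rightarrow> bool"
  where "moving_apart r n \<longleftrightarrow>
    (\<forall>s<r. \<forall>t<r. s \<noteq> t \<longrightarrow> filterlim (\<lambda>j. n j s - n j t) cofinite sequentially)"

definition mixing_of_order ::
  "'x measure \<Rightarrow> (int ^ 'd::finite \<Rightarrow> 'x \<Rightarrow> 'x) \<Rightarrow> nat \<Rightarrow> bool"
  where "mixing_of_order \<mu> \<alpha> r \<longleftrightarrow>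
    (\<forall>n A. moving_apart r n \<longrightarrow> (\<forall>s<r. A s \<in> sets \<mu>) \<longrightarrow>
      (\<lambda>j. measure \<mu> (\<Inter>s<r. \<alpha> (n j s) -` A s \<inter> space \<mu>))
        \<longlonglongrightarrow> (\<Prod>s<r. measure \<mu> (A s)))"

definition mixing_shape ::
  "'x measure \<Rightarrow> (int ^ 'd::finite \<Rightarrow> 'x \<Rightarrow> 'x) \<Rightarrow> (int ^ 'd) set \<Rightarrow> bool"
  where "mixing_shape \<mu> \<alpha> F \<longleftrightarrow>
    (\<forall>A. (\<forall>n\<in>F. A n \<in> sets \<mu>) \<longrightarrow>
      (\<lambda>k. measure \<mu> (\<Inter>n\<in>F. \<alpha> (int k *s n) -` A n \<inter> space \<mu>))
        \<longlonglongrightarrow> (\<Prod>n\<in>F. measure \<mu> (A n)))"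

text \<open>
  In \<open>enat\<close> the supremum of a nonempty set is its maximum if the set is finite and \<open>\<infinity>\<close>
  otherwise. Both sets below contain 1 for every measure-preserving action.
\<close>

definition mixing_order :: "'x measure \<Rightarrow> (int ^ 'd::finite \<Rightarrow> 'x \<Rightarrow> 'x) \<Rightarrow> enat"
  where "mixing_order \<mu> \<alpha> = Sup {enat r | r. r \<ge> 1 \<and> mixing_of_order \<mu> \<alpha> r}"

definition shape_mixing_order :: "'x measure \<Rightarrow> (int ^ 'd::finite \<Rightarrow> 'x \<Rightarrow> 'x) \<Rightarrow> enat"
  where "shape_mixing_order \<mu> \<alpha> =
    Sup {enat r | r. r \<ge> 1 \<and> (\<forall>F. finite F \<and> card F = r \<longrightarrow> mixing_shape \<mu> \<alpha> F)}"

end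

theory Submission
  imports Defs "HOL-Probability.Probability_Measure"
begin

text \<open>
  A family of moving-apart tuples along which mixing of order \<open>r\<close> fails is, by Fourier analysis on the
  dual group, the same as a relation \<open>\<Sum>i. a i * u ^ n i = 0\<close> in the domain \<open>R / \<langle>f\<rangle>\<close> with a fixed
  nonzero coefficient vector \<open>a\<close> and exponents \<open>n i\<close> arbitrarily far apart. Take such a relation with
  as few terms as possible. Splitting off the last base-\<open>p\<close> digits of the exponents with a Cartier
  operator gives a new relation among the remaining exponents whose coefficients stay in a finite set,
  and by minimality two relations satisfied by the same tuples are proportional. Hence the \<open>p\<close>-th
  powers of the new coefficients are proportional to the old ones up to monomials. By the pigeonhole
  principle some coefficient vector returns to itself, so that \<open>a i ^ (q - 1)\<close> is
  proportional to a monomial for some power \<open>q\<close> of \<open>p\<close>. Raising one relation to the powers \<open>q ^ l\<close>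
  then turns it into a relation along the multiples \<open>k = (q ^ l - 1) / (q - 1)\<close> of a single shape
  with no more points. That \<open>\<langle>f\<rangle>\<close> is a prime ideal is Gauss's lemma.
\<close>

section \<open>Laurent polynomials over a field form a unique factorization domain\<close>

text \<open>A Cartier operator alone does not respect congruence modulo \<open>f\<close>. Its twist
  \<open>cartier w (f ^ (CARD('p) - 1) * h)\<close> does, since it sends \<open>f * h\<close> to
  \<open>f * cartier w h\<close>. Up to a bounded error the twist also divides exponents by p, so
  bounded supports stay bounded; as the field is finite, this is the source of the finite set of
  coefficients. The relation obtained in this way lives on the quotients of the exponents, not on
  the old tuples. Only its p-th power is again a relation on the old tuples, and it is there that
  two relations are compared. Proportionality belongs to the fraction field of the quotient ring. It
  is expressed instead by cross-multiplication and divisibility by \<open>f\<close>; cancelling a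
  common factor then requires that \<open>f\<close> be prime, so Gauss's lemma is settled before
  anything else. Characters take values in the p-th roots of unity, so indicators of cylinders are
  finite combinations of characters. In the absence of relations the measures are therefore
  eventually equal to the product on cylinders, and a limit argument is needed only to pass to
  general measurable sets.\<close>

lemma lookup_times_keys:
  fixes f g :: "'a::ab_group_add \<Rightarrow>\<^sub>0 'b::comm_ring_1"
  shows "Poly_Mapping.lookup (f * g) k =
    (\<Sum>m\<in>Poly_Mapping.keys f. Poly_Mapping.lookup f m * Poly_Mapping.lookup g (k - m))"
proof -
  have inner: "Sum_any (\<lambda>q. Poly_Mapping.lookup g q when k = l + q) = Poly_Mapping.lookup g (k - l)" for l
  proof -
    have "(k = l + q) = (q = k - l)" for q by (auto simp: algebra_simps)
    then show ?thesis by simp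
  qed
  have "Poly_Mapping.lookup (f * g) k =
      Sum_any (\<lambda>m. Poly_Mapping.lookup f m * Poly_Mapping.lookup g (k - m))"
    unfolding lookup_mult inner ..
  also have "\<dots> =
      (\<Sum>m\<in>Poly_Mapping.keys f. Poly_Mapping.lookup f m * Poly_Mapping.lookup g (k - m))"
    by (rule Sum_any.expand_superset) (auto simp: in_keys_iff)
  finally show ?thesis .
qed

lemma lookup_single_times:
  fixes g :: "'a::ab_group_add \<Rightarrow>\<^sub>0 'b::comm_ring_1"
  shows "Poly_Mapping.lookup (Poly_Mapping.single m c * g) k = c * Poly_Mapping.lookup g (k - m)"
  unfolding lookup_times_keys by (cases "c = 0") auto

lemma sum_single_keys:
  "(\<Sum>m\<in>Poly_Mapping.keys f. Poly_Mapping.single m (Poly_Mapping.lookup f m)) = f"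
  by (rule poly_mapping_eqI) (auto simp: lookup_sum lookup_single when_def in_keys_iff)

lemma ex_in_keys: "f \<noteq> 0 \<Longrightarrow> \<exists>m. m \<in> Poly_Mapping.keys f"
  by (rule ccontr) (auto simp: in_keys_iff poly_mapping_eq_iff fun_eq_iff)

definition pm_part :: "('a \<Rightarrow> bool) \<Rightarrow> ('a \<Rightarrow>\<^sub>0 'b::comm_monoid_add) \<Rightarrow> ('a \<Rightarrow>\<^sub>0 'b)"
  where "pm_part P f =
    (\<Sum>m\<in>{m\<in>Poly_Mapping.keys f. P m}. Poly_Mapping.single m (Poly_Mapping.lookup f m))"

lemma lookup_pm_part:
  "Poly_Mapping.lookup (pm_part P f) m = (if P m then Poly_Mapping.lookup f m else 0)"
  by (auto simp: pm_part_def lookup_sum lookup_single when_def in_keys_iff)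

lemma keys_pm_part: "Poly_Mapping.keys (pm_part P f) = {m\<in>Poly_Mapping.keys f. P m}"
  by (auto simp: in_keys_iff lookup_pm_part split: if_splits)

text \<open>Leading forms multiply: weight \<open>M + N\<close> in the product can only come from
  exponents that attain both bounds, so no other pair of terms contributes.\<close>

lemma pm_part_times_top:
  fixes f g :: "'a::ab_group_add \<Rightarrow>\<^sub>0 'b::comm_ring_1" and \<theta> :: "'a \<Rightarrow> int"
  assumes add: "\<And>m n. \<theta> (m + n) = \<theta> m + \<theta> n"
    and f: "\<And>m. m \<in> Poly_Mapping.keys f \<Longrightarrow> \<theta> m \<le> M"
    and g: "\<And>m. m \<in> Poly_Mapping.keys g \<Longrightarrow> \<theta> m \<le> N"
  shows "pm_part (\<lambda>m. \<theta> m = M + N) (f * g) =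
    pm_part (\<lambda>m. \<theta> m = M) f * pm_part (\<lambda>m. \<theta> m = N) g"
proof (rule poly_mapping_eqI)
  fix k
  have diff: "\<theta> (k - m) = \<theta> k - \<theta> m" for m
    using add[of "k - m" m] by simp
  let ?f = "Poly_Mapping.lookup f" and ?g = "Poly_Mapping.lookup g"
  have "Poly_Mapping.lookup (pm_part (\<lambda>m. \<theta> m = M) f * pm_part (\<lambda>m. \<theta> m = N) g) k =
      (\<Sum>m\<in>{m\<in>Poly_Mapping.keys f. \<theta> m = M}. ?f m * (if \<theta> k - \<theta> m = N then ?g (k - m) else 0))"
    unfolding lookup_times_keys keys_pm_part by (intro sum.cong) (auto simp: lookup_pm_part diff)
  also have "\<dots> = (\<Sum>m\<in>Poly_Mapping.keys f. if \<theta> k = M + N then ?f m * ?g (k - m) else 0)"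
  proof (rule sum.mono_neutral_cong_left)
    show "\<forall>m\<in>Poly_Mapping.keys f - {m \<in> Poly_Mapping.keys f. \<theta> m = M}.
      (if \<theta> k = M + N then ?f m * ?g (k - m) else 0) = 0"
    proof
      fix m assume m: "m \<in> Poly_Mapping.keys f - {m \<in> Poly_Mapping.keys f. \<theta> m = M}"
      then have "\<theta> m < M" using f[of m] by auto
      then have "k - m \<notin> Poly_Mapping.keys g" if "\<theta> k = M + N"
        using g[of "k - m"] that by (auto simp: diff)
      then show "(if \<theta> k = M + N then ?f m * ?g (k - m) else 0) = 0"
        by (auto simp: in_keys_iff)
    qed
  qed auto
  also have "\<dots> = Poly_Mapping.lookup (pm_part (\<lambda>m. \<theta> m = M + N) (f * g)) k"
    by (simp add: lookup_pm_part lookup_times_keys)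
  finally show "Poly_Mapping.lookup (pm_part (\<lambda>m. \<theta> m = M + N) (f * g)) k =
    Poly_Mapping.lookup (pm_part (\<lambda>m. \<theta> m = M) f * pm_part (\<lambda>m. \<theta> m = N) g) k" by simp
qed

text \<open>A generic integer weight. Evaluating at \<open>t\<close> the polynomial with
  coefficients \<open>v $ i\<close> is additive in \<open>v\<close>, and each pair of distinct
  points of \<open>A\<close> forbids only the finitely many roots of one nonzero polynomial.\<close>

lemma exists_additive_inj_on:
  fixes A :: "(int ^ 'd::finite) set"
  assumes "finite A"
  shows "\<exists>\<theta> :: int ^ 'd \<Rightarrow> int. (\<forall>m n. \<theta> (m + n) = \<theta> m + \<theta> n) \<and> inj_on \<theta> A"
proof -
  obtain ix :: "'d \<Rightarrow> nat" where ix: "inj ix"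
    using finite_imp_inj_to_nat_seg[of "UNIV :: 'd set"] by auto
  define q :: "int ^ 'd \<Rightarrow> int poly" where "q v = (\<Sum>i\<in>UNIV. Polynomial.monom (v $ i) (ix i))" for v
  have q0: "q v \<noteq> 0" if "v \<noteq> 0" for v
  proof -
    from that obtain i where "v $ i \<noteq> 0" by (auto simp: vec_eq_iff)
    moreover have "Polynomial.coeff (q v) (ix i) = v $ i"
      using ix by (simp add: q_def Polynomial.coeff_sum inj_eq)
    ultimately show ?thesis by auto
  qed
  let ?B = "\<Union>m\<in>A. \<Union>n\<in>A. if m = n then {} else {t. poly (q (m - n)) t = 0}"
  have "finite ?B" using assms q0 by (auto intro!: poly_roots_finite)
  then obtain t where t: "t \<notin> ?B" using ex_new_if_finite infinite_UNIV_int by blast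
  have qadd: "q (m + n) = q m + q n" and qdiff: "q (m - n) = q m - q n" for m n
    by (simp_all add: q_def sum.distrib sum_subtractf flip: add_monom diff_monom)
  show ?thesis
  proof (intro exI[of _ "\<lambda>m. poly (q m) t"] conjI allI)
    show "poly (q (m + n)) t = poly (q m) t + poly (q n) t" for m n by (simp add: qadd)
    show "inj_on (\<lambda>m. poly (q m) t) A"
    proof (rule inj_onI, rule ccontr)
      fix m n assume "m \<in> A" "n \<in> A" "poly (q m) t = poly (q n) t" "m \<noteq> n"
      then have "t \<in> ?B" unfolding UN_iff
        by (intro bexI[of _ m] bexI[of _ n]) (auto simp: qdiff)
      with t show False by simp
    qed
  qed
qed

text \<open>For a weight that is injective on both supports the leading forms are single terms, and
  nonzero terms over a field have a nonzero product.\<close>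

lemma laurent_times_eq_0_iff:
  fixes f g :: "(int ^ 'd::finite) \<Rightarrow>\<^sub>0 'b::field"
  shows "f * g = 0 \<longleftrightarrow> f = 0 \<or> g = 0"
proof
  assume 0: "f * g = 0"
  show "f = 0 \<or> g = 0"
  proof (rule ccontr)
    assume "\<not> (f = 0 \<or> g = 0)"
    then have ne: "Poly_Mapping.keys f \<noteq> {}" "Poly_Mapping.keys g \<noteq> {}" by auto
    obtain \<theta> :: "int ^ 'd \<Rightarrow> int" where add: "\<And>m n. \<theta> (m + n) = \<theta> m + \<theta> n"
      and inj: "inj_on \<theta> (Poly_Mapping.keys f \<union> Poly_Mapping.keys g)"
      using exists_additive_inj_on[OF finite_UnI[OF finite_keys[of f] finite_keys[of g]]] by blast
    have top: "\<exists>m c. c \<noteq> 0 \<and> (\<forall>n\<in>Poly_Mapping.keys h. \<theta> n \<le> \<theta> m) \<and>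
        pm_part (\<lambda>n. \<theta> n = \<theta> m) h = Poly_Mapping.single m c"
      if h: "Poly_Mapping.keys h \<noteq> {}" "inj_on \<theta> (Poly_Mapping.keys h)"
      for h :: "(int ^ 'd) \<Rightarrow>\<^sub>0 'b"
    proof -
      have "Max (\<theta> ` Poly_Mapping.keys h) \<in> \<theta> ` Poly_Mapping.keys h"
        using h by (intro Max_in) auto
      then obtain m where m: "m \<in> Poly_Mapping.keys h" "\<theta> m = Max (\<theta> ` Poly_Mapping.keys h)"
        by auto
      have "pm_part (\<lambda>n. \<theta> n = \<theta> m) h = Poly_Mapping.single m (Poly_Mapping.lookup h m)"
      proof (rule poly_mapping_eqI)
        fix k
        have "\<theta> k \<noteq> \<theta> m \<or> Poly_Mapping.lookup h k = 0" if "k \<noteq> m"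
          using inj_onD[OF h(2), of k m] m(1) that by (auto simp: in_keys_iff)
        then show "Poly_Mapping.lookup (pm_part (\<lambda>n. \<theta> n = \<theta> m) h) k =
            Poly_Mapping.lookup (Poly_Mapping.single m (Poly_Mapping.lookup h m)) k"
          by (cases "k = m") (auto simp: lookup_pm_part lookup_single)
      qed
      then show ?thesis using m by (intro exI[of _ m]) (auto simp: in_keys_iff)
    qed
    obtain m c where m: "c \<noteq> 0" "\<And>n. n\<in>Poly_Mapping.keys f \<Longrightarrow> \<theta> n \<le> \<theta> m"
      "pm_part (\<lambda>n. \<theta> n = \<theta> m) f = Poly_Mapping.single m c"
      using top[OF ne(1) inj_on_subset[OF inj Un_upper1]] by blast
    obtain n d where n: "d \<noteq> 0" "\<And>k. k\<in>Poly_Mapping.keys g \<Longrightarrow> \<theta> k \<le> \<theta> n"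
      "pm_part (\<lambda>k. \<theta> k = \<theta> n) g = Poly_Mapping.single n d"
      using top[OF ne(2) inj_on_subset[OF inj Un_upper2]] by blast
    have "pm_part (\<lambda>k. \<theta> k = \<theta> m + \<theta> n) (f * g) = Poly_Mapping.single (m + n) (c * d)"
      by (subst pm_part_times_top[OF add m(2) n(2)]) (simp_all add: m(3) n(3) mult_single)
    then have "Poly_Mapping.lookup (pm_part (\<lambda>k. \<theta> k = \<theta> m + \<theta> n) (f * g)) (m + n) = c * d"
      by simp
    then show False using 0 m(1) n(1) by (simp add: lookup_pm_part add)
  qed
qed auto

lemma laurent_mult_cancel_left:
  fixes f g h :: "(int ^ 'd::finite) \<Rightarrow>\<^sub>0 'b::field"
  assumes "f \<noteq> 0" "f * g = f * h" shows "g = h"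
proof -
  have "f * (g - h) = 0" using assms(2) by (simp add: algebra_simps)
  then show ?thesis using assms(1) by (simp add: laurent_times_eq_0_iff)
qed

section \<open>Top weights and widths, the substitutes for degrees\<close>

definition top_weight :: "('a \<Rightarrow> int) \<Rightarrow> ('a \<Rightarrow>\<^sub>0 'b::zero) \<Rightarrow> int"
  where "top_weight \<theta> f = Max (\<theta> ` Poly_Mapping.keys f)"

lemma top_weight_ge: "m \<in> Poly_Mapping.keys f \<Longrightarrow> \<theta> m \<le> top_weight \<theta> f"
  by (simp add: top_weight_def)

lemma top_weight_attained:
  assumes "f \<noteq> 0" obtains m where "m \<in> Poly_Mapping.keys f" "\<theta> m = top_weight \<theta> f"
proof -
  have "top_weight \<theta> f \<in> \<theta> ` Poly_Mapping.keys f"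
    unfolding top_weight_def using ex_in_keys[OF assms] by (intro Max_in) auto
  then show ?thesis using that by auto
qed

lemma top_part_nonzero:
  assumes "f \<noteq> 0" shows "pm_part (\<lambda>m. \<theta> m = top_weight \<theta> f) f \<noteq> 0"
proof -
  obtain m where "m \<in> Poly_Mapping.keys f" "\<theta> m = top_weight \<theta> f"
    using top_weight_attained[OF assms] .
  then have "m \<in> Poly_Mapping.keys (pm_part (\<lambda>m. \<theta> m = top_weight \<theta> f) f)"
    by (simp add: keys_pm_part)
  then show ?thesis by auto
qed

lemma top_weight_eqI:
  assumes "\<And>m. m \<in> Poly_Mapping.keys f \<Longrightarrow> \<theta> m \<le> M" "m \<in> Poly_Mapping.keys f" "\<theta> m = M"
  shows "top_weight \<theta> f = M"
  unfolding top_weight_def using assms by (intro Max_eqI) auto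

lemma top_weight_times:
  fixes f g :: "(int ^ 'd::finite) \<Rightarrow>\<^sub>0 'b::field"
  assumes add: "\<And>m n. \<theta> (m + n) = \<theta> m + \<theta> n" and nz: "f \<noteq> 0" "g \<noteq> 0"
  shows "top_weight \<theta> (f * g) = top_weight \<theta> f + top_weight \<theta> g"
proof -
  let ?M = "top_weight \<theta> f" and ?N = "top_weight \<theta> g"
  have "pm_part (\<lambda>m. \<theta> m = ?M + ?N) (f * g) \<noteq> 0"
    by (subst pm_part_times_top[OF add]) (auto simp: top_weight_ge laurent_times_eq_0_iff
      nz top_part_nonzero)
  from ex_in_keys[OF this] obtain m where "m \<in> Poly_Mapping.keys (f * g)" "\<theta> m = ?M + ?N"
    by (auto simp: keys_pm_part)
  moreover have "\<theta> k \<le> ?M + ?N" if k: "k \<in> Poly_Mapping.keys (f * g)" for k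
  proof -
    obtain a b where "k = a + b" "a \<in> Poly_Mapping.keys f" "b \<in> Poly_Mapping.keys g"
      using subsetD[OF keys_mult[of f g] k] by blast
    then show ?thesis using top_weight_ge[of a f \<theta>] top_weight_ge[of b g \<theta>] by (simp add: add)
  qed
  ultimately show ?thesis by (intro top_weight_eqI)
qed

text \<open>Length of the projection of the Newton polytope to the axis \<open>i\<close>. Unlike a
  degree it is unchanged by multiplication with monomials, which are units here. It is meaningful
  only for nonzero \<open>f\<close>: otherwise \<open>top_weight\<close> is the maximum of an empty
  set.\<close>

definition width :: "'d::finite \<Rightarrow> ((int ^ 'd) \<Rightarrow>\<^sub>0 'b::zero) \<Rightarrow> nat"
  where "width i f = nat (top_weight (\<lambda>n. n $ i) f + top_weight (\<lambda>n. - (n $ i)) f)"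

lemma top_weight_sum_nonneg:
  assumes "f \<noteq> 0" shows "0 \<le> top_weight \<theta> f + top_weight (\<lambda>n. - \<theta> n) f"
proof -
  obtain m where "m \<in> Poly_Mapping.keys f" using assms ex_in_keys by blast
  then show ?thesis using top_weight_ge[of m f \<theta>] top_weight_ge[of m f "\<lambda>n. - \<theta> n"] by simp
qed

lemma width_times:
  fixes f g :: "(int ^ 'd::finite) \<Rightarrow>\<^sub>0 'b::field"
  assumes "f \<noteq> 0" "g \<noteq> 0"
  shows "width i (f * g) = width i f + width i g"
proof -
  have "top_weight (\<lambda>n. n $ i) (f * g) = top_weight (\<lambda>n. n $ i) f + top_weight (\<lambda>n. n $ i) g"
    "top_weight (\<lambda>n. - (n $ i)) (f * g) = top_weight (\<lambda>n. - (n $ i)) f + top_weight (\<lambda>n. - (n $ i)) g"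
    using assms by (auto intro!: top_weight_times)
  then show ?thesis
    using top_weight_sum_nonneg[OF assms(1), of "\<lambda>n. n $ i"] 
      top_weight_sum_nonneg[OF assms(2), of "\<lambda>n. n $ i"]
    by (simp add: width_def)
qed

lemma width_bound:
  assumes "\<And>m. m \<in> Poly_Mapping.keys f \<Longrightarrow> a \<le> m $ i \<and> m $ i \<le> b" "f \<noteq> 0"
  shows "int (width i f) \<le> b - a"
proof -
  obtain m where m: "m \<in> Poly_Mapping.keys f" "m $ i = top_weight (\<lambda>n. n $ i) f"
    using top_weight_attained[OF assms(2)] .
  obtain n where n: "n \<in> Poly_Mapping.keys f" "- (n $ i) = top_weight (\<lambda>n. - (n $ i)) f"
    using top_weight_attained[OF assms(2)] .
  show ?thesis using assms(1)[OF m(1)] assms(1)[OF n(1)] top_weight_sum_nonneg[OF assms(2), of "\<lambda>n. n $ i"]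
    by (simp add: width_def flip: m(2) n(2))
qed

lemma width_ge:
  assumes "m \<in> Poly_Mapping.keys f" "n \<in> Poly_Mapping.keys f"
  shows "m $ i - n $ i \<le> int (width i f)"
proof -
  have "m $ i \<le> top_weight (\<lambda>n. n $ i) f" "- (n $ i) \<le> top_weight (\<lambda>n. - (n $ i)) f"
    using assms by (auto intro: top_weight_ge[where \<theta> = "\<lambda>n. n $ i"]
       top_weight_ge[where \<theta> = "\<lambda>n. - (n $ i)"])
  then show ?thesis by (simp add: width_def)
qed

lemma unit_single:
  fixes c :: "'b::field"
  assumes "c \<noteq> 0" shows "Poly_Mapping.single (m :: 'a::ab_group_add) c dvd 1"
proof
  show "1 = Poly_Mapping.single m c * Poly_Mapping.single (- m) (inverse c)"
    using assms by (simp add: mult_single)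
qed

lemma width_0_imp_unit:
  fixes f :: "(int ^ 'd::finite) \<Rightarrow>\<^sub>0 'b::field"
  assumes "f \<noteq> 0" "\<And>i. width i f = 0"
  shows "f dvd 1"
proof -
  obtain m where m: "m \<in> Poly_Mapping.keys f" using ex_in_keys assms by blast
  have "n = m" if n: "n \<in> Poly_Mapping.keys f" for n
  proof -
    have "n $ i = m $ i" for i
      using width_ge[OF n m, of i] width_ge[OF m n, of i] assms(2)[of i] by simp
    then show ?thesis by (simp add: vec_eq_iff)
  qed
  then have "Poly_Mapping.keys f = {m}" using m by blast
  then have "f = Poly_Mapping.single m (Poly_Mapping.lookup f m)"
    by (subst sum_single_keys[of f, symmetric]) simp
  moreover have "Poly_Mapping.lookup f m \<noteq> 0" using m by (simp add: in_keys_iff)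
  ultimately show ?thesis using unit_single[of "Poly_Mapping.lookup f m" m] by argo
qed

section \<open>Subrings in fewer variables\<close>

definition laurent_sub :: "'d::finite set \<Rightarrow> ((int ^ 'd) \<Rightarrow>\<^sub>0 'b::field) set"
  where "laurent_sub S = {f. \<forall>n\<in>Poly_Mapping.keys f. \<forall>j. j \<notin> S \<longrightarrow> n $ j = 0}"

lemma laurent_sub_simps [simp]:
  "0 \<in> laurent_sub S" "1 \<in> laurent_sub S"
  by (auto simp: laurent_sub_def)

lemma laurent_sub_add: "f \<in> laurent_sub S \<Longrightarrow> g \<in> laurent_sub S \<Longrightarrow> f + g \<in> laurent_sub S"
  using keys_add[of f g] by (fastforce simp: laurent_sub_def)

lemma keys_uminus_pm: "Poly_Mapping.keys (- f :: 'a \<Rightarrow>\<^sub>0 'b::ab_group_add) = Poly_Mapping.keys f"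
  by (auto simp: in_keys_iff)

lemma laurent_sub_diff: "f \<in> laurent_sub S \<Longrightarrow> g \<in> laurent_sub S \<Longrightarrow> f - g \<in> laurent_sub S"
  using laurent_sub_add[of f S "- g"] by (auto simp: laurent_sub_def keys_uminus_pm)

lemma laurent_sub_times: "f \<in> laurent_sub S \<Longrightarrow> g \<in> laurent_sub S \<Longrightarrow> f * g \<in> laurent_sub S"
  using keys_mult[of f g] by (fastforce simp: laurent_sub_def)

lemma laurent_sub_part: "f \<in> laurent_sub S \<Longrightarrow> pm_part P f \<in> laurent_sub S"
  by (auto simp: laurent_sub_def keys_pm_part)

lemma laurent_sub_mono: "f \<in> laurent_sub S \<Longrightarrow> S \<subseteq> T \<Longrightarrow> f \<in> laurent_sub T"
  by (auto simp: laurent_sub_def)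

lemma laurent_sub_UNIV: "f \<in> laurent_sub UNIV"
  by (auto simp: laurent_sub_def)

lemma laurent_sub_single_axis: "i \<in> S \<Longrightarrow> Poly_Mapping.single (axis i k) c \<in> laurent_sub S"
  by (auto simp: laurent_sub_def axis_def)

lemma laurent_sub_top_weight:
  assumes "f \<in> laurent_sub S" "f \<noteq> 0" "j \<notin> S"
  shows "top_weight (\<lambda>n. n $ j) f = 0" "top_weight (\<lambda>n. - (n $ j)) f = 0"
proof -
  obtain m where m: "m \<in> Poly_Mapping.keys f" using ex_in_keys assms by blast
  show "top_weight (\<lambda>n. n $ j) f = 0" "top_weight (\<lambda>n. - (n $ j)) f = 0"
    using assms m by (auto simp: laurent_sub_def intro!: top_weight_eqI[OF _ m])
qed

text \<open>Top weights are additive in the directions \<open>j\<close> and \<open>-j\<close>, so a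
  quotient has no extent outside \<open>S\<close>. Hence divisibility between elements of the
  subring means the same inside it and in the whole ring.\<close>

lemma laurent_sub_quotient:
  assumes "f \<in> laurent_sub S" "f \<noteq> 0" "f * q \<in> laurent_sub S"
  shows "q \<in> laurent_sub S"
proof (cases "q = 0")
  case False
  show ?thesis unfolding laurent_sub_def
  proof (clarify)
    fix n j assume n: "n \<in> Poly_Mapping.keys q" and j: "j \<notin> S"
    have "f * q \<noteq> 0" using assms(2) False by (simp add: laurent_times_eq_0_iff)
    note * = laurent_sub_top_weight[OF assms(1,2) j] laurent_sub_top_weight[OF assms(3) this j]
    have "top_weight (\<lambda>n. n $ j) (f * q) = top_weight (\<lambda>n. n $ j) f + top_weight (\<lambda>n. n $ j) q"
      "top_weight (\<lambda>n. - (n $ j)) (f * q) =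
         top_weight (\<lambda>n. - (n $ j)) f + top_weight (\<lambda>n. - (n $ j)) q"
      using assms(2) False by (auto intro!: top_weight_times)
    with * have "top_weight (\<lambda>n. n $ j) q = 0" "top_weight (\<lambda>n. - (n $ j)) q = 0" by auto
    then show "n $ j = 0"
      using top_weight_ge[OF n, of "\<lambda>n. n $ j"] top_weight_ge[OF n, of "\<lambda>n. - (n $ j)"] by simp
  qed
qed simp

text \<open>Widths add up, so both factors have width 0 in every direction outside \<open>S\<close>:
  their exponents are constant there, and opposite monomial shifts move both into the subring
  without changing the product.\<close>

lemma laurent_sub_factor:
  assumes "c1 * c2 \<in> laurent_sub S" "c1 \<noteq> 0" "c2 \<noteq> 0"
  obtains m where "Poly_Mapping.single m 1 * c1 \<in> laurent_sub S"
    "Poly_Mapping.single (- m) 1 * c2 \<in> laurent_sub S"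
proof -
  obtain n where n: "n \<in> Poly_Mapping.keys c1" using assms ex_in_keys by blast
  let ?c = "Poly_Mapping.single (- n) 1 * c1"
  have w: "width j c1 = 0" if "j \<notin> S" for j
  proof -
    have "width j (c1 * c2) = 0"
      using laurent_sub_top_weight[OF assms(1) _ that] assms
      by (simp add: width_def laurent_times_eq_0_iff)
    then show ?thesis using assms by (simp add: width_times)
  qed
  have 1: "?c \<in> laurent_sub S" unfolding laurent_sub_def
  proof (clarify)
    fix k j assume k: "k \<in> Poly_Mapping.keys ?c" and j: "j \<notin> S"
    then have "k + n \<in> Poly_Mapping.keys c1" by (auto simp: in_keys_iff lookup_single_times)
    then show "k $ j = 0" using width_ge[OF n, of "k + n" j] width_ge[of "k + n" c1 n j] n w[OF j]
      by simp
  qed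
  have eq: "?c * (Poly_Mapping.single n 1 * c2) = c1 * c2"
  proof -
    have "?c * (Poly_Mapping.single n 1 * c2) =
        (Poly_Mapping.single (- n) 1 * Poly_Mapping.single n 1) * (c1 * c2)"
      by (simp only: mult_ac)
    then show ?thesis by (simp add: mult_single)
  qed
  have "?c \<noteq> 0"
  proof
    assume "?c = 0"
    then have "c1 * c2 = 0" using eq by simp
    then show False using assms by (simp add: laurent_times_eq_0_iff)
  qed
  then have "Poly_Mapping.single n 1 * c2 \<in> laurent_sub S"
    by (rule laurent_sub_quotient[OF 1]) (unfold eq, rule assms(1))
  with 1 show ?thesis using that[of "- n"] unfolding minus_minus by blast
qed

text \<open>Induction measure for factorizations: additive on nonzero products and positive on
  nonzero nonunits, so proper factors are smaller.\<close>

definition laurent_size :: "((int ^ 'd::finite) \<Rightarrow>\<^sub>0 'b::zero) \<Rightarrow> nat"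
  where "laurent_size f = (\<Sum>i\<in>UNIV. width i f)"

lemma laurent_size_times:
  fixes f g :: "(int ^ 'd::finite) \<Rightarrow>\<^sub>0 'b::field"
  assumes "f \<noteq> 0" "g \<noteq> 0"
  shows "laurent_size (f * g) = laurent_size f + laurent_size g"
  using assms by (simp add: laurent_size_def width_times sum.distrib)

lemma laurent_size_pos:
  fixes f :: "(int ^ 'd::finite) \<Rightarrow>\<^sub>0 'b::field"
  assumes "f \<noteq> 0" "\<not> f dvd 1"
  shows "0 < laurent_size f"
  using width_0_imp_unit[OF assms(1)] assms(2) by (auto simp: laurent_size_def intro!: Nat.gr0I)

lemma dvd_unit_times_iff:
  assumes "u dvd (1 :: 'a::comm_ring_1)" shows "f dvd u * g \<longleftrightarrow> f dvd g"
proof -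
  obtain v where v: "1 = u * v" using assms by (rule dvdE)
  have "f dvd v * (u * g)" if "f dvd u * g" using that by simp
  moreover have "v * (u * g) = g" using v by (simp add: mult_ac flip: mult.assoc)
  ultimately show ?thesis by auto
qed

lemma unit_times_dvd_iff:
  assumes "u dvd (1 :: 'a::comm_ring_1)" shows "u * f dvd g \<longleftrightarrow> f dvd g"
proof -
  obtain v where v: "1 = u * v" using assms by (rule dvdE)
  have "u * f dvd g" if "f dvd g"
  proof -
    obtain k where "g = f * k" using \<open>f dvd g\<close> by (rule dvdE)
    then have "g = (u * v) * (f * k)" by (simp flip: v)
    then have "g = (u * f) * (v * k)" by (simp only: mult_ac)
    then show ?thesis by (rule dvdI)
  qed
  then show ?thesis using dvd_mult_right[of u f g] by blast
qed

lemma unit_times_unit_iff: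
  assumes "u dvd (1 :: 'a::comm_ring_1)" shows "u * f dvd 1 \<longleftrightarrow> f dvd 1"
  using unit_times_dvd_iff[OF assms] .

lemma irreducible_unit_times:
  fixes u :: "'a::comm_ring_1"
  assumes "u dvd 1" "irreducible f"
  shows "irreducible (u * f)"
proof (rule irreducibleI)
  obtain v where v: "1 = u * v" using assms(1) by (rule dvdE)
  have vu: "v * (u * g) = g" for g using v by (simp add: mult_ac flip: mult.assoc)
  show "u * f \<noteq> 0"
  proof
    assume "u * f = 0"
    then have "f = 0" using vu[of f] by simp
    then show False using assms(2) by simp
  qed
  show "\<not> u * f dvd 1" using assms unit_times_unit_iff irreducible_not_unit by blast
  fix a b assume "u * f = a * b"
  then have "f = (v * a) * b" using vu[of f] by (simp add: mult.assoc)
  then have "v * a dvd 1 \<or> b dvd 1" using assms(2) irreducibleD by blast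
  then show "a dvd 1 \<or> b dvd 1" using dvd_mult_right[of v a 1] by blast
qed

text \<open>
  Gauss's lemma is proved along the tower of subrings \<open>laurent_sub S\<close>, adjoining one variable at a
  time. Divisibility and irreducibility always refer to the whole ring.
\<close>

definition irreducibles_prime_on :: "'d::finite set \<Rightarrow> 'b::field itself \<Rightarrow> bool"
  where "irreducibles_prime_on S _ \<longleftrightarrow> (\<forall>f g h :: (int ^ 'd) \<Rightarrow>\<^sub>0 'b.
    irreducible f \<longrightarrow> f \<in> laurent_sub S \<longrightarrow> g \<in> laurent_sub S \<longrightarrow> h \<in> laurent_sub S \<longrightarrow>
    f dvd g * h \<longrightarrow> f dvd g \<or> f dvd h)"

section \<open>Gauss's lemma for one additional variable\<close>

lemma part_times_degree_0:
  fixes f g :: "(int ^ 'd::finite) \<Rightarrow>\<^sub>0 'b::field"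
  assumes "f \<in> laurent_sub S" "i \<notin> S"
  shows "pm_part (\<lambda>n. n $ i = k) (f * g) = f * pm_part (\<lambda>n. n $ i = k) g"
proof (rule poly_mapping_eqI)
  fix n
  have 0: "m $ i = 0" if "m \<in> Poly_Mapping.keys f" for m
    using assms that by (auto simp: laurent_sub_def)
  show "Poly_Mapping.lookup (pm_part (\<lambda>n. n $ i = k) (f * g)) n =
      Poly_Mapping.lookup (f * pm_part (\<lambda>n. n $ i = k) g) n"
    by (simp add: lookup_pm_part lookup_times_keys 0)
qed

text \<open>The shifted component is the coefficient of the \<open>k\<close>-th power of the
  variable \<open>i\<close>, as an element of the smaller subring.\<close>

lemma shift_homogeneous:
  fixes f :: "(int ^ 'd::finite) \<Rightarrow>\<^sub>0 'b::field"
  assumes "f \<in> laurent_sub (insert i S)" "i \<notin> S"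
  shows "Poly_Mapping.single (axis i (- k)) 1 * pm_part (\<lambda>n. n $ i = k) f \<in> laurent_sub S"
  unfolding laurent_sub_def
proof (clarify)
  fix n j assume n: "n \<in> Poly_Mapping.keys (Poly_Mapping.single (axis i (- k)) 1 * pm_part (\<lambda>n. n $ i = k) f)"
    and j: "j \<notin> S"
  then have *: "n - axis i (- k) \<in> Poly_Mapping.keys f" "(n - axis i (- k)) $ i = k"
    by (auto simp: in_keys_iff lookup_single_times lookup_pm_part split: if_splits)
  show "n $ j = 0"
  proof (cases "j = i")
    case True then show ?thesis using *(2) by (simp add: axis_def)
  next
    case False
    then have "(n - axis i (- k)) $ j = 0" using *(1) assms(1) j by (auto simp: laurent_sub_def)
    then show ?thesis using False by (simp add: axis_def)
  qed
qed

lemma single_axis_cancel: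
  "Poly_Mapping.single (axis i k) 1 * (Poly_Mapping.single (axis i (- k)) 1 * f) =
    (f :: (int ^ 'd::finite) \<Rightarrow>\<^sub>0 'b::field)"
proof -
  have "axis i k + axis i (- k) = (0 :: int ^ 'd)" by (simp add: vec_eq_iff axis_def)
  then show ?thesis by (simp add: mult_single flip: mult.assoc)
qed

text \<open>\<open>f\<close> divides the product of the leading coefficients in the variable
  \<open>i\<close>, hence one of them. Subtracting that leading part keeps the divisibility and
  lowers the total number of terms.\<close>

lemma prime_adjoin_degree_0:
  fixes f g h :: "(int ^ 'd::finite) \<Rightarrow>\<^sub>0 'b::field"
  assumes P: "irreducibles_prime_on S TYPE('b)" and i: "i \<notin> S"
    and f: "irreducible f" "f \<in> laurent_sub S"
    and gh: "g \<in> laurent_sub (insert i S)" "h \<in> laurent_sub (insert i S)" "f dvd g * h"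
  shows "f dvd g \<or> f dvd h"
  using gh
proof (induction "card (Poly_Mapping.keys g) + card (Poly_Mapping.keys h)"
    arbitrary: g h rule: less_induct)
  case less
  show ?case
  proof (cases "g = 0 \<or> h = 0")
    case False
    let ?t = "\<lambda>g :: (int ^ 'd) \<Rightarrow>\<^sub>0 'b. pm_part (\<lambda>n. n $ i = top_weight (\<lambda>n. n $ i) g) g"
    let ?u = "\<lambda>k. Poly_Mapping.single (axis i k) 1 :: (int ^ 'd) \<Rightarrow>\<^sub>0 'b"
    obtain q where q: "g * h = f * q" using less.prems(3) by (rule dvdE)
    have "?t g * ?t h = pm_part (\<lambda>n. n $ i = top_weight (\<lambda>n. n $ i) g + top_weight (\<lambda>n. n $ i) h) (g * h)"
      by (rule pm_part_times_top[symmetric])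
        (auto intro: top_weight_ge[where \<theta> = "\<lambda>n. n $ i"])
    then have fdvd: "f dvd ?t g * ?t h" by (simp add: q part_times_degree_0[OF f(2) i])
    let ?sg = "?u (- top_weight (\<lambda>n. n $ i) g) * ?t g"
    let ?sh = "?u (- top_weight (\<lambda>n. n $ i) h) * ?t h"
    have sgsh: "?sg * ?sh = ?u (- top_weight (\<lambda>n. n $ i) g) * ?u (- top_weight (\<lambda>n. n $ i) h) * (?t g * ?t h)"
      by (simp only: mult_ac)
    have "f dvd ?sg * ?sh" unfolding sgsh by (rule dvd_mult[OF fdvd])
    moreover have "?sg \<in> laurent_sub S" "?sh \<in> laurent_sub S"
      using less.prems i by (auto intro!: shift_homogeneous)
    ultimately have "f dvd ?sg \<or> f dvd ?sh"
      using P f unfolding irreducibles_prime_on_def by blast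
    then have tops: "f dvd ?t g \<or> f dvd ?t h"
      by (simp add: dvd_unit_times_iff unit_single)
    have card: "card (Poly_Mapping.keys (y - ?t y)) < card (Poly_Mapping.keys y)" if y: "y \<noteq> 0" for y :: "(int ^ 'd) \<Rightarrow>\<^sub>0 'b"
    proof (rule psubset_card_mono)
      obtain m where m: "m \<in> Poly_Mapping.keys y" "m $ i = top_weight (\<lambda>n. n $ i) y"
        using top_weight_attained[OF y] .
      then have "m \<notin> Poly_Mapping.keys (y - ?t y)" by (simp add: in_keys_iff lookup_minus lookup_pm_part)
      moreover have "Poly_Mapping.keys (y - ?t y) \<subseteq> Poly_Mapping.keys y"
        by (auto simp: in_keys_iff lookup_minus lookup_pm_part split: if_splits)
      ultimately show "Poly_Mapping.keys (y - ?t y) \<subset> Poly_Mapping.keys y" using m(1) by blast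
    qed simp
    from tops show ?thesis
    proof
      assume d: "f dvd ?t g"
      have "f dvd (g - ?t g) * h" using less.prems(3) d by (simp add: left_diff_distrib)
      then have "f dvd g - ?t g \<or> f dvd h"
        using card[of g] False less.prems
        by (intro less.hyps) (auto intro: laurent_sub_diff laurent_sub_part)
      then show ?thesis using dvd_add[OF _ d, of "g - ?t g"] by auto
    next
      assume d: "f dvd ?t h"
      have "f dvd g * (h - ?t h)" using less.prems(3) d by (simp add: right_diff_distrib)
      then have "f dvd g \<or> f dvd h - ?t h"
        using card[of h] False less.prems
        by (intro less.hyps) (auto intro: laurent_sub_diff laurent_sub_part)
      then show ?thesis using dvd_add[OF _ d, of "h - ?t h"] by auto
    qed
  qed auto
qed

text \<open>Stands in for the theory of contents: the irreducible factors of \<open>c\<close>, all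
  free of the variable \<open>i\<close>, are handed out one after another to \<open>v\<close> or
  \<open>w\<close>, as \<open>prime_adjoin_degree_0\<close> permits.\<close>

lemma split_constant_factor:
  fixes c y v w :: "(int ^ 'd::finite) \<Rightarrow>\<^sub>0 'b::field"
  assumes P: "irreducibles_prime_on S TYPE('b)" and i: "i \<notin> S"
    and c: "c \<in> laurent_sub S" "c \<noteq> 0"
    and yvw: "v \<in> laurent_sub (insert i S)" "w \<in> laurent_sub (insert i S)" "c * y = v * w"
  shows "\<exists>c1 c2 v' w'. c1 \<in> laurent_sub S \<and> c2 \<in> laurent_sub S \<and>
    c = c1 * c2 \<and> v = c1 * v' \<and> w = c2 * w' \<and> y = v' * w'"
  using c yvw
proof (induction "laurent_size c" arbitrary: c y v w rule: less_induct)
  case less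
  let ?T = "insert i S"
  have cT: "c \<in> laurent_sub ?T" using less.prems(1) laurent_sub_mono by blast
  consider "c dvd 1" | "irreducible c" | a b where "c = a * b" "\<not> a dvd 1" "\<not> b dvd 1"
    using less.prems(2) unfolding irreducible_def by blast
  then show ?case
  proof cases
    case 1
    then obtain b where b: "1 = c * b" by (rule dvdE)
    have "b \<in> laurent_sub S" using laurent_sub_quotient[OF less.prems(1,2), of b] b by simp
    have "v = c * (b * v)" by (simp flip: mult.assoc b)
    moreover have "y = b * v * w"
    proof -
      have "y = c * b * y" by (simp flip: b)
      also have "\<dots> = b * (c * y)" by (simp only: mult_ac)
      finally show ?thesis by (simp only: less.prems(5) mult_ac)
    qed
    ultimately show ?thesis using less.prems(1)
      by (intro exI[of _ c] exI[of _ 1] exI[of _ "b * v"] exI[of _ w]) auto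
  next
    case 2
    have "c dvd v * w" using dvd_triv_left[of c y] unfolding less.prems(5) .
    then have "c dvd v \<or> c dvd w"
      using prime_adjoin_degree_0[OF P i 2 less.prems(1)] less.prems by blast
    then show ?thesis
    proof
      assume "c dvd v"
      then obtain v' where v': "v = c * v'" by (rule dvdE)
      have "c * y = c * (v' * w)" by (simp only: less.prems(5) v' mult.assoc)
      then have "y = v' * w" by (rule laurent_mult_cancel_left[OF less.prems(2)])
      with v' show ?thesis using less.prems(1)
        by (intro exI[of _ c] exI[of _ 1] exI[of _ v'] exI[of _ w]) auto
    next
      assume "c dvd w"
      then obtain w' where w': "w = c * w'" by (rule dvdE)
      have "c * y = c * (v * w')" by (simp only: less.prems(5) w' mult_ac)
      then have "y = v * w'" by (rule laurent_mult_cancel_left[OF less.prems(2)])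
      with w' show ?thesis using less.prems(1)
        by (intro exI[of _ 1] exI[of _ c] exI[of _ v] exI[of _ w']) auto
    qed
  next
    case 3
    have nz: "a \<noteq> 0" "b \<noteq> 0" using 3(1) less.prems(2) by auto
    \<comment> \<open>The factors \<open>a\<close> and \<open>b\<close> come from the whole ring; a
      monomial shift brings them into \<open>laurent_sub S\<close>, where the induction hypothesis
      applies.\<close>
    obtain m where "Poly_Mapping.single m 1 * a \<in> laurent_sub S"
      "Poly_Mapping.single (- m) 1 * b \<in> laurent_sub S"
      using laurent_sub_factor[of a b S] nz 3(1) less.prems(1) by blast
    moreover define a' b' where "a' = Poly_Mapping.single m 1 * a"
      and "b' = Poly_Mapping.single (- m) 1 * b"
    ultimately have sub: "a' \<in> laurent_sub S" "b' \<in> laurent_sub S" by auto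
    have "a' * b' = (Poly_Mapping.single m 1 * Poly_Mapping.single (- m) 1) * (a * b)"
      unfolding a'_def b'_def by (simp only: mult_ac)
    then have ab: "c = a' * b'" using 3(1) by (simp add: mult_single)
    have nz': "a' \<noteq> 0" "b' \<noteq> 0" using ab less.prems(2) by auto
    have nu: "\<not> a' dvd 1" "\<not> b' dvd 1"
      using 3 by (auto simp: a'_def b'_def unit_times_unit_iff unit_single)
    have sz: "laurent_size a' < laurent_size c" "laurent_size b' < laurent_size c"
      using laurent_size_pos[OF nz'(1) nu(1)] laurent_size_pos[OF nz'(2) nu(2)]
      by (simp_all add: ab laurent_size_times nz')
    have "a' * (b' * y) = v * w" using less.prems(5) by (simp add: ab mult.assoc)
    from less.hyps[OF sz(1) sub(1) nz'(1) less.prems(3,4) this]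
    obtain c1 c2 v' w' where 1: "c1 \<in> laurent_sub S" "c2 \<in> laurent_sub S" "a' = c1 * c2"
      "v = c1 * v'" "w = c2 * w'" "b' * y = v' * w'" by blast
    have "c1 \<noteq> 0" "c2 \<noteq> 0" using 1(3) nz' by auto
    then have "v' \<in> laurent_sub ?T" "w' \<in> laurent_sub ?T"
      using laurent_sub_quotient[of c1 ?T v'] laurent_sub_quotient[of c2 ?T w']
        1 less.prems(3,4) laurent_sub_mono[of _ S ?T] by auto
    from less.hyps[OF sz(2) sub(2) nz'(2) this 1(6)]
    obtain d1 d2 v'' w'' where 2: "d1 \<in> laurent_sub S" "d2 \<in> laurent_sub S" "b' = d1 * d2"
      "v' = d1 * v''" "w' = d2 * w''" "y = v'' * w''" by blast
    show ?thesis
      using 1 2 by (intro exI[of _ "c1 * d1"] exI[of _ "c2 * d2"] exI[of _ v''] exI[of _ w''])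
        (auto simp: ab mult_ac laurent_sub_times)
  qed
qed

text \<open>Euclidean division in the variable \<open>i\<close> over coefficients that cannot be
  inverted: \<open>y\<close> is multiplied by the leading coefficient of \<open>e\<close> at every
  step, and these factors accumulate in \<open>c\<close>.\<close>

lemma pseudo_division:
  fixes e y :: "(int ^ 'd::finite) \<Rightarrow>\<^sub>0 'b::field"
  assumes i: "i \<notin> S" and e: "e \<in> laurent_sub (insert i S)" "e \<noteq> 0"
    and y: "y \<in> laurent_sub (insert i S)"
  shows "\<exists>c q. c \<in> laurent_sub S \<and> c \<noteq> 0 \<and> q \<in> laurent_sub (insert i S) \<and>
    (c * y = q * e \<or> width i (c * y - q * e) < width i e)"
  using y
proof (induction "width i y" arbitrary: y rule: less_induct)
  case less
  let ?T = "insert i S"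
  show ?case
  proof (cases "y = 0 \<or> width i y < width i e")
    case True
    then show ?thesis by (intro exI[of _ 1] exI[of _ 0]) auto
  next
    case False
    let ?top = "\<lambda>f :: (int ^ 'd) \<Rightarrow>\<^sub>0 'b. top_weight (\<lambda>n. n $ i) f"
    let ?bot = "\<lambda>f :: (int ^ 'd) \<Rightarrow>\<^sub>0 'b. - top_weight (\<lambda>n. - (n $ i)) f"
    let ?p = "\<lambda>k f :: (int ^ 'd) \<Rightarrow>\<^sub>0 'b. pm_part (\<lambda>n. n $ i = k) f"
    let ?u = "\<lambda>k. Poly_Mapping.single (axis i k) 1 :: (int ^ 'd) \<Rightarrow>\<^sub>0 'b"
    define \<alpha> where "\<alpha> = ?u (- ?top e) * ?p (?top e) e"
    define \<beta> where "\<beta> = ?u (- ?top y) * ?p (?top y) y"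
    define k where "k = ?top y - ?top e"
    \<comment> \<open>\<open>\<alpha>\<close> and \<open>\<beta>\<close> are the leading
      coefficients of \<open>e\<close> and \<open>y\<close>, and the shift by \<open>k\<close>
      aligns the tops, so the leading terms cancel.\<close>
    define z where "z = \<alpha> * y - \<beta> * (?u k * e)"
    have \<alpha>S: "\<alpha> \<in> laurent_sub S" and \<beta>S: "\<beta> \<in> laurent_sub S"
      unfolding \<alpha>_def \<beta>_def using e less.prems i by (auto intro: shift_homogeneous)
    have \<alpha>0: "\<alpha> \<noteq> 0"
    proof
      assume "\<alpha> = 0"
      then have "?u (?top e) * \<alpha> = 0" by simp
      then have "?p (?top e) e = 0" by (simp add: \<alpha>_def single_axis_cancel)
      then show False using top_part_nonzero[OF e(2), of "\<lambda>n. n $ i"] by simp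
    qed
    have qT: "\<beta> * ?u k \<in> laurent_sub ?T"
      using laurent_sub_mono[OF \<beta>S] by (intro laurent_sub_times laurent_sub_single_axis) auto
    have zT: "z \<in> laurent_sub ?T"
      unfolding z_def mult.assoc[symmetric]
      by (intro laurent_sub_diff laurent_sub_times[of \<alpha>] laurent_sub_times[of "\<beta> * ?u k"]
        laurent_sub_mono[OF \<alpha>S subset_insertI] less.prems e(1) qT)
    have ytop: "?p (?top y) y = ?u (?top y) * \<beta>" and etop: "?p (?top e) e = ?u (?top e) * \<alpha>"
      unfolding \<alpha>_def \<beta>_def by (simp_all add: single_axis_cancel)
    have keys_z: "?bot y \<le> n $ i \<and> n $ i \<le> ?top y - 1" if n: "n \<in> Poly_Mapping.keys z" for n
    proof -
      \<comment> \<open>Secures the lower end: as \<open>e\<close> is not wider than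
        \<open>y\<close>, the shifted \<open>e\<close> with its top aligned does not reach below the
        bottom of \<open>y\<close>.\<close>
      have we: "?top e - ?bot e \<le> ?top y - ?bot y"
        using False top_weight_sum_nonneg[OF e(2), of "\<lambda>n. n $ i"]
          top_weight_sum_nonneg[of y "\<lambda>n. n $ i"] by (auto simp: width_def)
      have "n \<in> Poly_Mapping.keys (?p (n $ i) z)" using n by (simp add: keys_pm_part)
      moreover have pz: "?p j z = \<alpha> * ?p j y - \<beta> * ?p j (?u k * e)" for j
      proof -
        have "?p j z = ?p j (\<alpha> * y) - ?p j (\<beta> * (?u k * e))"
          unfolding z_def by (rule poly_mapping_eqI) (simp add: lookup_pm_part lookup_minus)
        then show ?thesis by (simp add: part_times_degree_0[OF \<alpha>S i] part_times_degree_0[OF \<beta>S i])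
      qed
      ultimately have nz: "\<alpha> * ?p (n $ i) y - \<beta> * ?p (n $ i) (?u k * e) \<noteq> 0" by auto
      have uep: "?p j (?u k * e) = ?u k * ?p (j - k) e" for j
        by (rule poly_mapping_eqI) (auto simp: lookup_pm_part lookup_single_times axis_def)
      have "n $ i \<noteq> ?top y"
      proof
        assume n: "n $ i = ?top y"
        have k: "?top y - k = ?top e" by (simp add: k_def)
        have "axis i k + axis i (?top e) = axis i (?top y)"
          by (simp add: vec_eq_iff axis_def k_def)
        then have u: "?u (?top y) = ?u k * ?u (?top e)" by (simp add: mult_single)
        have "\<alpha> * ?p (n $ i) y = \<alpha> * (?u k * ?u (?top e) * \<beta>)" unfolding n ytop u ..
        also have "\<dots> = \<beta> * (?u k * (?u (?top e) * \<alpha>))" by (simp only: mult_ac)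
        also have "\<dots> = \<beta> * ?p (n $ i) (?u k * e)" unfolding n uep k etop ..
        finally show False using nz by simp
      qed
      moreover have "?p (n $ i) y \<noteq> 0 \<or> ?p (n $ i - k) e \<noteq> 0" using nz by (auto simp: uep)
      then have "\<exists>m. (m \<in> Poly_Mapping.keys y \<and> m $ i = n $ i) \<or>
          (m \<in> Poly_Mapping.keys e \<and> m $ i = n $ i - k)"
        using ex_in_keys[of "?p (n $ i) y"] ex_in_keys[of "?p (n $ i - k) e"] by (auto simp: keys_pm_part)
      then obtain m where "(m \<in> Poly_Mapping.keys y \<and> m $ i = n $ i) \<or>
          (m \<in> Poly_Mapping.keys e \<and> m $ i = n $ i - k)" ..
      then have "?bot y \<le> n $ i \<and> n $ i \<le> ?top y"
      proof
        assume "m \<in> Poly_Mapping.keys y \<and> m $ i = n $ i"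
        then show ?thesis using top_weight_ge[of m y "\<lambda>n. n $ i"] top_weight_ge[of m y "\<lambda>n. - (n $ i)"]
          by simp
      next
        assume "m \<in> Poly_Mapping.keys e \<and> m $ i = n $ i - k"
        then show ?thesis using top_weight_ge[of m e "\<lambda>n. n $ i"] top_weight_ge[of m e "\<lambda>n. - (n $ i)"] we
          by (simp add: k_def)
      qed
      ultimately show ?thesis by simp
    qed
    show ?thesis
    proof (cases "z = 0")
      case True
      then have "\<alpha> * y = \<beta> * ?u k * e" by (simp add: z_def mult.assoc)
      then show ?thesis using \<alpha>S \<alpha>0 qT by blast
    next
      case z0: False
      have "int (width i z) \<le> ?top y - 1 - ?bot y" using keys_z z0 by (rule width_bound) 
      then have "width i z < width i y"
        using top_weight_sum_nonneg[OF z0, of "\<lambda>n. n $ i"] by (simp add: width_def)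
      from less.hyps[OF this zT] obtain c q where cq: "c \<in> laurent_sub S" "c \<noteq> 0"
        "q \<in> laurent_sub ?T" "c * z = q * e \<or> width i (c * z - q * e) < width i e" by blast
      have eq: "c * \<alpha> * y - (q + c * (\<beta> * ?u k)) * e = c * z - q * e"
        unfolding z_def by (simp add: algebra_simps)
      then have "c * \<alpha> * y = (q + c * (\<beta> * ?u k)) * e \<or>
          width i (c * \<alpha> * y - (q + c * (\<beta> * ?u k)) * e) < width i e"
        using cq(4) by auto
      moreover have "c * \<alpha> \<in> laurent_sub S" "c * \<alpha> \<noteq> 0" "q + c * (\<beta> * ?u k) \<in> laurent_sub ?T"
        using cq \<alpha>S \<alpha>0 qT laurent_sub_mono[OF cq(1), of ?T]
        by (auto simp: laurent_times_eq_0_iff intro!: laurent_sub_add laurent_sub_times)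
      ultimately show ?thesis by blast
    qed
  qed
qed

lemma width_unit:
  fixes f :: "(int ^ 'd::finite) \<Rightarrow>\<^sub>0 'b::field"
  assumes "f dvd 1" shows "width i f = 0"
proof -
  obtain g where g: "1 = f * g" using assms by (rule dvdE)
  have "top_weight \<theta> (1 :: (int ^ 'd) \<Rightarrow>\<^sub>0 'b) = \<theta> 0" for \<theta> :: "int ^ 'd \<Rightarrow> int"
    by (simp add: top_weight_def)
  then have "width i (1 :: (int ^ 'd) \<Rightarrow>\<^sub>0 'b) = 0" by (simp add: width_def)
  moreover have "f \<noteq> 0" "g \<noteq> 0" using g by auto
  ultimately show ?thesis using width_times[of f g i] by (simp flip: g)
qed

lemma width_laurent_sub:
  assumes "f \<in> laurent_sub S" "f \<noteq> 0" "i \<notin> S" shows "width i f = 0"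
  using laurent_sub_top_weight[OF assms] by (simp add: width_def)

lemma width_0_shift:
  fixes f :: "(int ^ 'd::finite) \<Rightarrow>\<^sub>0 'b::field"
  assumes "f \<in> laurent_sub (insert i S)" "i \<notin> S" "width i f = 0"
  obtains k where "Poly_Mapping.single (axis i k) 1 * f \<in> laurent_sub S"
proof (cases "f = 0")
  case False
  then obtain m where m: "m \<in> Poly_Mapping.keys f" using ex_in_keys by blast
  have "n $ i = m $ i" if "n \<in> Poly_Mapping.keys f" for n
    using width_ge[OF m that, of i] width_ge[OF that m, of i] assms(3) by simp
  then have "pm_part (\<lambda>n. n $ i = m $ i) f = f"
    by (intro poly_mapping_eqI) (auto simp: lookup_pm_part in_keys_iff)
  then show ?thesis using shift_homogeneous[OF assms(1,2), of "m $ i"] that[of "- (m $ i)"] by simp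
qed (use that[of 0] in simp)

text \<open>\<open>split_constant_factor\<close> writes \<open>f\<close> as \<open>c1 * f'\<close>
  with \<open>f'\<close> dividing \<open>y\<close>. The positive width of \<open>f\<close> sits
  entirely in \<open>f'\<close>, so irreducibility makes \<open>c1\<close> a unit.\<close>

lemma dvd_cancel_constant:
  fixes f c y :: "(int ^ 'd::finite) \<Rightarrow>\<^sub>0 'b::field"
  assumes P: "irreducibles_prime_on S TYPE('b)" and i: "i \<notin> S"
    and f: "irreducible f" "f \<in> laurent_sub (insert i S)" "width i f \<noteq> 0"
    and c: "c \<in> laurent_sub S" "c \<noteq> 0"
    and y: "y \<in> laurent_sub (insert i S)" "f dvd c * y"
  shows "f dvd y"
proof -
  obtain q where q: "c * y = f * q" using y(2) by (rule dvdE)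
  have f0: "f \<noteq> 0" using f(1) by auto
  have "f * q \<in> laurent_sub (insert i S)"
    unfolding q[symmetric] using y(1) laurent_sub_mono[OF c(1) subset_insertI] by (rule laurent_sub_times[rotated])
  then have "q \<in> laurent_sub (insert i S)" using laurent_sub_quotient[OF f(2) f0] by blast
  from split_constant_factor[OF P i c f(2) this q]
  obtain c1 c2 f' q' where s: "c1 \<in> laurent_sub S" "f = c1 * f'" "y = f' * q'" by blast
  have nz: "c1 \<noteq> 0" "f' \<noteq> 0" using f0 s(2) by auto
  have "c1 dvd 1 \<or> f' dvd 1" using irreducibleD[OF f(1) s(2)] .
  moreover have "\<not> f' dvd 1"
    using f(3) width_unit[of f' i] width_laurent_sub[OF s(1) nz(1) i] width_times[OF nz, of i] by (auto simp: s(2))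
  ultimately have "c1 dvd 1" by blast
  then have "f dvd f'" unfolding s(2) by (simp add: unit_times_dvd_iff)
  then show ?thesis unfolding s(3) by (rule dvd_mult2)
qed

text \<open>Imitates the Euclidean argument over the fraction field of the coefficients. Take
  \<open>e\<close> of least width in the ideal spanned by \<open>f\<close> and \<open>g\<close>. If
  its width is 0, it is a coefficient up to a monomial, and \<open>f dvd e * h\<close> leads to
  \<open>f dvd h\<close>. Otherwise \<open>e\<close> is a multiple of \<open>f\<close> that divides
  a coefficient multiple of \<open>g\<close>.\<close>

lemma irreducibles_prime_on_insert:
  fixes i :: "'d::finite"
  assumes P: "irreducibles_prime_on S TYPE('b::field)" and i: "i \<notin> S"
  shows "irreducibles_prime_on (insert i S) TYPE('b)"
  unfolding irreducibles_prime_on_def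
proof (intro allI impI)
  fix f g h :: "(int ^ 'd) \<Rightarrow>\<^sub>0 'b"
  let ?T = "insert i S"
  assume f: "irreducible f" "f \<in> laurent_sub ?T" and g: "g \<in> laurent_sub ?T"
    and h: "h \<in> laurent_sub ?T" and fgh: "f dvd g * h"
  have f0: "f \<noteq> 0" using f(1) by auto
  show "f dvd g \<or> f dvd h"
  proof (cases "width i f = 0")
    case True
    obtain k where k: "Poly_Mapping.single (axis i k) 1 * f \<in> laurent_sub S"
      using width_0_shift[OF f(2) i True] .
    have u: "Poly_Mapping.single (axis i k) (1::'b) dvd 1" by (rule unit_single) simp
    show ?thesis
      using prime_adjoin_degree_0[OF P i irreducible_unit_times[OF u f(1)] k g h] fgh
      unfolding unit_times_dvd_iff[OF u] by blast
  next
    case wf: False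
    define J where "J = {y. \<exists>s\<in>laurent_sub ?T. \<exists>t\<in>laurent_sub ?T. y = s * f + t * g}"
    have fJ: "f \<in> J" unfolding J_def by (rule CollectI, rule bexI[of _ 1], rule bexI[of _ 0]) auto
    have gJ: "g \<in> J" unfolding J_def by (rule CollectI, rule bexI[of _ 0], rule bexI[of _ 1]) auto
    have "\<exists>e. (e \<in> J \<and> e \<noteq> 0) \<and> (\<forall>y. y \<in> J \<and> y \<noteq> 0 \<longrightarrow> width i e \<le> width i y)"
      by (rule ex_has_least_nat[of "\<lambda>y. y \<in> J \<and> y \<noteq> 0" f "width i"]) (use fJ f0 in blast)
    then obtain e where e: "e \<in> J" "e \<noteq> 0"
      and min: "\<And>y. y \<in> J \<Longrightarrow> y \<noteq> 0 \<Longrightarrow> width i e \<le> width i y" by blast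
    obtain s t where st: "s \<in> laurent_sub ?T" "t \<in> laurent_sub ?T" "e = s * f + t * g"
      using e(1) unfolding J_def by blast
    have JT: "y \<in> laurent_sub ?T" if "y \<in> J" for y
      using that f(2) g unfolding J_def by (auto intro!: laurent_sub_add laurent_sub_times)
    \<comment> \<open>A nonzero pseudo-remainder would be an element of \<open>J\<close> narrower
      than \<open>e\<close>; so \<open>e\<close> divides every element of \<open>J\<close> up to a
      coefficient.\<close>
    have div: "\<exists>c q. c \<in> laurent_sub S \<and> c \<noteq> 0 \<and> q \<in> laurent_sub ?T \<and> c * y = q * e" if y: "y \<in> J" for y
    proof -
      obtain c q where cq: "c \<in> laurent_sub S" "c \<noteq> 0" "q \<in> laurent_sub ?T"
        "c * y = q * e \<or> width i (c * y - q * e) < width i e"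
        using pseudo_division[OF i JT[OF e(1)] e(2) JT[OF y]] by blast
      obtain s' t' where st': "s' \<in> laurent_sub ?T" "t' \<in> laurent_sub ?T" "y = s' * f + t' * g"
        using y unfolding J_def by blast
      have "c * y - q * e = (c * s' - q * s) * f + (c * t' - q * t) * g"
        unfolding st(3) st'(3) by (simp add: algebra_simps)
      moreover have "c * s' - q * s \<in> laurent_sub ?T" "c * t' - q * t \<in> laurent_sub ?T"
        using laurent_sub_mono[OF cq(1) subset_insertI, of i] cq(3) st st'
        by (simp_all add: laurent_sub_diff laurent_sub_times)
      ultimately have "c * y - q * e \<in> J" unfolding J_def by blast
      then have "c * y = q * e" using min[of "c * y - q * e"] cq(4) by fastforce
      then show ?thesis using cq by blast
    qed
    show ?thesis
    proof (cases "width i e = 0")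
      case True
      obtain k where k: "Poly_Mapping.single (axis i k) 1 * e \<in> laurent_sub S"
        using width_0_shift[OF JT[OF e(1)] i True] .
      have u: "Poly_Mapping.single (axis i k) (1::'b) dvd 1" by (rule unit_single) simp
      have "e * h = f * (s * h) + t * (g * h)" unfolding st(3) by (simp add: algebra_simps)
      then have "f dvd e * h" using fgh by simp
      then have "f dvd (Poly_Mapping.single (axis i k) 1 * e) * h"
        unfolding mult.assoc by (rule dvd_mult)
      moreover have "Poly_Mapping.single (axis i k) 1 * e \<noteq> 0"
        using e(2) u by (auto simp: laurent_times_eq_0_iff)
      ultimately have "f dvd h" using dvd_cancel_constant[OF P i f wf k _ h] by blast
      then show ?thesis ..
    next
      case we: False
      obtain c q where cq: "c \<in> laurent_sub S" "c \<noteq> 0" "q \<in> laurent_sub ?T" "c * f = q * e"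
        using div[OF fJ] by blast
      from split_constant_factor[OF P i cq(1,2,3) JT[OF e(1)] cq(4)]
      obtain a b q' e' where sp: "b \<in> laurent_sub S" "e = b * e'" "f = q' * e'" by blast
      have nz: "b \<noteq> 0" "e' \<noteq> 0" using e(2) sp(2) by auto
      have "q' dvd 1 \<or> e' dvd 1" using irreducibleD[OF f(1) sp(3)] .
      \<comment> \<open>The width of \<open>e\<close> is positive and \<open>b\<close> contributes
        nothing to it, so \<open>e'\<close> is no unit; irreducibility then makes \<open>f\<close>
        and \<open>e'\<close> associates.\<close>
      moreover have "\<not> e' dvd 1"
        using we width_unit[of e' i] width_laurent_sub[OF sp(1) nz(1) i] width_times[OF nz, of i] by (auto simp: sp(2))
      ultimately have "q' dvd 1" by blast
      then have "f dvd e'" unfolding sp(3) by (simp add: unit_times_dvd_iff)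
      then have fe: "f dvd e" unfolding sp(2) by (rule dvd_mult)
      obtain c2 q2 where c2: "c2 \<in> laurent_sub S" "c2 \<noteq> 0" "c2 * g = q2 * e"
        using div[OF gJ] by blast
      have "f dvd c2 * g" unfolding c2(3) using fe by (rule dvd_mult)
      then have "f dvd g" using dvd_cancel_constant[OF P i f wf c2(1,2) g] by blast
      then show ?thesis ..
    qed
  qed
qed

text \<open>Variables are adjoined one at a time. The induction starts vacuously: without variables
  every nonzero element is a unit.\<close>

theorem laurent_irreducible_imp_prime_elem:
  fixes f :: "(int ^ 'd::finite) \<Rightarrow>\<^sub>0 'b::field"
  assumes "irreducible f"
  shows "prime_elem f"
proof -
  have "irreducibles_prime_on S TYPE('b)" for S :: "'d set"
    using finite[of S]
  proof (induction S rule: finite_induct)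
    show "irreducibles_prime_on ({} :: 'd set) TYPE('b)"
      unfolding irreducibles_prime_on_def
    proof (intro allI impI)
      fix f g h :: "(int ^ 'd) \<Rightarrow>\<^sub>0 'b"
      assume f: "irreducible f" "f \<in> laurent_sub {}"
      then have "f dvd 1" by (intro width_0_imp_unit width_laurent_sub[of f "{}"]) auto
      then show "f dvd g \<or> f dvd h" using f(1) irreducible_not_unit by blast
    qed
  qed (rule irreducibles_prime_on_insert)
  from this[of UNIV] have "f dvd a * b \<Longrightarrow> f dvd a \<or> f dvd b" for a b
    using assms laurent_sub_UNIV unfolding irreducibles_prime_on_def by blast
  then show ?thesis
    using assms irreducible_not_unit by (intro prime_elemI) auto
qed

section \<open>Frobenius and Cartier operators\<close>

lemma laurent_monom_add: "laurent_monom (m + n) = laurent_monom m * laurent_monom n"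
  by (simp add: laurent_monom_def mult_single)

lemma laurent_monom_0 [simp]: "laurent_monom 0 = 1"
  by (simp add: laurent_monom_def)

lemma laurent_monom_unit: "laurent_monom n dvd 1"
  unfolding laurent_monom_def by (rule unit_single) simp

lemma lookup_laurent_monom_times:
  "Poly_Mapping.lookup (laurent_monom m * g) k = Poly_Mapping.lookup g (k - m)"
  by (simp add: laurent_monom_def lookup_single_times)

lemma laurent_monom_power: "laurent_monom n ^ k = laurent_monom (int k *s n)"
proof (induction k)
  case 0
  have "int 0 *s n = 0" by (simp add: vec_eq_iff)
  then show ?case by simp
next
  case (Suc k)
  have "int (Suc k) *s n = n + int k *s n" by (simp add: vec_eq_iff algebra_simps)
  then show ?case by (simp add: Suc laurent_monom_add)
qed

lemma CHAR_laurent: "CHAR(('d::finite, 'p::prime_card) laurent) = CARD('p)"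
proof (rule CHAR_eqI)
  show "of_nat CARD('p) = (0 :: ('d, 'p) laurent)"
    using of_nat_CHAR[where 'a = "'p mod_ring"] by (simp flip: single_of_nat)
  fix n assume "of_nat n = (0 :: ('d, 'p) laurent)"
  then have "Poly_Mapping.lookup (of_nat n :: ('d, 'p) laurent) 0 = 0" by simp
  then have "of_nat n = (0 :: 'p mod_ring)" by (simp flip: single_of_nat)
  then show "CARD('p) dvd n" by (rule of_nat_0_mod_ring_dvd)
qed

lemma prime_CHAR_laurent: "prime CHAR(('d::finite, 'p::prime_card) laurent)"
  unfolding CHAR_laurent by (rule prime_card)

lemma mod_ring_power_card: "(c :: 'p::prime_card mod_ring) ^ CARD('p) = c"
  using finite_field_power_card_eq_same[of c] by simp

text \<open>Frobenius is additive and fixes the coefficients, which lie in the prime field, so it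
  acts on exponents alone.\<close>

lemma laurent_power_CARD:
  fixes x :: "('d::finite, 'p::prime_card) laurent"
  shows "x ^ CARD('p) =
    (\<Sum>n\<in>Poly_Mapping.keys x. Poly_Mapping.single (int CARD('p) *s n) (Poly_Mapping.lookup x n))"
proof -
  have pow: "Poly_Mapping.single n c ^ k = Poly_Mapping.single (int k *s n) (c ^ k)"
    for n :: "int ^ 'd" and c :: "'p mod_ring" and k
  proof (induction k)
    case 0
    have "int 0 *s n = 0" by (simp add: vec_eq_iff)
    then show ?case by simp
  next
    case (Suc k)
    have "int (Suc k) *s n = n + int k *s n" by (simp add: vec_eq_iff algebra_simps)
    then show ?case by (simp add: Suc mult_single)
  qed
  have "x ^ CARD('p) =
      (\<Sum>n\<in>Poly_Mapping.keys x. Poly_Mapping.single n (Poly_Mapping.lookup x n)) ^ CARD('p)"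
    by (simp add: sum_single_keys)
  also have "\<dots> = (\<Sum>n\<in>Poly_Mapping.keys x. Poly_Mapping.single n (Poly_Mapping.lookup x n) ^ CARD('p))"
    by (rule freshmans_dream_sum[OF prime_CHAR_laurent]) (simp add: CHAR_laurent)
  finally show ?thesis by (simp add: pow mod_ring_power_card)
qed

lemma CARD_smult_inj: "inj (\<lambda>n :: int ^ 'd. int CARD('p::prime_card) *s n + w)"
proof (rule injI)
  fix m n :: "int ^ 'd"
  have "CARD('p) \<noteq> 0" by simp
  assume "int CARD('p) *s m + w = int CARD('p) *s n + w"
  then show "m = n" by (simp add: vec_eq_iff)
qed

lemma lookup_power_CARD:
  fixes x :: "('d::finite, 'p::prime_card) laurent"
  shows "Poly_Mapping.lookup (x ^ CARD('p)) (int CARD('p) *s n) = Poly_Mapping.lookup x n"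
proof -
  have "int CARD('p) *s m = int CARD('p) *s n \<longleftrightarrow> m = n" for m
    by (simp add: vec_eq_iff)
  then show ?thesis
    by (simp add: laurent_power_CARD lookup_sum lookup_single when_def in_keys_iff)
qed

lemma keys_power_CARD:
  fixes x :: "('d::finite, 'p::prime_card) laurent"
  shows "Poly_Mapping.keys (x ^ CARD('p)) = (\<lambda>n. int CARD('p) *s n) ` Poly_Mapping.keys x"
proof
  show "Poly_Mapping.keys (x ^ CARD('p)) \<subseteq> (\<lambda>n. int CARD('p) *s n) ` Poly_Mapping.keys x"
    unfolding laurent_power_CARD
    by (rule order_trans[OF keys_sum]) auto
  show "(\<lambda>n. int CARD('p) *s n) ` Poly_Mapping.keys x \<subseteq> Poly_Mapping.keys (x ^ CARD('p))"
    by (auto simp: in_keys_iff lookup_power_CARD)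
qed

text \<open>Keeps the exponents congruent to \<open>w\<close> modulo p, subtracts \<open>w\<close>
  and divides by p: a one-sided inverse of Frobenius on each residue class. Coefficients are left
  alone because they are their own p-th roots.\<close>

definition cartier :: "int ^ 'd \<Rightarrow> ('d::finite, 'p::prime_card) laurent \<Rightarrow> ('d, 'p) laurent"
  where "cartier w h = Poly_Mapping.map_key (\<lambda>n. int CARD('p) *s n + w) h"

lemma lookup_cartier:
  fixes h :: "('d::finite, 'p::prime_card) laurent"
  shows "Poly_Mapping.lookup (cartier w h) n = Poly_Mapping.lookup h (int CARD('p) *s n + w)"
  unfolding cartier_def by (subst map_key.rep_eq[OF CARD_smult_inj]) simp

lemma cartier_add: "cartier w (g + h) = cartier w g + cartier w h"
  by (rule poly_mapping_eqI) (simp add: lookup_cartier lookup_add)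

lemma cartier_0 [simp]: "cartier w 0 = 0"
  by (rule poly_mapping_eqI) (simp add: lookup_cartier)

lemma cartier_sum: "cartier w (sum h A) = (\<Sum>i\<in>A. cartier w (h i))"
  by (induction A rule: infinite_finite_induct) (simp_all add: cartier_add)

text \<open>The projection formula. A p-th power is supported on multiples of p, so it does not mix
  residue classes and leaves the operator with its exponents divided by p.\<close>

lemma cartier_power_times:
  fixes x h :: "('d::finite, 'p::prime_card) laurent"
  shows "cartier w (x ^ CARD('p) * h) = x * cartier w h"
proof (rule poly_mapping_eqI)
  fix k
  have inj: "inj_on (\<lambda>n :: int ^ 'd. int CARD('p) *s n) A" for A
    using CARD_smult_inj[where 'p = 'p and w = "0 :: int ^ 'd"] by (auto simp: inj_on_def)
  have arg: "int CARD('p) *s k + w - int CARD('p) *s m = int CARD('p) *s (k - m) + w" for m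
    by (simp add: vec_eq_iff algebra_simps)
  show "Poly_Mapping.lookup (cartier w (x ^ CARD('p) * h)) k = Poly_Mapping.lookup (x * cartier w h) k"
    unfolding lookup_cartier lookup_times_keys keys_power_CARD sum.reindex[OF inj]
    by (simp add: lookup_power_CARD arg)
qed

definition digit_box :: "nat \<Rightarrow> (int ^ 'd::finite) set"
  where "digit_box p = {w. \<forall>i. 0 \<le> w $ i \<and> w $ i < int p}"

lemma finite_vec_box: "finite {w :: int ^ 'd::finite. \<forall>i. a \<le> w $ i \<and> w $ i \<le> b}"
proof -
  have "{w :: int ^ 'd. \<forall>i. a \<le> w $ i \<and> w $ i \<le> b} \<subseteq> vec_lambda ` (PiE UNIV (\<lambda>_. {a..b}))"
  proof
    fix w :: "int ^ 'd" assume "w \<in> {w. \<forall>i. a \<le> w $ i \<and> w $ i \<le> b}"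
    then have "vec_nth w \<in> PiE UNIV (\<lambda>_. {a..b})" by auto
    then show "w \<in> vec_lambda ` (PiE UNIV (\<lambda>_. {a..b}))" by (metis image_eqI vec_nth_inverse)
  qed
  then show ?thesis by (rule finite_subset) (intro finite_imageI finite_PiE, auto)
qed

lemma finite_digit_box: "finite (digit_box p)"
  by (rule finite_subset[OF _ finite_vec_box[of 0 "int p"]]) (auto simp: digit_box_def less_imp_le)

lemma digit_decomposition:
  fixes n :: "int ^ 'd::finite"
  assumes "p > 0"
  obtains m w where "w \<in> digit_box p" "n = int p *s m + w"
proof
  show "(\<chi> i. n $ i mod int p) \<in> digit_box p" using assms by (simp add: digit_box_def)
  show "n = int p *s (\<chi> i. n $ i div int p) + (\<chi> i. n $ i mod int p)" by (simp add: vec_eq_iff)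
qed

lemma digit_unique:
  fixes m n :: "int ^ 'd::finite"
  assumes "w \<in> digit_box p" "v \<in> digit_box p" "int p *s m + w = int p *s n + v"
  shows "m = n" "w = v"
proof -
  have eq: "int p * m $ i + w $ i = int p * n $ i + v $ i" for i
    using assms(3) by (simp add: vec_eq_iff)
  have wv: "0 \<le> w $ i" "w $ i < int p" "0 \<le> v $ i" "v $ i < int p" for i
    using assms by (auto simp: digit_box_def)
  have "m $ i = n $ i \<and> w $ i = v $ i" for i
  proof -
    have "(int p * m $ i + w $ i) div int p = m $ i" "(int p * n $ i + v $ i) div int p = n $ i"
      using wv[of i] by auto
    then show ?thesis using eq[of i] by auto
  qed
  then show "m = n" "w = v" by (auto simp: vec_eq_iff)
qed

text \<open>Every exponent has exactly one digit vector, so the monomials in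
  \<open>digit_box\<close> form a basis of the ring over its p-th powers.\<close>

lemma cartier_expansion:
  fixes h :: "('d::finite, 'p::prime_card) laurent"
  shows "h = (\<Sum>w\<in>digit_box CARD('p). laurent_monom w * cartier w h ^ CARD('p))"
proof (rule poly_mapping_eqI)
  fix k :: "int ^ 'd"
  have p0: "CARD('p) > 0" by simp
  obtain m v where v: "v \<in> digit_box CARD('p)" "k = int CARD('p) *s m + v"
    using digit_decomposition[OF p0, of k] .
  have "Poly_Mapping.lookup (cartier w h ^ CARD('p)) (k - w) = (if w = v then Poly_Mapping.lookup h k else 0)"
    if w: "w \<in> digit_box CARD('p)" for w
  proof (cases "w = v")
    case True
    then show ?thesis by (simp add: v lookup_power_CARD lookup_cartier)
  next
    case False
    have "k - w \<notin> Poly_Mapping.keys (cartier w h ^ CARD('p))"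
    proof
      assume "k - w \<in> Poly_Mapping.keys (cartier w h ^ CARD('p))"
      then obtain n where "k - w = int CARD('p) *s n" by (auto simp: keys_power_CARD)
      then have "int CARD('p) *s n + w = int CARD('p) *s m + v" using v(2) by (simp add: algebra_simps)
      then show False using digit_unique(2)[OF w v(1)] False by blast
    qed
    then show ?thesis using False by (simp add: in_keys_iff)
  qed
  then have "(\<Sum>w\<in>digit_box CARD('p). Poly_Mapping.lookup (cartier w h ^ CARD('p)) (k - w)) =
      (\<Sum>w\<in>digit_box CARD('p). if w = v then Poly_Mapping.lookup h k else 0)"
    by (intro sum.cong) auto
  then show "Poly_Mapping.lookup h k = Poly_Mapping.lookup
      (\<Sum>w\<in>digit_box CARD('p). laurent_monom w * cartier w h ^ CARD('p)) k"
    using v(1) by (simp add: lookup_sum lookup_laurent_monom_times finite_digit_box)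
qed

text \<open>By the expansion, \<open>f ^ CARD('p)\<close> divides
  \<open>f ^ (CARD('p) - 1) * b\<close>; now cancel. Its use is contrapositive: a coefficient
  outside the ideal survives the twisted operator for at least one digit.\<close>

lemma dvd_if_cartier_dvd:
  fixes f b :: "('d::finite, 'p::prime_card) laurent"
  assumes f: "f \<noteq> 0"
    and dvd: "\<And>w. w \<in> digit_box CARD('p) \<Longrightarrow> f dvd cartier w (f ^ (CARD('p) - 1) * b)"
  shows "f dvd b"
proof -
  let ?p = "CARD('p)"
  have pp: "f ^ ?p = f ^ (?p - 1) * f"
    using power_minus_mult[of ?p f] by simp
  have "f ^ ?p dvd (\<Sum>w\<in>digit_box ?p. laurent_monom w * cartier w (f ^ (?p - 1) * b) ^ ?p)"
    by (intro dvd_sum dvd_mult dvd_power_same dvd)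
  then have "f ^ ?p dvd f ^ (?p - 1) * b" by (simp flip: cartier_expansion)
  then obtain c where "f ^ (?p - 1) * b = f ^ (?p - 1) * f * c" unfolding pp by (rule dvdE)
  then have "f ^ (?p - 1) * b = f ^ (?p - 1) * (f * c)" by (simp only: mult.assoc)
  moreover have "f ^ k \<noteq> 0" for k using f by (induction k) (auto simp: laurent_times_eq_0_iff)
  ultimately have "b = f * c" using laurent_mult_cancel_left by blast
  then show ?thesis by simp
qed

section \<open>Relations along tuples of exponents that move apart\<close>

definition relation_at ::
  "('d::finite, 'p::prime_card) laurent \<Rightarrow> nat set \<Rightarrow> (nat \<Rightarrow> ('d, 'p) laurent) \<Rightarrow> (nat \<Rightarrow> int ^ 'd) \<Rightarrow> bool"
  where "relation_at f I a n \<longleftrightarrow> f dvd (\<Sum>i\<in>I. a i * laurent_monom (n i))"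

text \<open>
  \<open>far_apart I Q\<close> says that tuples indexed by \<open>I\<close> and satisfying \<open>Q\<close> can be found with all
  differences outside any prescribed finite set. It replaces sequences moving apart and is stable
  under splitting \<open>Q\<close> into finitely many cases.
\<close>

definition far_apart :: "nat set \<Rightarrow> ((nat \<Rightarrow> int ^ 'd::finite) \<Rightarrow> bool) \<Rightarrow> bool"
  where "far_apart I Q \<longleftrightarrow> (\<forall>K. finite K \<longrightarrow>
    (\<exists>n. Q n \<and> (\<forall>s\<in>I. \<forall>t\<in>I. s \<noteq> t \<longrightarrow> n s - n t \<notin> K)))"

lemma far_apartD:
  assumes "far_apart I Q" "finite K"
  shows "\<exists>n. Q n \<and> (\<forall>s\<in>I. \<forall>t\<in>I. s \<noteq> t \<longrightarrow> n s - n t \<notin> K)"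
  using assms unfolding far_apart_def by blast

lemma far_apart_mono:
  assumes "far_apart I Q" "J \<subseteq> I" "\<And>n. Q n \<Longrightarrow> R n" shows "far_apart J R"
  using assms unfolding far_apart_def by (meson subsetD)

text \<open>If every case failed, the union of the finitely many obstructing finite sets would
  obstruct the whole family. This replaces passing to a subsequence.\<close>

lemma far_apart_finite_cases:
  assumes "finite C" "far_apart I (\<lambda>n. \<exists>c\<in>C. Q c n)"
  obtains c where "c \<in> C" "far_apart I (Q c)"
proof (rule ccontr)
  assume neg: "\<not> thesis"
  have "\<forall>c\<in>C. \<exists>K. finite K \<and> (\<forall>n. Q c n \<longrightarrow> (\<exists>s\<in>I. \<exists>t\<in>I. s \<noteq> t \<and> n s - n t \<in> K))"
  proof
    fix c assume "c \<in> C"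
    then have "\<not> far_apart I (Q c)" using that neg by blast
    then show "\<exists>K. finite K \<and> (\<forall>n. Q c n \<longrightarrow> (\<exists>s\<in>I. \<exists>t\<in>I. s \<noteq> t \<and> n s - n t \<in> K))"
      by (simp add: far_apart_def)
  qed
  from bchoice[OF this] obtain K where K: "\<forall>c\<in>C. finite (K c) \<and>
    (\<forall>n. Q c n \<longrightarrow> (\<exists>s\<in>I. \<exists>t\<in>I. s \<noteq> t \<and> n s - n t \<in> K c))" ..
  have "finite (\<Union>c\<in>C. K c)" using assms(1) K by blast
  from far_apartD[OF assms(2) this] obtain n c where nc: "c \<in> C" "Q c n"
    and avoid: "\<forall>s\<in>I. \<forall>t\<in>I. s \<noteq> t \<longrightarrow> n s - n t \<notin> (\<Union>c\<in>C. K c)"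
    by blast
  from bspec[OF K nc(1)] nc(2) obtain s t where "s \<in> I" "t \<in> I" "s \<noteq> t" "n s - n t \<in> K c"
    by auto
  then show False using avoid nc(1) by auto
qed

text \<open>There are finitely many digit vectors, so one of them can be fixed. Differences of
  tuples and of quotients then determine each other, so the quotients remain far apart.\<close>

lemma far_apart_digits:
  assumes I: "finite I" and p: "p > 0" and far: "far_apart I Q"
  obtains g where "\<And>i. i \<in> I \<Longrightarrow> g i \<in> digit_box p"
    "far_apart I (\<lambda>m. \<exists>n. Q n \<and> (\<forall>i\<in>I. n i = int p *s m i + g i))"
proof -
  let ?G = "PiE I (\<lambda>_. digit_box p)"
  have "\<exists>g\<in>?G. \<exists>m. \<forall>i\<in>I. n i = int p *s m i + g i" for n :: "nat \<Rightarrow> int ^ 'a"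
  proof -
    have "\<exists>m w. w \<in> digit_box p \<and> n i = int p *s m + w" for i
      using digit_decomposition[OF p, of "n i"] by blast
    then obtain m w where "\<And>i. w i \<in> digit_box p" "\<And>i. n i = int p *s m i + w i" by metis
    then show ?thesis by (intro bexI[of _ "restrict w I"] exI[of _ m]) auto
  qed
  then have "far_apart I (\<lambda>n. \<exists>g\<in>?G. Q n \<and> (\<exists>m. \<forall>i\<in>I. n i = int p *s m i + g i))"
    by (intro far_apart_mono[OF far]) auto
  then obtain g where g: "g \<in> ?G" "far_apart I (\<lambda>n. Q n \<and> (\<exists>m. \<forall>i\<in>I. n i = int p *s m i + g i))"
    by (rule far_apart_finite_cases[rotated]) (use I finite_digit_box in \<open>auto intro: finite_PiE\<close>)
  have "far_apart I (\<lambda>m. \<exists>n. Q n \<and> (\<forall>i\<in>I. n i = int p *s m i + g i))"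
    unfolding far_apart_def
  proof (intro allI impI)
    fix K :: "(int ^ 'a) set" assume K: "finite K"
    \<comment> \<open>The differences of \<open>n\<close> that would arise from a difference of
      \<open>m\<close> in \<open>K\<close>; still a finite set.\<close>
    let ?K = "(\<lambda>(k, s, t). int p *s k + (g s - g t)) ` (K \<times> I \<times> I)"
    have "finite ?K" using K I by auto
    from far_apartD[OF g(2) this]
    obtain n m where n: "Q n" "\<forall>i\<in>I. n i = int p *s m i + g i"
      "\<forall>s\<in>I. \<forall>t\<in>I. s \<noteq> t \<longrightarrow> n s - n t \<notin> ?K"
      by blast
    have "m s - m t \<notin> K" if st: "s \<in> I" "t \<in> I" "s \<noteq> t" for s t
    proof
      assume k: "m s - m t \<in> K"
      have "n s - n t = int p *s (m s - m t) + (g s - g t)"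
        using n(2) st by (simp add: vec_eq_iff algebra_simps)
      moreover have "int p *s (m s - m t) + (g s - g t) \<in> ?K"
        by (rule image_eqI[of _ _ "(m s - m t, s, t)"]) (use k st in auto)
      ultimately have "n s - n t \<in> ?K" by (simp only:)
      then show False using n(3) st by blast
    qed
    then show "\<exists>m. (\<exists>n. Q n \<and> (\<forall>i\<in>I. n i = int p *s m i + g i)) \<and>
        (\<forall>s\<in>I. \<forall>t\<in>I. s \<noteq> t \<longrightarrow> m s - m t \<notin> K)"
      using n by blast
  qed
  then show ?thesis using that[of g] g(1) by auto
qed

text \<open>Multiplying by \<open>f ^ (CARD('p) - 1)\<close> turns the multiple of \<open>f\<close>
  into a multiple of \<open>f ^ CARD('p)\<close>, so one factor \<open>f\<close> is left after the
  Cartier operator. The digits are absorbed into the coefficients.\<close>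

lemma relation_at_digits:
  fixes f :: "('d::finite, 'p::prime_card) laurent"
  assumes "relation_at f I a n" "\<And>i. i \<in> I \<Longrightarrow> n i = int CARD('p) *s m i + g i"
  shows "relation_at f I (\<lambda>i. cartier w (f ^ (CARD('p) - 1) * (a i * laurent_monom (g i)))) m"
proof -
  let ?p = "CARD('p)"
  have pp: "f ^ ?p = f ^ (?p - 1) * f"
    using power_minus_mult[of ?p f] by simp
  obtain h where h: "(\<Sum>i\<in>I. a i * laurent_monom (n i)) = f * h"
    using assms(1) unfolding relation_at_def by (rule dvdE)
  have "f ^ ?p * h = f ^ (?p - 1) * (\<Sum>i\<in>I. a i * laurent_monom (n i))"
    by (simp only: h pp mult.assoc)
  also have "\<dots> = (\<Sum>i\<in>I. laurent_monom (m i) ^ ?p * (f ^ (?p - 1) * (a i * laurent_monom (g i))))"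
    unfolding sum_distrib_left
    by (intro sum.cong refl) (simp add: assms(2) laurent_monom_add laurent_monom_power mult_ac)
  finally have "cartier w (f ^ ?p * h) =
      cartier w (\<Sum>i\<in>I. laurent_monom (m i) ^ ?p * (f ^ (?p - 1) * (a i * laurent_monom (g i))))"
    by (rule arg_cong)
  then have "f * cartier w h =
      (\<Sum>i\<in>I. cartier w (f ^ (?p - 1) * (a i * laurent_monom (g i))) * laurent_monom (m i))"
    unfolding cartier_sum cartier_power_times by (simp only: mult.commute[of "laurent_monom _"])
  from dvdI[OF this[symmetric]] show ?thesis unfolding relation_at_def .
qed

text \<open>The way back from quotients to tuples: Frobenius produces the exponents
  \<open>n i - g i\<close>, and the monomials with exponent \<open>- g i\<close> in the coefficients
  make up for the difference.\<close>

lemma relation_at_power: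
  fixes f :: "('d::finite, 'p::prime_card) laurent"
  assumes "relation_at f I a m" "\<And>i. i \<in> I \<Longrightarrow> n i = int (CARD('p) ^ t) *s m i + g i"
  shows "relation_at f I (\<lambda>i. a i ^ (CARD('p) ^ t) * laurent_monom (- g i)) n"
proof -
  let ?q = "CARD('p) ^ t"
  have "f dvd (\<Sum>i\<in>I. a i * laurent_monom (m i)) ^ ?q"
    by (rule dvd_trans[OF assms(1)[unfolded relation_at_def] dvd_power]) simp
  also have "(\<Sum>i\<in>I. a i * laurent_monom (m i)) ^ ?q = (\<Sum>i\<in>I. (a i * laurent_monom (m i)) ^ ?q)"
    by (rule freshmans_dream_sum'[OF prime_CHAR_laurent]) (simp add: CHAR_laurent)
  also have "\<dots> = (\<Sum>i\<in>I. a i ^ ?q * laurent_monom (- g i) * laurent_monom (n i))"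
  proof (intro sum.cong refl)
    fix i assume i: "i \<in> I"
    have "(laurent_monom (m i) :: ('d, 'p) laurent) ^ ?q = laurent_monom (- g i + n i)"
      unfolding laurent_monom_power assms(2)[OF i] by (rule arg_cong[of _ _ laurent_monom]) simp
    then show "(a i * laurent_monom (m i)) ^ ?q = a i ^ ?q * laurent_monom (- g i) * laurent_monom (n i)"
      by (simp only: power_mult_distrib laurent_monom_add mult.assoc)
  qed
  finally show ?thesis unfolding relation_at_def .
qed

text \<open>
  In the fraction field of the quotient by \<open>f\<close>, \<open>power_link f I q N a b\<close> says that the projective
  points \<open>a\<close> and \<open>(b i ^ q * u ^ (- N i))\<close>, where \<open>i\<close> runs through \<open>I\<close>, coincide.
\<close>

definition power_link ::
  "('d::finite, 'p::prime_card) laurent \<Rightarrow> nat set \<Rightarrow> nat \<Rightarrow> (nat \<Rightarrow> int ^ 'd) \<Rightarrow>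
    (nat \<Rightarrow> ('d, 'p) laurent) \<Rightarrow> (nat \<Rightarrow> ('d, 'p) laurent) \<Rightarrow> bool"
  where "power_link f I q N a b \<longleftrightarrow> (\<forall>i\<in>I. \<forall>k\<in>I.
    f dvd a k * b i ^ q * laurent_monom (N k) - a i * b k ^ q * laurent_monom (N i))"

lemma dvd_diff_power: "(f :: 'a::comm_ring_1) dvd x - y \<Longrightarrow> f dvd x ^ q - y ^ q"
proof (induction q)
  case (Suc q)
  have "x ^ Suc q - y ^ Suc q = x * (x ^ q - y ^ q) + (x - y) * y ^ q" by (simp add: algebra_simps)
  then show ?case using Suc by simp
qed simp

lemma dvd_diff_times:
  "(f :: 'a::comm_ring_1) dvd x - x' \<Longrightarrow> f dvd y - y' \<Longrightarrow> f dvd x * y - x' * y'"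
proof -
  assume "f dvd x - x'" "f dvd y - y'"
  moreover have "x * y - x' * y' = (x - x') * y + x' * (y - y')" by (simp add: algebra_simps)
  ultimately show ?thesis by simp
qed

lemma prime_elem_dvd_power_imp_dvd:
  assumes "prime_elem (f :: 'a::comm_ring_1)" "f dvd x ^ q" shows "f dvd x"
  using assms(2)
proof (induction q)
  case 0
  then show ?case using assms(1) by (simp add: prime_elem_def)
next
  case (Suc q)
  then show ?case using prime_elem_dvd_multD[OF assms(1), of x "x ^ q"] by auto
qed

text \<open>Raise the second link to the power \<open>q\<close> and multiply it with the first. The
  common factor \<open>b i ^ q * b k ^ q\<close> cancels because \<open>f\<close> is prime and
  divides no \<open>b i\<close>.\<close>

lemma power_link_trans:
  fixes f :: "('d::finite, 'p::prime_card) laurent"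
  assumes f: "prime_elem f" and b: "\<And>i. i \<in> I \<Longrightarrow> \<not> f dvd b i"
    and ab: "power_link f I q N a b" and bc: "power_link f I q' N' b c"
  shows "power_link f I (q * q') (\<lambda>i. N i + int q *s N' i) a c"
  unfolding power_link_def
proof (intro ballI)
  fix i k assume ik: "i \<in> I" "k \<in> I"
  let ?u = "laurent_monom"
  let ?X = "a k * b i ^ q * ?u (N k)" and ?X' = "a i * b k ^ q * ?u (N i)"
  let ?Y = "(b k * c i ^ q' * ?u (N' k)) ^ q" and ?Y' = "(b i * c k ^ q' * ?u (N' i)) ^ q"
  have pw: "x ^ (q * q') = (x ^ q') ^ q" for x :: "('d, 'p) laurent"
    by (subst mult.commute) (rule power_mult)
  have "f dvd ?X - ?X'" using ab ik unfolding power_link_def by blast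
  moreover have "f dvd b k * c i ^ q' * ?u (N' k) - b i * c k ^ q' * ?u (N' i)"
    using bc ik unfolding power_link_def by blast
  ultimately have "f dvd ?X * ?Y - ?X' * ?Y'" by (rule dvd_diff_times[OF _ dvd_diff_power])
  also have "?X * ?Y - ?X' * ?Y' = (b i ^ q * b k ^ q) *
      (a k * c i ^ (q * q') * ?u (N k + int q *s N' k) - a i * c k ^ (q * q') * ?u (N i + int q *s N' i))"
    by (simp only: pw power_mult_distrib laurent_monom_add laurent_monom_power right_diff_distrib mult_ac)
  finally have dvd: "f dvd (b i ^ q * b k ^ q) * (a k * c i ^ (q * q') * ?u (N k + int q *s N' k)
      - a i * c k ^ (q * q') * ?u (N i + int q *s N' i))" .
  have "\<not> f dvd b i ^ q * b k ^ q"
    using prime_elem_dvd_multD[OF f, of "b i ^ q" "b k ^ q"] prime_elem_dvd_power_imp_dvd[OF f] b ik by blast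
  then show "f dvd a k * c i ^ (q * q') * ?u (N k + int q *s N' k)
      - a i * c k ^ (q * q') * ?u (N i + int q *s N' i)"
    using prime_elem_dvd_multD[OF f dvd] by blast
qed

text \<open>\<open>minimal\<close> ranges over all coefficient vectors, not only over parts of one
  relation, because elimination and Cartier operators produce new coefficients. That
  \<open>I\<close> itself carries a nontrivial relation is left to the single lemmas.\<close>

locale minimal_relation =
  fixes f :: "('d::finite, 'p::prime_card) laurent" and I :: "nat set"
  assumes prime: "prime_elem f" and finite_I: "finite I"
    and minimal: "\<And>J a j. J \<subset> I \<Longrightarrow> far_apart J (relation_at f J a) \<Longrightarrow> j \<in> J \<Longrightarrow> f dvd a j"
begin

lemma relation_at_remove:
  assumes "relation_at f I a n" "k \<in> I" "f dvd a k"
  shows "relation_at f (I - {k}) a n"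
proof -
  have "(\<Sum>i\<in>I. a i * laurent_monom (n i)) =
      a k * laurent_monom (n k) + (\<Sum>i\<in>I - {k}. a i * laurent_monom (n i))"
    using finite_I assms(2) by (rule sum.remove)
  then have "f dvd a k * laurent_monom (n k) + (\<Sum>i\<in>I - {k}. a i * laurent_monom (n i))"
    using assms(1) unfolding relation_at_def by simp
  then show ?thesis using dvd_mult2[OF assms(3)] unfolding relation_at_def
    by (simp add: dvd_add_right_iff)
qed

lemma all_coefficients_nonzero:
  assumes "far_apart I (relation_at f I a)" "j \<in> I" "\<not> f dvd a j" "k \<in> I"
  shows "\<not> f dvd a k"
proof
  assume k: "f dvd a k"
  then have "far_apart (I - {k}) (relation_at f (I - {k}) a)"
    using assms(4) by (intro far_apart_mono[OF assms(1)] relation_at_remove) auto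
  then have "f dvd a j" using minimal[of "I - {k}" a j] assms(2,3,4) k by blast
  then show False using assms(3) by blast
qed

text \<open>The combination \<open>c\<close> eliminates the term \<open>k\<close>, which leaves a
  relation on a proper subset along the same tuples; minimality puts all its coefficients into the
  ideal.\<close>

lemma relations_proportional:
  assumes far: "far_apart I (\<lambda>n. relation_at f I a n \<and> relation_at f I b n)"
    and ik: "i \<in> I" "k \<in> I"
  shows "f dvd b k * a i - a k * b i"
proof (cases "i = k")
  case True
  then show ?thesis by (simp add: mult.commute)
next
  case False
  define c where "c i = b k * a i - a k * b i" for i
  have ck: "f dvd c k" by (simp add: c_def mult.commute)
  have "relation_at f I c n" if "relation_at f I a n \<and> relation_at f I b n" for n
  proof -
    have "(\<Sum>i\<in>I. c i * laurent_monom (n i)) =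
        b k * (\<Sum>i\<in>I. a i * laurent_monom (n i)) - a k * (\<Sum>i\<in>I. b i * laurent_monom (n i))"
      by (simp add: c_def sum_distrib_left sum_subtractf algebra_simps)
    then show ?thesis using that unfolding relation_at_def by (simp add: dvd_diff)
  qed
  then have "far_apart (I - {k}) (relation_at f (I - {k}) c)"
    using ik(2) ck by (intro far_apart_mono[OF far] relation_at_remove) auto
  then have "f dvd c i" using minimal[of "I - {k}" c i] ik False by blast
  then show ?thesis by (simp add: c_def)
qed

text \<open>Digit extraction turns \<open>a\<close> into \<open>b\<close>, with \<open>w\<close>
  chosen so that the coefficient at \<open>j\<close> survives. Frobenius carries \<open>b\<close>
  back to a relation \<open>b'\<close> on the tuples of \<open>a\<close>, where
  \<open>relations_proportional\<close> yields the link.\<close>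

lemma frobenius_step:
  assumes far: "far_apart I (relation_at f I a)" and j: "j \<in> I" "\<not> f dvd a j"
  obtains b g w where "\<forall>i\<in>I. g i \<in> digit_box CARD('p)" "w \<in> digit_box CARD('p)"
    "b = (\<lambda>i\<in>I. cartier w (f ^ (CARD('p) - 1) * (a i * laurent_monom (g i))))"
    "far_apart I (relation_at f I b)" "\<not> f dvd b j" "power_link f I CARD('p) g a b"
proof -
  let ?p = "CARD('p)"
  have p0: "?p > 0" by simp
  obtain g where g: "\<And>i. i \<in> I \<Longrightarrow> g i \<in> digit_box ?p"
    "far_apart I (\<lambda>m. \<exists>n. relation_at f I a n \<and> (\<forall>i\<in>I. n i = int ?p *s m i + g i))"
    using far_apart_digits[OF finite_I p0 far] by blast
  have "\<not> f dvd a j * laurent_monom (g j)"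
    using j(2) dvd_unit_times_iff[OF laurent_monom_unit, of f "g j" "a j"] by (simp add: mult.commute)
  moreover have "f \<noteq> 0" using prime by (simp add: prime_elem_def)
  ultimately obtain w where w: "w \<in> digit_box ?p"
    "\<not> f dvd cartier w (f ^ (?p - 1) * (a j * laurent_monom (g j)))"
    using dvd_if_cartier_dvd by blast
  \<comment> \<open>Restricted to \<open>I\<close> so that later only finitely many functions
    \<open>b\<close> are possible.\<close>
  define b where "b = (\<lambda>i\<in>I. cartier w (f ^ (?p - 1) * (a i * laurent_monom (g i))))"
  have b: "relation_at f I b m" if "relation_at f I a n" "\<forall>i\<in>I. n i = int ?p *s m i + g i" for m n
    using relation_at_digits[OF that(1), of m g w] that(2) by (simp add: relation_at_def b_def cong: sum.cong)
  have far_b: "far_apart I (relation_at f I b)"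
    by (rule far_apart_mono[OF g(2)]) (use b in auto)
  define b' where "b' i = b i ^ ?p * laurent_monom (- g i)" for i
  have "far_apart I (\<lambda>n. relation_at f I a n \<and> relation_at f I b' n)"
    unfolding far_apart_def
  proof (intro allI impI)
    fix K :: "(int ^ 'd) set" assume K: "finite K"
    let ?L = "(\<lambda>(k, s, t). k - g s + g t) ` (K \<times> I \<times> I)"
    have inj: "inj (\<lambda>n :: int ^ 'd. int ?p *s n)" using CARD_smult_inj[where w = "0 :: int ^ 'd"] by simp
    have "finite ((\<lambda>n. int ?p *s n) -` ?L)"
      by (intro finite_vimageI inj) (use K finite_I in auto)
    from far_apartD[OF g(2) this]
    obtain m n where mn: "relation_at f I a n" "\<forall>i\<in>I. n i = int ?p *s m i + g i"
      "\<forall>s\<in>I. \<forall>t\<in>I. s \<noteq> t \<longrightarrow> m s - m t \<notin> (\<lambda>n. int ?p *s n) -` ?L"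
      by blast
    have "n s - n t \<notin> K" if st: "s \<in> I" "t \<in> I" "s \<noteq> t" for s t
    proof
      assume k: "n s - n t \<in> K"
      have "int ?p *s (m s - m t) = (n s - n t) - g s + g t"
        using mn(2) st by (simp add: vec_eq_iff algebra_simps)
      also have "\<dots> \<in> ?L" by (rule image_eqI[of _ _ "(n s - n t, s, t)"]) (use k st in auto)
      finally have "m s - m t \<in> (\<lambda>n. int ?p *s n) -` ?L" by (rule vimageI2)
      then show False using mn(3) st by blast
    qed
    moreover have "relation_at f I b' n"
      using relation_at_power[OF b[OF mn(1,2)], of n 1 g] mn(2) unfolding b'_def by simp
    ultimately show "\<exists>n. (relation_at f I a n \<and> relation_at f I b' n) \<and>
        (\<forall>s\<in>I. \<forall>t\<in>I. s \<noteq> t \<longrightarrow> n s - n t \<notin> K)"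
      using mn(1) by blast
  qed
  note proportional = relations_proportional[OF this]
  have "power_link f I ?p g a b"
    unfolding power_link_def
  proof (intro ballI)
    fix i k assume ik: "i \<in> I" "k \<in> I"
    \<comment> \<open>The monomial factor clears the negative exponents in \<open>b'\<close>; the
      sign reverses the difference.\<close>
    have "f dvd (b' k * a i - a k * b' i) * (- (laurent_monom (g i) * laurent_monom (g k)))"
      using proportional[OF ik] by (rule dvd_mult2)
    also have "\<dots> = a k * b i ^ ?p * (laurent_monom (- g i) * laurent_monom (g i)) * laurent_monom (g k) -
        a i * b k ^ ?p * (laurent_monom (- g k) * laurent_monom (g k)) * laurent_monom (g i)"
      by (simp add: b'_def algebra_simps)
    also have "\<dots> = a k * b i ^ ?p * laurent_monom (g k) - a i * b k ^ ?p * laurent_monom (g i)"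
      by (simp flip: laurent_monom_add)
    finally show "f dvd a k * b i ^ ?p * laurent_monom (g k) - a i * b k ^ ?p * laurent_monom (g i)" .
  qed
  moreover have "\<not> f dvd b j" using w(2) j(1) by (simp add: b_def)
  moreover have "\<forall>i\<in>I. g i \<in> digit_box ?p" using g(1) by blast
  ultimately show ?thesis using that[OF _ w(1) b_def far_b] by blast
qed

end

section \<open>Bounded supports and recurrence of coefficients\<close>

definition keys_within :: "int \<Rightarrow> ((int ^ 'd::finite) \<Rightarrow>\<^sub>0 'b::zero) \<Rightarrow> bool"
  where "keys_within B h \<longleftrightarrow> (\<forall>n\<in>Poly_Mapping.keys h. \<forall>i. \<bar>n $ i\<bar> \<le> B)"

lemma ex_keys_within: "\<exists>B \<ge> 0. keys_within B h"
proof -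
  let ?S = "(\<lambda>(n, i). \<bar>n $ i\<bar>) ` (Poly_Mapping.keys h \<times> UNIV)"
  have "\<bar>n $ i\<bar> \<le> Max (insert 0 ?S)" if "n \<in> Poly_Mapping.keys h" for n i
    by (rule Max_ge) (use that in auto)
  moreover have "0 \<le> Max (insert 0 ?S)" by (rule Max_ge) auto
  ultimately show ?thesis unfolding keys_within_def by blast
qed

lemma keys_within_mono: "keys_within B h \<Longrightarrow> B \<le> C \<Longrightarrow> keys_within C h"
  unfolding keys_within_def by (meson order_trans)

lemma keys_within_times:
  fixes g h :: "(int ^ 'd::finite) \<Rightarrow>\<^sub>0 'b::comm_ring_1"
  assumes "keys_within B g" "keys_within C h" shows "keys_within (B + C) (g * h)"
  unfolding keys_within_def
proof (intro ballI allI)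
  fix n i assume n: "n \<in> Poly_Mapping.keys (g * h)"
  obtain a b where ab: "n = a + b" "a \<in> Poly_Mapping.keys g" "b \<in> Poly_Mapping.keys h"
    using subsetD[OF keys_mult[of g h] n] by blast
  have "\<bar>a $ i\<bar> \<le> B" "\<bar>b $ i\<bar> \<le> C" using assms ab unfolding keys_within_def by blast+
  then show "\<bar>n $ i\<bar> \<le> B + C" unfolding ab(1) by simp
qed

lemma keys_within_power:
  fixes g :: "(int ^ 'd::finite) \<Rightarrow>\<^sub>0 'b::comm_ring_1"
  assumes "keys_within B g" shows "keys_within (int k * B) (g ^ k)"
proof (induction k)
  case 0
  then show ?case by (simp add: keys_within_def)
next
  case (Suc k)
  then show ?case using keys_within_times[OF assms Suc] by (simp add: algebra_simps)
qed

lemma keys_within_laurent_monom: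
  assumes "g \<in> digit_box p" shows "keys_within (int p) (laurent_monom g)"
proof -
  have "\<bar>g $ i\<bar> \<le> int p" for i
  proof -
    have "0 \<le> g $ i" "g $ i < int p" using assms by (auto simp: digit_box_def)
    then show ?thesis by simp
  qed
  then show ?thesis by (auto simp: keys_within_def laurent_monom_def)
qed

text \<open>Digits are smaller than p, so \<open>CARD('p) * \<bar>n $ i\<bar>\<close> is at most
  \<open>C + CARD('p)\<close>; strictness in the hypothesis and integrality then give
  \<open>B\<close>.\<close>

lemma keys_within_cartier:
  fixes h :: "('d::finite, 'p::prime_card) laurent"
  assumes h: "keys_within C h" and w: "w \<in> digit_box CARD('p)"
    and C: "C + int CARD('p) < int CARD('p) * (B + 1)"
  shows "keys_within B (cartier w h)"
  unfolding keys_within_def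
proof (intro ballI allI)
  fix n i assume "n \<in> Poly_Mapping.keys (cartier w h)"
  then have "int CARD('p) *s n + w \<in> Poly_Mapping.keys h" by (simp add: in_keys_iff lookup_cartier)
  then have "\<bar>(int CARD('p) *s n + w) $ i\<bar> \<le> C" using h unfolding keys_within_def by blast
  then have 1: "\<bar>int CARD('p) * n $ i + w $ i\<bar> \<le> C" by simp
  have "0 \<le> w $ i" "w $ i < int CARD('p)" using w by (auto simp: digit_box_def)
  with 1 have "\<bar>int CARD('p) * n $ i\<bar> \<le> C + int CARD('p)" by linarith
  moreover have "\<bar>int CARD('p) * n $ i\<bar> = int CARD('p) * \<bar>n $ i\<bar>" by (simp add: abs_mult)
  ultimately have "int CARD('p) * \<bar>n $ i\<bar> < int CARD('p) * (B + 1)" using C by linarith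
  then have "\<bar>n $ i\<bar> < B + 1" by (rule mult_left_less_imp_less) simp
  then show "\<bar>n $ i\<bar> \<le> B" by simp
qed

lemma finite_keys_within: "finite {h :: ('d::finite, 'p::prime_card) laurent. keys_within B h}"
proof -
  let ?A = "{n :: int ^ 'd. \<forall>i. - B \<le> n $ i \<and> n $ i \<le> B}"
  let ?F = "\<lambda>\<phi> :: int ^ 'd \<Rightarrow> 'p mod_ring. \<Sum>n\<in>?A. Poly_Mapping.single n (\<phi> n)"
  have A: "finite ?A" by (rule finite_vec_box)
  have "{h :: ('d, 'p) laurent. keys_within B h} \<subseteq> ?F ` PiE ?A (\<lambda>_. UNIV)"
  proof clarify
    fix h :: "('d, 'p) laurent" assume h: "keys_within B h"
    have sub: "Poly_Mapping.keys h \<subseteq> ?A"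
    proof
      fix n assume "n \<in> Poly_Mapping.keys h"
      then have "\<bar>n $ i\<bar> \<le> B" for i using h unfolding keys_within_def by blast
      then show "n \<in> ?A" by (simp add: abs_le_iff minus_le_iff[of _ B])
    qed
    have "h = (\<Sum>n\<in>Poly_Mapping.keys h. Poly_Mapping.single n (Poly_Mapping.lookup h n))"
      by (rule sum_single_keys[symmetric])
    also have "\<dots> = (\<Sum>n\<in>?A. Poly_Mapping.single n (Poly_Mapping.lookup h n))"
      by (rule sum.mono_neutral_left[OF A sub]) (auto simp: in_keys_iff)
    also have "\<dots> = ?F (restrict (Poly_Mapping.lookup h) ?A)" by (intro sum.cong) auto
    finally show "h \<in> ?F ` PiE ?A (\<lambda>_. UNIV)" 
      by (rule image_eqI[where x = "restrict (Poly_Mapping.lookup h) ?A"]) auto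
  qed
  then show ?thesis by (rule finite_subset) (intro finite_imageI finite_PiE A, simp)
qed

text \<open>Pigeonhole for a step that involves choices: a finite acyclic relation has an element
  without successor, which totality excludes.\<close>

lemma finite_total_relation_cycle:
  assumes "finite S" "x \<in> S" and R: "\<And>x. x \<in> S \<Longrightarrow> \<exists>y\<in>S. (x, y) \<in> R"
  shows "\<exists>y\<in>S. (y, y) \<in> (R \<inter> S \<times> S)\<^sup>+"
proof -
  let ?R = "R \<inter> S \<times> S"
  have fin: "finite ?R" using assms(1) by blast
  have "\<not> acyclic ?R"
  proof
    assume "acyclic ?R"
    then have "wf (?R\<inverse>)" using fin by (rule finite_acyclic_wf_converse[rotated])
    then have "\<exists>z\<in>S. \<forall>y. (y, z) \<in> ?R\<inverse> \<longrightarrow> y \<notin> S"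
      using assms(2) unfolding wf_eq_minimal by blast
    then obtain z where z: "z \<in> S" "\<And>y. (y, z) \<in> ?R\<inverse> \<Longrightarrow> y \<notin> S" by blast
    obtain y where "y \<in> S" "(z, y) \<in> R" using R[OF z(1)] by blast
    then show False using z by blast
  qed
  then obtain y where "(y, y) \<in> ?R\<^sup>+" unfolding acyclic_def by blast
  moreover from this have "y \<in> S" by (induction rule: tranclE) auto
  ultimately show ?thesis by blast
qed

text \<open>A coincidence at \<open>s\<close> and \<open>t\<close> puts
  \<open>c *s (n s - n t)\<close> into the finite set of differences of \<open>N\<close>. This will
  make the points of the shape distinct, with \<open>c\<close> one less than the power of p in the
  self-link.\<close>

lemma far_apart_distinct:
  fixes N :: "nat \<Rightarrow> int ^ 'd::finite"
  assumes far: "far_apart I Q" and I: "finite I" and c: "c \<noteq> 0"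
  obtains n where "Q n" "inj_on (\<lambda>i. c *s n i + N i) I"
proof -
  have "inj (\<lambda>x :: int ^ 'd. c *s x)" using c by (auto simp: inj_on_def vec_eq_iff)
  then have "finite ((\<lambda>x :: int ^ 'd. c *s x) -` ((\<lambda>(s, t). N t - N s) ` (I \<times> I)))"
    by (intro finite_vimageI) (use I in auto)
  from far_apartD[OF far this] obtain n where n: "Q n"
    "\<forall>s\<in>I. \<forall>t\<in>I. s \<noteq> t \<longrightarrow> n s - n t \<notin> (\<lambda>x. c *s x) -` ((\<lambda>(s, t). N t - N s) ` (I \<times> I))"
    by blast
  have "inj_on (\<lambda>i. c *s n i + N i) I"
  proof (rule inj_onI, rule ccontr)
    fix s t assume st: "s \<in> I" "t \<in> I" "c *s n s + N s = c *s n t + N t" "s \<noteq> t"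
    have "c *s (n s - n t) = N t - N s"
      using st(3) by (simp add: vec_eq_iff algebra_simps)
    then have "n s - n t \<in> (\<lambda>x. c *s x) -` ((\<lambda>(s, t). N t - N s) ` (I \<times> I))" using st by auto
    then show False using n(2) st by blast
  qed
  then show ?thesis using n(1) that by blast
qed

context minimal_relation
begin

lemma exists_self_link:
  assumes far: "far_apart I (relation_at f I a)" and j: "j \<in> I" "\<not> f dvd a j"
  obtains b t N where "far_apart I (relation_at f I b)" "\<not> f dvd b j" "t > 0"
    "power_link f I (CARD('p) ^ t) N b b"
proof -
  let ?p = "CARD('p)"
  obtain c where c: "keys_within c f" "c \<ge> 0" using ex_keys_within by blast
  have "\<exists>B. \<forall>i\<in>I. keys_within B (a i)"
  proof -
    have "\<forall>i. \<exists>B. keys_within B (a i)" using ex_keys_within by blast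
    from choice[OF this] obtain B where B: "\<forall>i. keys_within (B i) (a i)" ..
    have "keys_within (Max (B ` I)) (a i)" if "i \<in> I" for i
      by (rule keys_within_mono[of "B i"]) (use B that finite_I in auto)
    then show ?thesis by blast
  qed
  then obtain B0 where B0: "\<And>i. i \<in> I \<Longrightarrow> keys_within B0 (a i)" by blast
  \<comment> \<open>One step must preserve the bound:
    \<open>(p - 1) * c + B + 2 * p < p * (B + 1)\<close>, that is
    \<open>p < (p - 1) * (B - c)\<close>. For \<open>p \<ge> 2\<close> this follows from
    \<open>B - c \<ge> 4\<close>. The maximum with \<open>B0\<close> admits the initial
    vector.\<close>
  define B where "B = max B0 (c + 4)"
  define S where "S = {b \<in> PiE I (\<lambda>_. {h. keys_within B h}).
    far_apart I (relation_at f I b) \<and> \<not> f dvd b j}"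
  define R where "R = {(b, b'). \<exists>N. power_link f I ?p N b b'}"
  have p2: "?p \<ge> 2" using prime_ge_2_nat[OF prime_card[where 'a = 'p]] .
  have "finite S" unfolding S_def
    by (rule finite_subset[OF _ finite_PiE[OF finite_I finite_keys_within]]) auto
  moreover have "restrict a I \<in> S"
  proof -
    have "relation_at f I (restrict a I) = relation_at f I a"
      by (auto simp: relation_at_def fun_eq_iff cong: sum.cong)
    then show ?thesis using far j B0 unfolding S_def
      by (auto simp: B_def intro: keys_within_mono[of B0])
  qed
  moreover have "\<exists>b'\<in>S. (b, b') \<in> R" if b: "b \<in> S" for b
  proof -
    have b_rel: "far_apart I (relation_at f I b)" "\<not> f dvd b j" using b by (auto simp: S_def)
    obtain b' g w where g: "\<forall>i\<in>I. g i \<in> digit_box ?p" and w: "w \<in> digit_box ?p"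
      and b': "b' = (\<lambda>i\<in>I. cartier w (f ^ (?p - 1) * (b i * laurent_monom (g i))))"
        "far_apart I (relation_at f I b')" "\<not> f dvd b' j" "power_link f I ?p g b b'"
      using frobenius_step[OF b_rel(1) j(1) b_rel(2)] .
    have "keys_within B (b' i)" if i: "i \<in> I" for i
    proof -
      have 1: "keys_within (int (?p - 1) * c + (B + int ?p)) (f ^ (?p - 1) * (b i * laurent_monom (g i)))"
        using b i by (intro keys_within_times keys_within_power c(1) keys_within_laurent_monom bspec[OF g])
          (auto simp: S_def PiE_iff)
      have p1: "int (?p - 1) = int ?p - 1" using p2 by (simp add: of_nat_diff)
      have "(int ?p - 1) * 4 \<le> (int ?p - 1) * (B - c)"
        using p2 by (intro mult_left_mono) (auto simp: B_def)
      then have "int (?p - 1) * c + (B + int ?p) + int ?p < int ?p * (B + 1)"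
        unfolding p1 using p2 by (simp add: algebra_simps)
      from keys_within_cartier[OF 1 w this] show ?thesis using i by (simp add: b'(1))
    qed
    then have "b' \<in> S" using b' by (auto simp: S_def b'(1))
    then show ?thesis using b'(4) by (auto simp: R_def)
  qed
  \<comment> \<open>Each step may depend on choices, so the return is a cycle in the relation
    \<open>R\<close>; composing its links gives the self-link.\<close>
  ultimately obtain b where b: "b \<in> S" "(b, b) \<in> (R \<inter> S \<times> S)\<^sup>+"
    using finite_total_relation_cycle[of S "restrict a I" R] by blast
  have "\<exists>t N. t > 0 \<and> power_link f I (?p ^ t) N x y" if "(x, y) \<in> (R \<inter> S \<times> S)\<^sup>+" for x y
    using that
  proof (induction rule: trancl_induct)
    case (base y)
    then obtain N where "power_link f I (?p ^ 1) N x y" by (auto simp: R_def)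
    then show ?case by blast
  next
    case (step y z)
    obtain t N where t: "t > 0" "power_link f I (?p ^ t) N x y" using step.IH by blast
    obtain N' where N': "power_link f I ?p N' y z" using step.hyps(2) by (auto simp: R_def)
    have "far_apart I (relation_at f I y)" "\<not> f dvd y j" using step.hyps(2) by (auto simp: S_def)
    then have "\<And>i. i \<in> I \<Longrightarrow> \<not> f dvd y i"
      using all_coefficients_nonzero[of y j] j(1) by blast
    from power_link_trans[OF prime this t(2) N']
    have "power_link f I (?p ^ (t + 1)) (\<lambda>i. N i + int (?p ^ t) *s N' i) x z"
      by (simp add: mult.commute)
    then show ?case
      by (intro exI[of _ "t + 1"] exI[of _ "\<lambda>i. N i + int (?p ^ t) *s N' i"]) simp
  qed
  then obtain t N where "t > 0" "power_link f I (?p ^ t) N b b" using b(2) by blast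
  then show ?thesis using that[of b t N] b(1) by (auto simp: S_def)
qed

text \<open>Modulo \<open>f\<close> and a common factor, the self-link replaces
  \<open>b i ^ q\<close> times the monomial of \<open>- N i\<close> by \<open>b i\<close>. So a
  relation of \<open>b\<close> at a tuple \<open>m\<close> gives one at \<open>q m + N\<close>, and
  this map can be iterated from a single tuple \<open>n\<close>.\<close>

theorem relation_along_shape:
  assumes far: "far_apart I (relation_at f I a)" and j: "j \<in> I" "\<not> f dvd a j"
  obtains b D where "inj_on D I" "\<not> f dvd b j"
    "infinite {k. relation_at f I b (\<lambda>i. int k *s D i)}"
proof -
  obtain b t N where b: "far_apart I (relation_at f I b)" "\<not> f dvd b j" and t: "t > 0"
    and link: "power_link f I (CARD('p) ^ t) N b b"
    using exists_self_link[OF assms] .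
  define q where "q = CARD('p) ^ t"
  have "CARD('p) \<ge> 2" using prime_ge_2_nat[OF prime_card[where 'a = 'p]] .
  then have q: "q \<ge> 2" 
    unfolding q_def using power_increasing[of 1 t "CARD('p)"] t by simp
  then have "int q - 1 \<noteq> 0" by simp
  from far_apart_distinct[OF b(1) finite_I this]
  obtain n where n: "relation_at f I b n" "inj_on (\<lambda>i. (int q - 1) *s n i + N i) I" .
  \<comment> \<open>The first step of the orbit of \<open>n\<close>. Later points are
    \<open>n i + k *s D i\<close>, because
    \<open>q *s (n i + k *s D i) + N i = n i + (q * k + 1) *s D i\<close>.\<close>
  define D where "D i = (int q - 1) *s n i + N i" for i
  define k where "k l = (\<Sum>m<l. q ^ m)" for l :: nat
  have kS: "int (k (Suc l)) = int q * int (k l) + 1" for l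
    unfolding k_def by (simp add: sum.lessThan_Suc_shift sum_distrib_left del: sum.lessThan_Suc)
  have rel: "relation_at f I b (\<lambda>i. n i + int (k l) *s D i)" for l
  proof (induction l)
    case 0
    have "(\<lambda>i. n i + int (k 0) *s D i) = n" by (simp add: k_def fun_eq_iff vec_eq_iff)
    then show ?case using n(1) by simp
  next
    case (Suc l)
    let ?m = "\<lambda>i. n i + int (k l) *s D i" and ?m' = "\<lambda>i. n i + int (k (Suc l)) *s D i"
    have mm': "?m' i = int q *s ?m i + N i" for i
      unfolding kS by (simp add: D_def vec_eq_iff algebra_simps)
    have "relation_at f I (\<lambda>i. b i ^ q * laurent_monom (- N i)) ?m'"
      unfolding q_def by (rule relation_at_power[OF Suc]) (simp only: mm' q_def)
    \<comment> \<open>The factor \<open>b j\<close> makes the link applicable to each term: it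
      exchanges \<open>b j * b i ^ q\<close> with the monomial of \<open>- N i\<close> for
      \<open>b i * b j ^ q\<close> with that of \<open>- N j\<close>. What depends on
      \<open>j\<close> alone is cancelled at the end.\<close>
    then have 1: "f dvd b j * (\<Sum>i\<in>I. b i ^ q * laurent_monom (- N i) * laurent_monom (?m' i))"
      unfolding relation_at_def by (rule dvd_mult)
    have 2: "f dvd (\<Sum>i\<in>I. (b j * b i ^ q * laurent_monom (N j) - b i * b j ^ q * laurent_monom (N i)) *
        (laurent_monom (- N j) * laurent_monom (- N i) * laurent_monom (?m' i)))"
      using link j(1) unfolding power_link_def q_def[symmetric] by (intro dvd_sum dvd_mult2) blast
    have 3: "b j * (\<Sum>i\<in>I. b i ^ q * laurent_monom (- N i) * laurent_monom (?m' i)) -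
        (\<Sum>i\<in>I. (b j * b i ^ q * laurent_monom (N j) - b i * b j ^ q * laurent_monom (N i)) *
        (laurent_monom (- N j) * laurent_monom (- N i) * laurent_monom (?m' i))) =
        (b j ^ q * laurent_monom (- N j)) * (\<Sum>i\<in>I. b i * laurent_monom (?m' i))"
    proof -
      have cancel: "laurent_monom v * laurent_monom (- v) = (1 :: ('d, 'p) laurent)" for v
        by (simp flip: laurent_monom_add)
      have "b j * (b i ^ q * laurent_monom (- N i) * u) -
          (b j * b i ^ q * laurent_monom (N j) - b i * b j ^ q * laurent_monom (N i)) *
          (laurent_monom (- N j) * laurent_monom (- N i) * u) =
          (b j ^ q * laurent_monom (- N j)) * (b i * u)" for i u
      proof -
        have "(b j * b i ^ q * laurent_monom (N j) - b i * b j ^ q * laurent_monom (N i)) *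
            (laurent_monom (- N j) * laurent_monom (- N i) * u) =
            b j * b i ^ q * (laurent_monom (N j) * laurent_monom (- N j)) * laurent_monom (- N i) * u -
            b i * b j ^ q * (laurent_monom (N i) * laurent_monom (- N i)) * laurent_monom (- N j) * u"
          by (simp only: left_diff_distrib right_diff_distrib mult_ac)
        then show ?thesis unfolding cancel by (simp add: mult_ac)
      qed
      then show ?thesis unfolding sum_distrib_left sum_subtractf[symmetric] by (intro sum.cong refl) 
    qed
    have dvd: "f dvd (b j ^ q * laurent_monom (- N j)) * (\<Sum>i\<in>I. b i * laurent_monom (?m' i))"
      using dvd_diff[OF 1 2] unfolding 3 .
    have "\<not> f dvd b j ^ q * laurent_monom (- N j)"
      using b(2) prime_elem_dvd_power_imp_dvd[OF prime, of "b j" q]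
        dvd_unit_times_iff[OF laurent_monom_unit, of f "- N j" "b j ^ q"] by (auto simp: mult.commute)
    then show ?case unfolding relation_at_def
      using prime_elem_dvd_multD[OF prime dvd] by blast
  qed
  \<comment> \<open>Moving the base point \<open>n\<close> into the coefficients leaves pure
    multiples of the shape \<open>D\<close>.\<close>
  define b' where "b' i = b i * laurent_monom (n i)" for i
  have "relation_at f I b' (\<lambda>i. int (k l) *s D i)" for l
    using rel[of l] unfolding relation_at_def b'_def by (simp add: laurent_monom_add mult.assoc)
  then have "range k \<subseteq> {k. relation_at f I b' (\<lambda>i. int k *s D i)}" by auto
  moreover have "infinite (range k)"
  proof -
    have "strict_mono k" by (rule strict_monoI_Suc) (use q in \<open>simp add: k_def\<close>)
    then have "inj k" by (rule strict_mono_imp_inj_on)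
    then show ?thesis using finite_imageD by blast
  qed
  ultimately have "infinite {k. relation_at f I b' (\<lambda>i. int k *s D i)}" using infinite_super by blast
  moreover have "\<not> f dvd b' j"
    using b(2) dvd_unit_times_iff[OF laurent_monom_unit, of f "n j" "b j"]
    by (simp add: b'_def mult.commute)
  moreover have "inj_on D I" using n(2) unfolding D_def .
  ultimately show ?thesis using that by blast
qed

end

text \<open>Among the subsets of \<open>I\<close> with a nontrivial relation along far-apart tuples,
  one of least cardinality satisfies \<open>minimal_relation\<close>; hence the shape may have fewer
  points than \<open>I\<close>.\<close>

theorem far_apart_relation_imp_shape_relation:
  fixes f :: "('d::finite, 'p::prime_card) laurent"
  assumes f: "prime_elem f" and I: "finite I"
    and far: "far_apart I (relation_at f I a)" and j: "j \<in> I" "\<not> f dvd a j"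
  obtains J D b i where "J \<subseteq> I" "inj_on D J" "i \<in> J" "\<not> f dvd b i"
    "infinite {k. relation_at f J b (\<lambda>i. int k *s D i)}"
proof -
  define P where "P J \<longleftrightarrow> J \<subseteq> I \<and> (\<exists>a. far_apart J (relation_at f J a) \<and> (\<exists>j\<in>J. \<not> f dvd a j))" for J
  have "P I" unfolding P_def using far j by blast
  then have "\<exists>J. P J \<and> (\<forall>J'. P J' \<longrightarrow> card J \<le> card J')" by (rule ex_has_least_nat)
  then obtain J where J: "P J" "\<And>J'. P J' \<Longrightarrow> card J \<le> card J'" by blast
  obtain c i where c: "J \<subseteq> I" "far_apart J (relation_at f J c)" "i \<in> J" "\<not> f dvd c i"
    using J(1) unfolding P_def by blast
  interpret minimal_relation f J
  proof
    show "finite J" using c(1) I by (rule finite_subset)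
    fix J' a j assume J': "J' \<subset> J" "far_apart J' (relation_at f J' a)" "j \<in> J'"
    show "f dvd a j"
    proof (rule ccontr)
      assume "\<not> f dvd a j"
      then have "P J'" unfolding P_def using J' c(1) by blast
      then show False using J(2)[of J'] psubset_card_mono[OF \<open>finite J\<close> J'(1)] by simp
    qed
  qed (rule f)
  obtain b D where bD: "inj_on D J" "\<not> f dvd b i" "infinite {k. relation_at f J b (\<lambda>i. int k *s D i)}"
    using relation_along_shape[OF c(2-4)] .
  show ?thesis by (rule that[OF c(1) bD(1) c(3) bD(2,3)])
qed

section \<open>Mixing and relations\<close>

text \<open>Isolates what mixing uses of the dual group: characters indexed by representatives,
  their orthogonality, equivariance, and a sigma-algebra generated by conditions on finitely many
  characters.\<close>

locale character_action = prob_space M for M :: "'x measure" +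
  fixes f :: "('d::finite, 'p::prime_card) laurent"
    and e :: "('d, 'p) laurent \<Rightarrow> 'x \<Rightarrow> complex"
    and \<alpha> :: "int ^ 'd \<Rightarrow> 'x \<Rightarrow> 'x"
  assumes e_add: "\<And>a b x. x \<in> space M \<Longrightarrow> e (a + b) x = e a x * e b x"
    and e_dvd: "\<And>a x. f dvd a \<Longrightarrow> x \<in> space M \<Longrightarrow> e a x = 1"
    and integral_e: "\<And>a. \<not> f dvd a \<Longrightarrow> integral\<^sup>L M (e a) = 0"
    and \<alpha>_space: "\<And>n x. x \<in> space M \<Longrightarrow> \<alpha> n x \<in> space M"
    and e_\<alpha>: "\<And>a n x. x \<in> space M \<Longrightarrow> e a (\<alpha> n x) = e (laurent_monom n * a) x"
    and sets_M: "sets M = sigma_sets (space M)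
      ((\<lambda>P. {x \<in> space M. \<forall>(a, z)\<in>P. e a x = z}) ` {P. finite P})"
begin

definition cylinder :: "(('d, 'p) laurent \<times> complex) set \<Rightarrow> 'x set"
  where "cylinder P = {x \<in> space M. \<forall>(a, z)\<in>P. e a x = z}"

definition cylinders :: "'x set set"
  where "cylinders = cylinder ` {P. finite P}"

lemma sets_M': "sets M = sigma_sets (space M) cylinders"
  unfolding sets_M cylinders_def cylinder_def ..

lemma cylinders_Pow: "cylinders \<subseteq> Pow (space M)"
  by (auto simp: cylinders_def cylinder_def)

lemma Int_stable_cylinders: "Int_stable cylinders"
proof (rule Int_stableI)
  fix A B assume "A \<in> cylinders" "B \<in> cylinders"
  then obtain P Q where "A = cylinder P" "finite P" "B = cylinder Q" "finite Q"
    by (auto simp: cylinders_def)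
  moreover have "cylinder P \<inter> cylinder Q = cylinder (P \<union> Q)" unfolding cylinder_def ball_Un by auto
  ultimately show "A \<inter> B \<in> cylinders" by (auto simp: cylinders_def)
qed

lemma cylinder_sets: "finite P \<Longrightarrow> cylinder P \<in> sets M"
  unfolding sets_M' by (rule sigma_sets.Basic) (simp add: cylinders_def)

lemma space_in_cylinders: "space M \<in> cylinders"
proof -
  have "space M = cylinder {}" by (simp add: cylinder_def)
  then show ?thesis by (simp add: cylinders_def)
qed

lemma e_of_nat_times: "x \<in> space M \<Longrightarrow> e (of_nat k * a) x = e a x ^ k"
proof (induction k)
  case (Suc k)
  then show ?case by (simp add: distrib_right e_add)
qed (simp add: e_dvd)

lemma e_power_CARD: "x \<in> space M \<Longrightarrow> e a x ^ CARD('p) = 1"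
proof -
  assume x: "x \<in> space M"
  have "of_nat CARD('p) = (0 :: ('d, 'p) laurent)"
    using of_nat_CHAR[where 'a = "('d, 'p) laurent"] by (simp add: CHAR_laurent)
  then show ?thesis using e_of_nat_times[OF x, of "CARD('p)" a] by (simp add: e_dvd x)
qed

lemma norm_e: "x \<in> space M \<Longrightarrow> norm (e a x) = 1"
  using e_power_CARD[of x a] power_eq_1_iff[of "e a x" "CARD('p)"] by simp

lemma e_sum: "x \<in> space M \<Longrightarrow> e (\<Sum>i\<in>A. a i) x = (\<Prod>i\<in>A. e (a i) x)"
  by (induction A rule: infinite_finite_induct) (auto simp: e_add e_dvd)

lemma finite_roots: "finite {z :: complex. z ^ CARD('p) = 1}"
  by (rule finite_roots_unity) (simp add: Suc_leI)

lemma e_measurable [measurable]: "e a \<in> borel_measurable M"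
proof (rule borel_measurable_simple_function, unfold simple_function_def, intro conjI ballI)
  show "finite (e a ` space M)"
    by (rule finite_subset[OF _ finite_roots]) (auto simp: e_power_CARD)
  fix z
  have "e a -` {z} \<inter> space M = cylinder {(a, z)}" by (auto simp: cylinder_def)
  then show "e a -` {z} \<inter> space M \<in> sets M" by (simp add: cylinder_sets)
qed

lemma integrable_e [simp]: "integrable M (e a)"
  by (rule integrable_const_bound[of _ 1]) (auto simp: norm_e)

lemma integral_e': "integral\<^sup>L M (e a) = (if f dvd a then 1 else 0)"
proof (cases "f dvd a")
  case True
  then have "integral\<^sup>L M (e a) = integral\<^sup>L M (\<lambda>_. 1)"
    by (intro Bochner_Integration.integral_cong) (auto simp: e_dvd)
  then show ?thesis using True by (simp add: prob_space)
qed (simp add: integral_e)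

lemma \<alpha>_measurable [measurable]: "\<alpha> n \<in> measurable M M"
proof (rule measurable_sigma_sets[OF sets_M' cylinders_Pow])
  show "\<alpha> n \<in> space M \<rightarrow> space M" by (auto simp: \<alpha>_space)
  fix A assume "A \<in> cylinders"
  then obtain P where P: "finite P" "A = cylinder P" by (auto simp: cylinders_def)
  have "\<alpha> n -` A \<inter> space M = cylinder ((\<lambda>(a, z). (laurent_monom n * a, z)) ` P)"
    by (auto simp: P(2) cylinder_def \<alpha>_space e_\<alpha>)
  then show "\<alpha> n -` A \<inter> space M \<in> sets M" using P(1) by (simp add: cylinder_sets)
qed

section \<open>Trigonometric polynomials and independence of cylinders\<close>

definition trig :: "('x \<Rightarrow> complex) \<Rightarrow> bool"
  where "trig \<phi> \<longleftrightarrow> (\<exists>E c. finite E \<and> (\<forall>x\<in>space M. \<phi> x = (\<Sum>a\<in>E. c a * e a x)))"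

lemma trig_zero: "trig (\<lambda>_. 0)"
  unfolding trig_def by (rule exI[of _ "{}"]) auto

lemma trig_add: assumes "trig \<phi>" "trig \<psi>" shows "trig (\<lambda>x. \<phi> x + \<psi> x)"
proof -
  obtain E c where E: "finite E" "\<forall>x\<in>space M. \<phi> x = (\<Sum>a\<in>E. c a * e a x)"
    using assms(1) unfolding trig_def by blast
  obtain F d where F: "finite F" "\<forall>x\<in>space M. \<psi> x = (\<Sum>a\<in>F. d a * e a x)"
    using assms(2) unfolding trig_def by blast
  have "(\<Sum>a\<in>E. c a * e a x) = (\<Sum>a\<in>E \<union> F. (if a \<in> E then c a else 0) * e a x)" for x
    using E(1) F(1) by (intro sum.mono_neutral_cong_left) auto
  moreover have "(\<Sum>a\<in>F. d a * e a x) = (\<Sum>a\<in>E \<union> F. (if a \<in> F then d a else 0) * e a x)" for x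
    using E(1) F(1) by (intro sum.mono_neutral_cong_left) auto
  ultimately have "\<forall>x\<in>space M. \<phi> x + \<psi> x =
      (\<Sum>a\<in>E \<union> F. ((if a \<in> E then c a else 0) + (if a \<in> F then d a else 0)) * e a x)"
    using E(2) F(2) by (simp add: distrib_right sum.distrib)
  then show ?thesis unfolding trig_def using E(1) F(1)
    by (intro exI[of _ "E \<union> F"] exI[of _ "\<lambda>a. (if a \<in> E then c a else 0) + (if a \<in> F then d a else 0)"]) auto
qed

lemma trig_times_e: assumes "trig \<phi>" shows "trig (\<lambda>x. z * e b x * \<phi> x)"
proof -
  obtain E c where E: "finite E" "\<forall>x\<in>space M. \<phi> x = (\<Sum>a\<in>E. c a * e a x)"
    using assms unfolding trig_def by blast
  have inj: "inj_on (\<lambda>a. b + a) E" by simp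
  have "z * e b x * \<phi> x = (\<Sum>a\<in>(\<lambda>a. b + a) ` E. (z * c (a - b)) * e a x)" if "x \<in> space M" for x
    unfolding sum.reindex[OF inj] using E(2) that
    by (simp add: sum_distrib_left e_add mult_ac)
  then show ?thesis unfolding trig_def using E(1)
    by (intro exI[of _ "(\<lambda>a. b + a) ` E"] exI[of _ "\<lambda>a. z * c (a - b)"]) auto
qed

lemma trig_e: "trig (\<lambda>x. z * e b x)"
  unfolding trig_def by (intro exI[of _ "{b}"] exI[of _ "\<lambda>_. z"]) auto

lemma trig_sum: "(\<And>i. i \<in> A \<Longrightarrow> trig (\<phi> i)) \<Longrightarrow> trig (\<lambda>x. \<Sum>i\<in>A. \<phi> i x)"
  by (induction A rule: infinite_finite_induct) (auto intro: trig_zero trig_add)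

lemma trig_times: assumes "trig \<phi>" "trig \<psi>" shows "trig (\<lambda>x. \<phi> x * \<psi> x)"
proof -
  obtain E c where E: "finite E" "\<forall>x\<in>space M. \<phi> x = (\<Sum>a\<in>E. c a * e a x)"
    using assms(1) unfolding trig_def by blast
  have "trig (\<lambda>x. \<Sum>a\<in>E. c a * e a x * \<psi> x)"
    by (intro trig_sum trig_times_e assms(2))
  then show ?thesis using E(2) unfolding trig_def by (simp add: sum_distrib_right)
qed

lemma trig_cong: "trig \<phi> \<Longrightarrow> (\<And>x. x \<in> space M \<Longrightarrow> \<psi> x = \<phi> x) \<Longrightarrow> trig \<psi>"
  unfolding trig_def by simp

lemma sum_roots_of_unity:
  assumes "w ^ CARD('p) = (1 :: complex)"
  shows "(\<Sum>k<CARD('p). w ^ k) = (if w = 1 then of_nat CARD('p) else 0)"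
  using assms by (auto simp: sum_gp_strict)

text \<open>Averaging the first p powers of \<open>inverse z * e a x\<close> detects
  \<open>e a x = z\<close>, as both are p-th roots of unity; for any other \<open>z\<close> the
  cylinder is empty. Several conditions correspond to a product.\<close>

lemma trig_cylinder:
  assumes "finite P" shows "trig (\<lambda>x. indicator (cylinder P) x)"
  using assms
proof (induction P rule: finite_induct)
  case empty
  have "trig (\<lambda>x. 1 * e 0 x)" by (rule trig_e)
  then show ?case by (rule trig_cong) (auto simp: cylinder_def e_dvd)
next
  case (insert az P)
  obtain a z where az: "az = (a, z)" by (cases az)
  have "trig (\<lambda>x. indicator (cylinder {(a, z)}) x)"
  proof (cases "z ^ CARD('p) = 1")
    case False
    then have "cylinder {(a, z)} = {}" using e_power_CARD by (auto simp: cylinder_def)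
    then show ?thesis using trig_zero by simp
  next
    case True
    have "trig (\<lambda>x. \<Sum>k<CARD('p). (inverse z ^ k / of_nat CARD('p)) * e (of_nat k * a) x)"
      by (intro trig_sum trig_e)
    then show ?thesis
    proof (rule trig_cong)
      fix x assume x: "x \<in> space M"
      have z0: "z \<noteq> 0" using True by (auto simp: power_0_left)
      have w: "(inverse z * e a x) ^ CARD('p) = 1"
        using True e_power_CARD[OF x, of a] by (simp add: power_mult_distrib power_inverse)
      have iff: "inverse z * e a x = 1 \<longleftrightarrow> e a x = z" using z0 by (auto simp: field_simps)
      have "(\<Sum>k<CARD('p). (inverse z ^ k / of_nat CARD('p)) * e (of_nat k * a) x) =
          (\<Sum>k<CARD('p). (inverse z * e a x) ^ k) / of_nat CARD('p)"
        by (simp add: sum_divide_distrib e_of_nat_times[OF x] power_mult_distrib)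
      also have "\<dots> = indicator (cylinder {(a, z)}) x"
        unfolding sum_roots_of_unity[OF w] iff using x by (auto simp: cylinder_def)
      finally show "indicator (cylinder {(a, z)}) x =
        (\<Sum>k<CARD('p). (inverse z ^ k / of_nat CARD('p)) * e (of_nat k * a) x)" ..
    qed
  qed
  from trig_times[OF this insert.IH] show ?case
    by (rule trig_cong) (auto simp: cylinder_def az indicator_def)
qed

lemma integral_trig:
  assumes "\<forall>x\<in>space M. \<phi> x = (\<Sum>a\<in>E. c a * e a x)"
  shows "integral\<^sup>L M \<phi> = (\<Sum>a\<in>E. if f dvd a then c a else 0)"
proof -
  have "integral\<^sup>L M \<phi> = integral\<^sup>L M (\<lambda>x. \<Sum>a\<in>E. c a * e a x)"
    using assms by (intro Bochner_Integration.integral_cong) auto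
  also have "\<dots> = (\<Sum>a\<in>E. c a * integral\<^sup>L M (e a))" by simp
  finally show ?thesis by (simp add: integral_e' if_distrib cong: if_cong)
qed

text \<open>Expand into characters. A choice \<open>g\<close> contributes only if the combined
  character is trivial; by \<open>no_rel\<close> each single character is then trivial, and such
  choices make up the product of the integrals.\<close>

lemma integral_prod_trig:
  fixes E :: "'i \<Rightarrow> ('d, 'p) laurent set" and n :: "'i \<Rightarrow> int ^ 'd"
  assumes I: "finite I" and E: "\<And>s. s \<in> I \<Longrightarrow> finite (E s)"
    and \<phi>: "\<And>s x. s \<in> I \<Longrightarrow> x \<in> space M \<Longrightarrow> \<phi> s x = (\<Sum>a\<in>E s. c s a * e a x)"
    and no_rel: "\<And>g. g \<in> PiE I E \<Longrightarrow> f dvd (\<Sum>s\<in>I. g s * laurent_monom (n s)) \<Longrightarrow> \<forall>s\<in>I. f dvd g s"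
  shows "integral\<^sup>L M (\<lambda>x. \<Prod>s\<in>I. \<phi> s (\<alpha> (n s) x)) = (\<Prod>s\<in>I. integral\<^sup>L M (\<phi> s))"
proof -
  have expand: "(\<Prod>s\<in>I. \<phi> s (\<alpha> (n s) x)) =
      (\<Sum>g\<in>PiE I E. (\<Prod>s\<in>I. c s (g s)) * e (\<Sum>s\<in>I. g s * laurent_monom (n s)) x)"
    if x: "x \<in> space M" for x
  proof -
    have "(\<Prod>s\<in>I. \<phi> s (\<alpha> (n s) x)) = (\<Prod>s\<in>I. \<Sum>a\<in>E s. c s a * e (a * laurent_monom (n s)) x)"
      using x by (intro prod.cong refl) (simp add: \<phi> \<alpha>_space e_\<alpha> mult.commute)
    also have "\<dots> = (\<Sum>g\<in>PiE I E. \<Prod>s\<in>I. c s (g s) * e (g s * laurent_monom (n s)) x)"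
      by (rule prod_sum_PiE[OF I E])
    finally show ?thesis by (simp add: prod.distrib e_sum[OF x])
  qed
  have "integral\<^sup>L M (\<lambda>x. \<Prod>s\<in>I. \<phi> s (\<alpha> (n s) x)) = integral\<^sup>L M
      (\<lambda>x. \<Sum>g\<in>PiE I E. (\<Prod>s\<in>I. c s (g s)) * e (\<Sum>s\<in>I. g s * laurent_monom (n s)) x)"
    by (intro Bochner_Integration.integral_cong refl expand)
  also have "\<dots> = (\<Sum>g\<in>PiE I E. (\<Prod>s\<in>I. c s (g s)) *
      (if f dvd (\<Sum>s\<in>I. g s * laurent_monom (n s)) then 1 else 0))"
    by (simp add: integral_e')
  also have "\<dots> = (\<Sum>g\<in>PiE I E. \<Prod>s\<in>I. if f dvd g s then c s (g s) else 0)"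
  proof (intro sum.cong refl)
    fix g assume g: "g \<in> PiE I E"
    show "(\<Prod>s\<in>I. c s (g s)) * (if f dvd (\<Sum>s\<in>I. g s * laurent_monom (n s)) then 1 else 0) =
        (\<Prod>s\<in>I. if f dvd g s then c s (g s) else 0)"
    proof (cases "\<forall>s\<in>I. f dvd g s")
      case True
      then have "f dvd (\<Sum>s\<in>I. g s * laurent_monom (n s))" by (intro dvd_sum dvd_mult2) auto
      then show ?thesis using True by simp
    next
      case False
      then show ?thesis using no_rel[OF g] I by (auto intro!: prod_zero[symmetric])
    qed
  qed
  also have "\<dots> = (\<Prod>s\<in>I. \<Sum>a\<in>E s. if f dvd a then c s a else 0)"
    by (rule prod_sum_PiE[OF I E, symmetric])
  also have "\<dots> = (\<Prod>s\<in>I. integral\<^sup>L M (\<phi> s))"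
    by (intro prod.cong refl integral_trig[symmetric]) (use \<phi> in auto)
  finally show ?thesis .
qed

lemma integral_indicator_complex:
  assumes "A \<in> sets M"
  shows "integral\<^sup>L M (\<lambda>x. indicator A x :: complex) = of_real (measure M A)"
proof -
  have "(\<lambda>x. indicator A x :: complex) = (\<lambda>x. of_real (indicator A x))"
    by (auto simp: indicator_def fun_eq_iff)
  then show ?thesis using assms by simp
qed

lemma measure_Int_cylinders:
  fixes n :: "'i \<Rightarrow> int ^ 'd"
  assumes I: "finite I" "I \<noteq> {}" and P: "\<And>s. s \<in> I \<Longrightarrow> finite (P s)"
    and E: "\<And>s. s \<in> I \<Longrightarrow> finite (E s)"
    and c: "\<And>s x. s \<in> I \<Longrightarrow> x \<in> space M \<Longrightarrow> indicator (cylinder (P s)) x = (\<Sum>a\<in>E s. c s a * e a x)"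
    and no_rel: "\<And>g. g \<in> PiE I E \<Longrightarrow> f dvd (\<Sum>s\<in>I. g s * laurent_monom (n s)) \<Longrightarrow> \<forall>s\<in>I. f dvd g s"
  shows "measure M (\<Inter>s\<in>I. \<alpha> (n s) -` cylinder (P s) \<inter> space M) = (\<Prod>s\<in>I. measure M (cylinder (P s)))"
proof -
  let ?A = "\<Inter>s\<in>I. \<alpha> (n s) -` cylinder (P s) \<inter> space M"
  have "?A \<in> sets M" using I P by (intro sets.finite_INT measurable_sets[OF \<alpha>_measurable] cylinder_sets) auto
  then have "of_real (measure M ?A) = integral\<^sup>L M (\<lambda>x. indicator ?A x :: complex)"
    by (rule integral_indicator_complex[symmetric])
  also have "\<dots> = integral\<^sup>L M (\<lambda>x. \<Prod>s\<in>I. indicator (cylinder (P s)) (\<alpha> (n s) x))"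
  proof (intro Bochner_Integration.integral_cong refl)
    fix x assume "x \<in> space M"
    then show "indicator ?A x = (\<Prod>s\<in>I. indicator (cylinder (P s)) (\<alpha> (n s) x) :: complex)"
      using I by (cases "x \<in> ?A") (auto intro!: prod_zero[symmetric] simp: indicator_def)
  qed
  also have "\<dots> = (\<Prod>s\<in>I. integral\<^sup>L M (\<lambda>x. indicator (cylinder (P s)) x))"
    by (rule integral_prod_trig[OF I(1) E c no_rel])
  also have "\<dots> = (\<Prod>s\<in>I. of_real (measure M (cylinder (P s))))"
    using P by (intro prod.cong refl integral_indicator_complex cylinder_sets)
  finally have "complex_of_real (measure M ?A) = of_real (\<Prod>s\<in>I. measure M (cylinder (P s)))" by simp
  then show ?thesis by (simp only: of_real_eq_iff)
qed

text \<open>Independence for a one-element index set: monomials are units, so no relation can arise.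
  Cylinders are an intersection-stable generator and determine the measure.\<close>

lemma distr_\<alpha>: "distr M M (\<alpha> n) = M"
proof (rule measure_eqI_generator_eq[OF Int_stable_cylinders cylinders_Pow])
  show "sets M = sigma_sets (space M) cylinders" by (rule sets_M')
  then show "sets (distr M M (\<alpha> n)) = sigma_sets (space M) cylinders" by simp
  show "range (\<lambda>_ :: nat. space M) \<subseteq> cylinders" using space_in_cylinders by auto
  fix A assume "A \<in> cylinders"
  then obtain P where P: "finite P" "A = cylinder P" by (auto simp: cylinders_def)
  obtain E c where E: "finite E" "\<forall>x\<in>space M. indicator (cylinder P) x = (\<Sum>a\<in>E. c a * e a x)"
    using trig_cylinder[OF P(1)] unfolding trig_def by blast
  have "measure M (\<Inter>s\<in>{()}. \<alpha> n -` cylinder P \<inter> space M) = (\<Prod>s\<in>{()}. measure M (cylinder P))"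
  proof (rule measure_Int_cylinders[where E = "\<lambda>_. E" and c = "\<lambda>_. c"])
    fix g :: "unit \<Rightarrow> ('d, 'p) laurent"
    assume "f dvd (\<Sum>s\<in>{()}. g s * laurent_monom n)"
    then show "\<forall>s\<in>{()}. f dvd g s"
      using dvd_unit_times_iff[OF laurent_monom_unit, of f n "g ()"] by (simp add: mult.commute)
  qed (use P E in auto)
  then show "emeasure (distr M M (\<alpha> n)) A = emeasure M A"
    using cylinder_sets[OF P(1)] by (simp add: emeasure_distr P(2) emeasure_eq_measure)
qed (auto simp: emeasure_distr emeasure_eq_measure)

lemma measure_preimage_\<alpha>: "A \<in> sets M \<Longrightarrow> measure M (\<alpha> n -` A \<inter> space M) = measure M A"
  using measure_distr[OF \<alpha>_measurable, of A n] by (simp add: distr_\<alpha>)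

text \<open>Fixed cylinders involve only finitely many coefficient vectors \<open>g\<close>; once
  none of the nontrivial ones gives a relation, both sides are equal.\<close>

lemma measure_Int_tendsto_cylinders:
  fixes n :: "nat \<Rightarrow> nat \<Rightarrow> int ^ 'd"
  assumes r: "r > 0"
    and no_rel: "\<And>a s. s < r \<Longrightarrow> \<not> f dvd a s \<Longrightarrow> eventually (\<lambda>j. \<not> relation_at f {..<r} a (n j)) sequentially"
    and A: "\<And>s. s < r \<Longrightarrow> A s \<in> cylinders"
  shows "(\<lambda>j. measure M (\<Inter>s<r. \<alpha> (n j s) -` A s \<inter> space M)) \<longlonglongrightarrow> (\<Prod>s<r. measure M (A s))"
proof -
  have "\<forall>s\<in>{..<r}. \<exists>P. finite P \<and> A s = cylinder P" using A by (auto simp: cylinders_def)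
  from bchoice[OF this] obtain P where P: "\<forall>s\<in>{..<r}. finite (P s) \<and> A s = cylinder (P s)" ..
  have "\<forall>s\<in>{..<r}. \<exists>Ec. finite (fst Ec) \<and>
      (\<forall>x\<in>space M. indicator (cylinder (P s)) x = (\<Sum>a\<in>fst Ec. snd Ec a * e a x))"
    using P trig_cylinder unfolding trig_def by fastforce
  from bchoice[OF this] obtain Ec where Ec: "\<forall>s\<in>{..<r}. finite (fst (Ec s)) \<and>
      (\<forall>x\<in>space M. indicator (cylinder (P s)) x = (\<Sum>a\<in>fst (Ec s). snd (Ec s) a * e a x))" ..
  let ?G = "PiE {..<r} (\<lambda>s. fst (Ec s))"
  have "finite ?G" using Ec by (intro finite_PiE) auto
  moreover have "eventually (\<lambda>j. f dvd (\<Sum>s<r. g s * laurent_monom (n j s)) \<longrightarrow>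
      (\<forall>s<r. f dvd g s)) sequentially" for g
  proof (cases "\<forall>s<r. f dvd g s")
    case False
    then obtain s where "s < r" "\<not> f dvd g s" by blast
    then have "eventually (\<lambda>j. \<not> relation_at f {..<r} g (n j)) sequentially" by (rule no_rel)
    then show ?thesis by eventually_elim (simp add: relation_at_def)
  qed simp
  ultimately have "eventually (\<lambda>j. \<forall>g\<in>?G. f dvd (\<Sum>s<r. g s * laurent_monom (n j s)) \<longrightarrow>
      (\<forall>s<r. f dvd g s)) sequentially"
    by (simp add: eventually_ball_finite)
  then have "eventually (\<lambda>j. measure M (\<Inter>s<r. \<alpha> (n j s) -` A s \<inter> space M) =
      (\<Prod>s<r. measure M (A s))) sequentially"
  proof eventually_elim
    case (elim j)
    have "measure M (\<Inter>s<r. \<alpha> (n j s) -` cylinder (P s) \<inter> space M) = (\<Prod>s<r. measure M (cylinder (P s)))"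
      by (rule measure_Int_cylinders[where E = "\<lambda>s. fst (Ec s)" and c = "\<lambda>s. snd (Ec s)"])
        (use P Ec r elim in auto)
    then show ?case using P by simp
  qed
  then show ?thesis by (rule tendsto_eventually)
qed

text \<open>In \<open>claim\<close>, cylinders give way to arbitrary measurable sets one index at a
  time; each replacement is a Dynkin-system induction in that coordinate with the other sets
  fixed.\<close>

lemma measure_Int_tendsto:
  fixes n :: "nat \<Rightarrow> nat \<Rightarrow> int ^ 'd"
  assumes r: "r > 0"
    and no_rel: "\<And>a s. s < r \<Longrightarrow> \<not> f dvd a s \<Longrightarrow> eventually (\<lambda>j. \<not> relation_at f {..<r} a (n j)) sequentially"
    and A: "\<And>s. s < r \<Longrightarrow> A s \<in> sets M"
  shows "(\<lambda>j. measure M (\<Inter>s<r. \<alpha> (n j s) -` A s \<inter> space M)) \<longlonglongrightarrow> (\<Prod>s<r. measure M (A s))"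
proof -
  have claim: "(\<lambda>j. measure M (\<Inter>s<r. \<alpha> (n j s) -` A s \<inter> space M)) \<longlonglongrightarrow> (\<Prod>s<r. measure M (A s))"
    if "k \<le> r" "\<forall>s<k. A s \<in> sets M" "\<forall>s. k \<le> s \<and> s < r \<longrightarrow> A s \<in> cylinders" for k A
    using that
  proof (induction k arbitrary: A)
    case 0
    then show ?case by (intro measure_Int_tendsto_cylinders[OF r no_rel]) auto
  next
    case (Suc k)
    define G where "G j = (\<Inter>s\<in>{..<r} - {k}. \<alpha> (n j s) -` A s \<inter> space M)" for j
    define V where "V B j = measure M (G j \<inter> (\<alpha> (n j k) -` B \<inter> space M))" for B j
    define \<kappa> where "\<kappa> = (\<Prod>s\<in>{..<r} - {k}. measure M (A s))"
    have kr: "{..<r} = insert k ({..<r} - {k})" using Suc.prems(1) by auto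
    have sets_A: "A s \<in> sets M" if "s < r" for s
    proof (cases "s < Suc k")
      case False
      then have "A s \<in> cylinders" using Suc.prems(3) that by simp
      then show ?thesis unfolding sets_M' by (rule sigma_sets.Basic)
    qed (use Suc.prems in simp)
    have split: "(\<Inter>s\<in>insert k ({..<r} - {k}). \<alpha> (n j s) -` (A(k := B)) s \<inter> space M) =
        G j \<inter> (\<alpha> (n j k) -` B \<inter> space M)" for B j
    proof -
      have "(\<Inter>s\<in>{..<r} - {k}. \<alpha> (n j s) -` (A(k := B)) s \<inter> space M) = G j"
        unfolding G_def by (intro INF_cong refl) auto
      then show ?thesis by (simp only: INT_insert fun_upd_same Int_commute)
    qed
    have G_meas: "G j \<inter> (\<alpha> (n j k) -` B \<inter> space M) \<in> sets M" if "B \<in> sets M" for B j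
    proof -
      have "(\<Inter>s\<in>insert k ({..<r} - {k}). \<alpha> (n j s) -` (A(k := B)) s \<inter> space M) \<in> sets M"
        using that sets_A by (intro sets.finite_INT measurable_sets[OF \<alpha>_measurable]) auto
      then show ?thesis unfolding split .
    qed
    have V_eq: "V B = (\<lambda>j. measure M (\<Inter>s<r. \<alpha> (n j s) -` (A(k := B)) s \<inter> space M))" for B
    proof
      fix j
      show "V B j = measure M (\<Inter>s<r. \<alpha> (n j s) -` (A(k := B)) s \<inter> space M)"
        unfolding V_def by (subst kr) (simp only: split)
    qed
    have prod_eq: "(\<Prod>s<r. measure M ((A(k := B)) s)) = measure M B * \<kappa>" for B
    proof -
      have "(\<Prod>s\<in>{..<r} - {k}. measure M ((A(k := B)) s)) = \<kappa>" unfolding \<kappa>_def by (intro prod.cong) auto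
      then show ?thesis by (subst kr, subst prod.insert) auto
    qed
    have cyl: "V B \<longlonglongrightarrow> measure M B * \<kappa>" if "B \<in> cylinders" for B
      using Suc.IH[of "A(k := B)"] Suc.prems that unfolding V_eq prod_eq by auto
    have "V B \<longlonglongrightarrow> measure M B * \<kappa>" if "B \<in> sigma_sets (space M) cylinders" for B
      using Int_stable_cylinders cylinders_Pow that
    proof (induction rule: sigma_sets_induct_disjoint)
      case (basic B)
      then show ?case by (rule cyl)
    next
      case empty
      then show ?case by (simp add: V_def)
    next
      case (compl B)
      have B: "B \<in> sets M" using compl(1) by (simp add: sets_M')
      have V_compl: "V (space M - B) j = V (space M) j - V B j" for j
      proof -
        have "G j \<inter> (\<alpha> (n j k) -` (space M - B) \<inter> space M) =
            (G j \<inter> (\<alpha> (n j k) -` space M \<inter> space M)) - (G j \<inter> (\<alpha> (n j k) -` B \<inter> space M))" by auto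
        then show ?thesis unfolding V_def
          by (simp only:) (intro finite_measure_Diff G_meas B sets.top, auto simp: \<alpha>_space)
      qed
      have "(\<lambda>j. V (space M) j - V B j) \<longlonglongrightarrow> measure M (space M) * \<kappa> - measure M B * \<kappa>"
        by (intro tendsto_diff cyl[OF space_in_cylinders] compl(2))
      then show ?case unfolding V_compl using B
        by (simp add: finite_measure_compl left_diff_distrib)
    next
      case (union B)
      have B: "B i \<in> sets M" for i using union(2) by (auto simp: sets_M')
      \<comment> \<open>Invariance of the measure makes this bound independent of \<open>j\<close>;
        it is the domination that allows exchanging the limit with the infinite sum.\<close>
      have V_le: "norm (V (B i) j) \<le> measure M (B i)" for i j
      proof -
        have "V (B i) j \<le> measure M (\<alpha> (n j k) -` B i \<inter> space M)"
          unfolding V_def by (intro finite_measure_mono measurable_sets[OF \<alpha>_measurable B]) auto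
        then show ?thesis by (simp add: measure_preimage_\<alpha>[OF B]) (simp add: V_def)
      qed
      have sums_B: "(\<lambda>i. measure M (B i)) sums measure M (\<Union>i. B i)"
        using B union(1) by (intro finite_measure_UNION) auto
      have V_sums: "(\<lambda>i. V (B i) j) sums V (\<Union>i. B i) j" for j
      proof -
        have "(\<lambda>i. measure M (G j \<inter> (\<alpha> (n j k) -` B i \<inter> space M))) sums
            measure M (\<Union>i. G j \<inter> (\<alpha> (n j k) -` B i \<inter> space M))"
        proof (rule finite_measure_UNION)
          have "B l \<inter> B m = {}" if "l \<noteq> m" for l m
            using union(1) that by (auto simp: disjoint_family_on_def)
          then show "disjoint_family (\<lambda>i. G j \<inter> (\<alpha> (n j k) -` B i \<inter> space M))"
            unfolding disjoint_family_on_def by blast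
        qed (use G_meas[OF B] in auto)
        moreover have "(\<Union>i. G j \<inter> (\<alpha> (n j k) -` B i \<inter> space M)) =
            G j \<inter> (\<alpha> (n j k) -` (\<Union>i. B i) \<inter> space M)" by auto
        ultimately show ?thesis by (simp add: V_def)
      qed
      have "(\<lambda>j. suminf (\<lambda>i. V (B i) j)) \<longlonglongrightarrow> suminf (\<lambda>i. measure M (B i) * \<kappa>)"
        using tannerys_theorem[of "\<lambda>i. V (B i)" "\<lambda>i. measure M (B i) * \<kappa>" sequentially "\<lambda>i. measure M (B i)"]
          union(3) V_le sums_summable[OF sums_B] by (simp add: always_eventually)
      moreover have "suminf (\<lambda>i. V (B i) j) = V (\<Union>i. B i) j" for j
        using V_sums[of j] by (rule sums_unique[symmetric])
      moreover have "suminf (\<lambda>i. measure M (B i) * \<kappa>) = measure M (\<Union>i. B i) * \<kappa>"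
        using sums_mult2[OF sums_B, of \<kappa>] by (rule sums_unique[symmetric])
      ultimately show ?case by simp
    qed
    then have "V (A k) \<longlonglongrightarrow> measure M (A k) * \<kappa>" using sets_A[of k] Suc.prems(1) by (simp add: sets_M')
    then show ?case using prod_eq[of "A k"] unfolding V_eq by simp
  qed
  show ?thesis by (rule claim[of r A]) (use A in auto)
qed

text \<open>Test sets: the kernels of the characters \<open>a s\<close>, but the complement at
  \<open>i\<close>. Under a relation the shifted characters multiply to 1, so the one at
  \<open>i\<close> is 1 wherever the others are, and the intersection is empty; yet the product of
  the measures is positive.\<close>

lemma not_tendsto_if_relation:
  fixes n :: "nat \<Rightarrow> 'i \<Rightarrow> int ^ 'd"
  assumes I: "finite I" and i: "i \<in> I" "\<not> f dvd a i"
    and rel: "frequently (\<lambda>j. f dvd (\<Sum>s\<in>I. a s * laurent_monom (n j s))) sequentially"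
  obtains A where "\<And>s. A s \<in> sets M"
    "\<not> ((\<lambda>j. measure M (\<Inter>s\<in>I. \<alpha> (n j s) -` A s \<inter> space M)) \<longlonglongrightarrow> (\<Prod>s\<in>I. measure M (A s)))"
proof
  let ?C = "\<lambda>s. cylinder {(a s, 1)}"
  define A where "A s = (if s = i then space M - ?C s else ?C s)" for s
  have C: "?C s \<in> sets M" for s by (simp add: cylinder_sets)
  show A: "A s \<in> sets M" for s using C by (simp add: A_def)
  \<comment> \<open>Off the kernel the first p powers of the character sum to 0, so a null kernel
    would give integral 0. But the exponent 0 contributes 1 and no exponent contributes
    negatively.\<close>
  have pos1: "measure M (?C s) > 0" for s
  proof (rule ccontr)
    assume "\<not> measure M (?C s) > 0"
    then have "measure M (?C s) = 0" by (simp add: zero_less_measure_iff)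
    then have "?C s \<in> null_sets M" using C by (simp add: null_setsI emeasure_eq_measure)
    then have ae: "AE x in M. x \<notin> ?C s" by (rule AE_not_in)
    have "AE x in M. (\<Sum>k<CARD('p). e (of_nat k * a s) x) = 0"
      using ae AE_space
    proof eventually_elim
      case (elim x)
      then have "e (a s) x \<noteq> 1" by (simp add: cylinder_def)
      then show ?case using sum_roots_of_unity[OF e_power_CARD[OF elim(2), of "a s"]]
        by (simp add: e_of_nat_times[OF elim(2)])
    qed
    then have "integral\<^sup>L M (\<lambda>x. \<Sum>k<CARD('p). e (of_nat k * a s) x) = 0"
      by (rule integral_eq_zero_AE)
    then have "(\<Sum>k<CARD('p). if f dvd of_nat k * a s then 1 else 0 :: complex) = 0"
      by (simp add: integral_e')
    then have "of_nat (card {k\<in>{..<CARD('p)}. f dvd of_nat k * a s}) = (0 :: complex)"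
      by (simp add: sum.If_cases Int_def)
    then have "card {k\<in>{..<CARD('p)}. f dvd of_nat k * a s} = 0" by (simp only: of_nat_eq_0_iff)
    then have "{k\<in>{..<CARD('p)}. f dvd of_nat k * a s} = {}" by simp
    moreover have "0 \<in> {k\<in>{..<CARD('p)}. f dvd of_nat k * a s}" by simp
    ultimately show False by blast
  qed
  \<comment> \<open>Otherwise the character would be 1 almost everywhere and have integral 1 instead
    of 0.\<close>
  have pos2: "measure M (space M - ?C i) > 0"
  proof (rule ccontr)
    assume "\<not> measure M (space M - ?C i) > 0"
    then have "measure M (space M - ?C i) = 0" by (simp add: zero_less_measure_iff)
    then have "space M - ?C i \<in> null_sets M" using C by (simp add: null_setsI emeasure_eq_measure)
    then have ae: "AE x in M. x \<notin> space M - ?C i" by (rule AE_not_in)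
    have "AE x in M. e (a i) x = 1"
      using ae AE_space by eventually_elim (auto simp: cylinder_def)
    then have "integral\<^sup>L M (e (a i)) = integral\<^sup>L M (\<lambda>_. 1)" by (intro integral_cong_AE) auto
    then show False using i(2) by (simp add: integral_e prob_space)
  qed
  have pos: "(\<Prod>s\<in>I. measure M (A s)) > 0"
    using pos1 pos2 by (intro prod_pos) (auto simp: A_def)
  have empty: "measure M (\<Inter>s\<in>I. \<alpha> (n j s) -` A s \<inter> space M) = 0"
    if j: "f dvd (\<Sum>s\<in>I. a s * laurent_monom (n j s))" for j
  proof -
    have "x \<notin> (\<Inter>s\<in>I. \<alpha> (n j s) -` A s \<inter> space M)" for x
    proof
      assume x: "x \<in> (\<Inter>s\<in>I. \<alpha> (n j s) -` A s \<inter> space M)"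
      then have xM: "x \<in> space M" using i(1) by blast
      have es: "e (a s * laurent_monom (n j s)) x = e (a s) (\<alpha> (n j s) x)" for s
        by (simp add: e_\<alpha>[OF xM] mult.commute)
      have "(\<Prod>s\<in>I. e (a s) (\<alpha> (n j s) x)) = e (\<Sum>s\<in>I. a s * laurent_monom (n j s)) x"
        by (simp add: e_sum[OF xM] es)
      also have "\<dots> = 1" using j xM by (rule e_dvd)
      finally have "e (a i) (\<alpha> (n j i) x) * (\<Prod>s\<in>I - {i}. e (a s) (\<alpha> (n j s) x)) = 1"
        by (simp add: prod.remove[OF I i(1)])
      moreover have "(\<Prod>s\<in>I - {i}. e (a s) (\<alpha> (n j s) x)) = 1"
      proof (intro prod.neutral ballI)
        fix s assume s: "s \<in> I - {i}"
        then have "\<alpha> (n j s) x \<in> A s" using x by blast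
        then show "e (a s) (\<alpha> (n j s) x) = 1" using s by (simp add: A_def cylinder_def)
      qed
      ultimately have "e (a i) (\<alpha> (n j i) x) = 1" by simp
      moreover have "\<alpha> (n j i) x \<in> A i" using x i(1) by blast
      ultimately show False by (simp add: A_def cylinder_def)
    qed
    then have "(\<Inter>s\<in>I. \<alpha> (n j s) -` A s \<inter> space M) = {}" by blast
    then show ?thesis by simp
  qed
  show "\<not> ((\<lambda>j. measure M (\<Inter>s\<in>I. \<alpha> (n j s) -` A s \<inter> space M)) \<longlonglongrightarrow> (\<Prod>s\<in>I. measure M (A s)))"
  proof
    assume "(\<lambda>j. measure M (\<Inter>s\<in>I. \<alpha> (n j s) -` A s \<inter> space M)) \<longlonglongrightarrow> (\<Prod>s\<in>I. measure M (A s))"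
    from order_tendstoD(1)[OF this pos]
    have "eventually (\<lambda>j. \<not> f dvd (\<Sum>s\<in>I. a s * laurent_monom (n j s))) sequentially"
      by eventually_elim (use empty in force)
    then show False using rel by (simp add: frequently_def)
  qed
qed

end

section \<open>The dual group\<close>

lemma cring_laurent_ring: "cring (laurent_ring :: ('d::finite, 'p::prime_card) laurent ring)"
proof (rule cringI)
  show "abelian_group (laurent_ring :: ('d, 'p) laurent ring)"
  proof (rule abelian_groupI)
    fix x :: "('d, 'p) laurent"
    show "\<exists>y\<in>carrier laurent_ring. y \<oplus>\<^bsub>laurent_ring\<^esub> x = \<zero>\<^bsub>laurent_ring\<^esub>"
      by (rule bexI[of _ "- x"]) (simp_all add: laurent_ring_def)
  qed (simp_all add: laurent_ring_def algebra_simps)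
  show "comm_monoid (laurent_ring :: ('d, 'p) laurent ring)"
    by (rule comm_monoidI) (simp_all add: laurent_ring_def algebra_simps)
qed (simp add: laurent_ring_def algebra_simps)

definition laurent_class :: "('d::finite, 'p::prime_card) laurent \<Rightarrow> ('d, 'p) laurent \<Rightarrow> ('d, 'p) laurent set"
  where "laurent_class f a = PIdl\<^bsub>laurent_ring\<^esub> f +>\<^bsub>laurent_ring\<^esub> a"

lemma laurent_class_alt: "laurent_class f a = {x. f dvd x - a}"
proof -
  have "laurent_class f a = {h + a | h. f dvd h}"
    by (auto simp: laurent_class_def a_r_coset_def' cgenideal_def laurent_ring_def dvd_def mult.commute)
  also have "\<dots> = {x. f dvd x - a}"
  proof (intro subset_antisym subsetI)
    fix x assume "x \<in> {x. f dvd x - a}"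
    then show "x \<in> {h + a | h. f dvd h}" by (intro CollectI exI[of _ "x - a"]) simp
  qed auto
  finally show ?thesis .
qed

lemma laurent_class_eq_iff: "laurent_class f a = laurent_class f b \<longleftrightarrow> f dvd a - b"
proof
  assume "laurent_class f a = laurent_class f b"
  moreover have "a \<in> laurent_class f a" by (simp add: laurent_class_alt)
  ultimately show "f dvd a - b" by (simp add: laurent_class_alt)
next
  assume d: "f dvd a - b"
  have "f dvd x - a \<longleftrightarrow> f dvd x - b" for x
    using dvd_add[OF _ d, of "x - a"] dvd_diff[OF _ d, of "x - b"] by auto
  then show "laurent_class f a = laurent_class f b" by (simp add: laurent_class_alt)
qed

lemma carrier_principal_quotient: "carrier (principal_quotient f) = range (laurent_class f)"
  by (auto simp: principal_quotient_def FactRing_def A_RCOSETS_def' laurent_class_def laurent_ring_def)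

lemma laurent_class_ring_hom:
  fixes f :: "('d::finite, 'p::prime_card) laurent"
  shows "laurent_class f \<in> Ring.ring_hom laurent_ring (principal_quotient f)"
proof -
  interpret cring "laurent_ring :: ('d, 'p) laurent ring" by (rule cring_laurent_ring)
  interpret I: ideal "PIdl\<^bsub>laurent_ring\<^esub> f" laurent_ring
    by (rule cgenideal_ideal) (simp add: laurent_ring_def)
  have "laurent_class f = (+>\<^bsub>laurent_ring\<^esub>) (PIdl\<^bsub>laurent_ring\<^esub> f)"
    by (simp add: laurent_class_def fun_eq_iff)
  then show ?thesis using I.rcos_ring_hom by (simp add: principal_quotient_def)
qed

lemma add_laurent_class:
  "laurent_class f a \<oplus>\<^bsub>principal_quotient f\<^esub> laurent_class f b = laurent_class f (a + b)"
  using ring_hom_add[OF laurent_class_ring_hom, of a b f] by (simp add: laurent_ring_def)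

lemma mult_laurent_class:
  "laurent_class f a \<otimes>\<^bsub>principal_quotient f\<^esub> laurent_class f b = laurent_class f (a * b)"
  using ring_hom_mult[OF laurent_class_ring_hom, of a b f] by (simp add: laurent_ring_def)

lemma carrier_dual_group:
  "\<xi> \<in> carrier (dual_group f) \<longleftrightarrow> \<xi> \<in> extensional (range (laurent_class f)) \<and>
    (\<forall>a. norm (\<xi> (laurent_class f a)) = 1) \<and>
    (\<forall>a b. \<xi> (laurent_class f (a + b)) = \<xi> (laurent_class f a) * \<xi> (laurent_class f b))"
  by (auto simp: dual_group_def pontryagin_dual_def hom_def circle_group_def
    carrier_principal_quotient add_laurent_class Pi_iff)

lemma dual_group_eval_dvd:
  assumes "\<xi> \<in> carrier (dual_group f)" "f dvd a"
  shows "\<xi> (laurent_class f a) = 1"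
proof -
  have a: "laurent_class f a = laurent_class f 0" using assms(2) by (simp add: laurent_class_eq_iff)
  have "\<xi> (laurent_class f (0 + 0)) = \<xi> (laurent_class f 0) * \<xi> (laurent_class f 0)"
    "norm (\<xi> (laurent_class f 0)) = 1"
    using assms(1) unfolding carrier_dual_group by blast+
  then show ?thesis unfolding a by auto
qed

text \<open>Linear algebra over the prime field: a basis of the ideal stays independent when
  \<open>a\<close> is adjoined, so the values 0 and 1 can be prescribed.\<close>

lemma linear_functional_mod_ideal:
  fixes f a :: "('d::finite, 'p::prime_card) laurent"
  assumes "\<not> f dvd a"
  obtains l :: "('d, 'p) laurent \<Rightarrow> 'p mod_ring"
  where "\<And>x y. l (x + y) = l x + l y" "\<And>x. f dvd x \<Longrightarrow> l x = 0" "l a = 1"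
proof -
  define scale :: "'p mod_ring \<Rightarrow> ('d, 'p) laurent \<Rightarrow> ('d, 'p) laurent"
    where "scale c x = Poly_Mapping.single 0 c * x" for c x
  interpret vector_space_pair scale "(*) :: 'p mod_ring \<Rightarrow> _"
    by unfold_locales (simp_all add: scale_def algebra_simps single_add mult_single flip: mult.assoc)
  let ?S = "{x. f dvd x}"
  have S: "vs1.subspace ?S" by (auto simp: vs1.subspace_def scale_def)
  obtain B where B: "B \<subseteq> ?S" "vs1.independent B" "?S \<subseteq> vs1.span B"
    using vs1.maximal_independent_subset[of ?S] .
  have "vs1.span B \<subseteq> ?S" using B(1) S by (rule vs1.span_minimal)
  then have "a \<notin> vs1.span B" using assms by blast
  then have "vs1.independent (insert a B)" using B(2) by (rule vs1.independent_insertI)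
  from linear_independent_extend[OF this, of "\<lambda>x. if x = a then 1 else 0"]
  obtain l where l: "Vector_Spaces.linear scale (*) l" "\<forall>x\<in>insert a B. l x = (if x = a then 1 else 0)"
    by blast
  have lB: "l x = 0" if "x \<in> B" for x using l(2) that B(1) assms by auto
  have "l x = 0" if "f dvd x" for x
    using linear_eq_0_on_span[OF l(1) lB, of B x] B(3) that by blast
  moreover have "l (x + y) = l x + l y" for x y using l(1) by (rule linear_add)
  ultimately show ?thesis using that[of l] l(2) by simp
qed

lemma nontrivial_character_mod_ring:
  obtains h :: "'p::prime_card mod_ring \<Rightarrow> complex"
  where "\<And>c d. h (c + d) = h c * h d" "\<And>c. norm (h c) = 1" "h 1 \<noteq> 1"
proof -
  let ?p = "CARD('p)"
  have p2: "?p \<ge> 2" using prime_ge_2_nat[OF prime_card[where 'a = 'p]] .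
  define \<omega> where "\<omega> = cis (2 * pi / ?p)"
  have \<omega>p: "\<omega> ^ ?p = 1" using p2 by (simp add: \<omega>_def Complex.DeMoivre cis_2pi)
  have mod: "\<omega> ^ (n mod ?p) = \<omega> ^ n" for n
  proof -
    have "\<omega> ^ n = \<omega> ^ (?p * (n div ?p) + n mod ?p)" by simp
    also have "\<dots> = \<omega> ^ (n mod ?p)" unfolding power_add power_mult \<omega>p by simp
    finally show ?thesis ..
  qed
  have \<omega>1: "\<omega> \<noteq> 1"
  proof
    assume "\<omega> = 1"
    then have "cos (2 * pi / ?p) = 1" by (simp add: \<omega>_def complex_eq_iff)
    moreover have "cos (2 * pi / ?p) < cos 0"
      using p2 by (intro cos_monotone_0_pi) (auto simp: field_simps)
    ultimately show False by simp
  qed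
  define h :: "'p mod_ring \<Rightarrow> complex" where "h c = \<omega> ^ nat (to_int_mod_ring c)" for c
  have range: "0 \<le> to_int_mod_ring c" for c :: "'p mod_ring"
    using range_to_int_mod_ring[where 'a = 'p] by (auto dest: equalityD1)
  have "h (c + d) = h c * h d" for c d
    unfolding h_def to_int_mod_ring_add
    using range[of c] range[of d]
    by (simp add: nat_mod_distrib nat_add_distrib mod power_add)
  moreover have "norm (h c) = 1" for c by (simp add: h_def norm_power \<omega>_def)
  moreover have "h 1 \<noteq> 1"
    using \<omega>1 p2 by (simp add: h_def)
  ultimately show ?thesis using that by blast
qed

lemma dual_group_separates:
  fixes f a :: "('d::finite, 'p::prime_card) laurent"
  assumes "\<not> f dvd a"
  obtains \<xi> where "\<xi> \<in> carrier (dual_group f)" "\<xi> (laurent_class f a) \<noteq> 1"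
proof -
  obtain l :: "('d, 'p) laurent \<Rightarrow> 'p mod_ring"
    where l: "\<And>x y. l (x + y) = l x + l y" "\<And>x. f dvd x \<Longrightarrow> l x = 0" "l a = 1"
    using linear_functional_mod_ideal[OF assms] by blast
  obtain h :: "'p mod_ring \<Rightarrow> complex"
    where h: "\<And>c d. h (c + d) = h c * h d" "\<And>c. norm (h c) = 1" "h 1 \<noteq> 1"
    using nontrivial_character_mod_ring by blast
  \<comment> \<open>\<open>inv_into\<close> picks a representative of the coset; the choice is
    immaterial because \<open>l\<close> vanishes on the ideal.\<close>
  define \<xi> where "\<xi> = (\<lambda>m\<in>range (laurent_class f). h (l (inv_into UNIV (laurent_class f) m)))"
  have \<xi>: "\<xi> (laurent_class f x) = h (l x)" for x
  proof -
    let ?y = "inv_into UNIV (laurent_class f) (laurent_class f x)"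
    have "laurent_class f ?y = laurent_class f x" by (simp add: f_inv_into_f)
    then have "l (?y - x) = 0" using l(2) by (simp add: laurent_class_eq_iff)
    then have "l ?y = l x" using l(1)[of "?y - x" x] by simp
    then show ?thesis by (simp add: \<xi>_def)
  qed
  have "\<xi> \<in> carrier (dual_group f)"
    unfolding carrier_dual_group \<xi> by (auto simp: \<xi>_def h l)
  moreover have "\<xi> (laurent_class f a) \<noteq> 1" using h(3) by (simp add: \<xi> l)
  ultimately show ?thesis using that by blast
qed

lemma algebraic_action_eval:
  "algebraic_action f n \<xi> (laurent_class f a) = \<xi> (laurent_class f (laurent_monom n * a))"
  by (simp add: algebraic_action_def carrier_principal_quotient mult_laurent_class flip: laurent_class_def)

lemma algebraic_action_carrier:
  assumes "\<xi> \<in> carrier (dual_group f)"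
  shows "algebraic_action f n \<xi> \<in> carrier (dual_group f)"
proof -
  have "algebraic_action f n \<xi> \<in> extensional (range (laurent_class f))"
    by (simp add: algebraic_action_def carrier_principal_quotient)
  then show ?thesis using assms unfolding carrier_dual_group algebraic_action_eval
    by (simp add: distrib_left)
qed

section \<open>Borel sets and cylinders of the dual group\<close>

lemma countable_laurent: "countable (UNIV :: ('d::finite, 'p::prime_card) laurent set)"
proof -
  have "(UNIV :: ('d, 'p) laurent set) = (\<Union>B :: int. {h. keys_within B h})"
    using ex_keys_within by blast
  also have "countable \<dots>" by (rule countable_UN) (auto intro: countable_finite finite_keys_within)
  finally show ?thesis .
qed

lemma topspace_dual_group: "topspace (dual_group_topology f) = carrier (dual_group f)"
  by (auto simp: dual_group_topology_def dual_topology_def dual_group_def pontryagin_dual_def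
    topspace_product_topology PiE_UNIV_domain extensional_def)

lemma openin_dual_topology_cylinder:
  assumes U: "openin (dual_group_topology f) U" and \<xi>: "\<xi> \<in> U"
  obtains E where "finite E"
    "\<And>\<eta>. \<eta> \<in> carrier (dual_group f) \<Longrightarrow> (\<And>a. a \<in> E \<Longrightarrow> \<eta> (laurent_class f a) = \<xi> (laurent_class f a)) \<Longrightarrow> \<eta> \<in> U"
proof -
  let ?Q = "range (laurent_class f)"
  have top: "dual_group_topology f =
      subtopology (product_topology (\<lambda>_. euclidean) ?Q) (carrier (dual_group f))"
    by (simp add: dual_group_topology_def dual_topology_def dual_group_def carrier_principal_quotient)
  obtain V where V: "openin (product_topology (\<lambda>_. euclidean) ?Q) V" "U = V \<inter> carrier (dual_group f)"
    using U unfolding top openin_subtopology by blast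
  have "\<xi> \<in> V" using \<xi> V(2) by blast
  then obtain W where W: "finite {m \<in> ?Q. W m \<noteq> UNIV}" "\<xi> \<in> PiE ?Q W" "PiE ?Q W \<subseteq> V"
    using V(1) unfolding openin_product_topology_alt by (auto simp: PiE_iff)
  obtain E where E: "finite E" "{m \<in> ?Q. W m \<noteq> UNIV} = laurent_class f ` E"
    using finite_subset_image[OF W(1), of "laurent_class f" UNIV] by auto
  show ?thesis
  proof (rule that[OF E(1)])
    fix \<eta> assume \<eta>: "\<eta> \<in> carrier (dual_group f)"
      "\<And>a. a \<in> E \<Longrightarrow> \<eta> (laurent_class f a) = \<xi> (laurent_class f a)"
    have "\<eta> \<in> PiE ?Q W"
    proof (rule PiE_I)
      fix m assume m: "m \<in> ?Q"
      show "\<eta> m \<in> W m"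
      proof (cases "W m = UNIV")
        case False
        then have "m \<in> laurent_class f ` E" using m E(2) by blast
        then have "\<eta> m = \<xi> m" using \<eta>(2) by auto
        then show ?thesis using W(2) m by (simp add: PiE_mem)
      qed simp
    next
      fix m assume "m \<notin> ?Q"
      then show "\<eta> m = undefined" using \<eta>(1) unfolding carrier_dual_group by (simp add: extensional_def)
    qed
    then show "\<eta> \<in> U" using W(3) V(2) \<eta>(1) by blast
  qed
qed

lemma dual_group_eval_root:
  fixes f :: "('d::finite, 'p::prime_card) laurent"
  assumes "\<xi> \<in> carrier (dual_group f)"
  shows "\<xi> (laurent_class f a) ^ CARD('p) = 1"
proof -
  have "\<xi> (laurent_class f (of_nat k * a)) = \<xi> (laurent_class f a) ^ k" for k
  proof (induction k)
    case 0
    then show ?case using dual_group_eval_dvd[OF assms, of 0] by simp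
  next
    case (Suc k)
    have "\<xi> (laurent_class f (a + of_nat k * a)) = \<xi> (laurent_class f a) * \<xi> (laurent_class f (of_nat k * a))"
      using assms unfolding carrier_dual_group by blast
    then show ?case by (simp add: Suc distrib_right)
  qed
  from this[of "CARD('p)"] show ?thesis
    using of_nat_CHAR[where 'a = "('d, 'p) laurent"] dual_group_eval_dvd[OF assms, of 0]
    by (simp add: CHAR_laurent)
qed

definition dual_cylinder ::
  "('d::finite, 'p::prime_card) laurent \<Rightarrow> (('d, 'p) laurent \<times> complex) set \<Rightarrow> (('d, 'p) laurent set \<Rightarrow> complex) set"
  where "dual_cylinder f P = {\<xi> \<in> carrier (dual_group f). \<forall>(a, z)\<in>P. \<xi> (laurent_class f a) = z}"

lemma countable_dual_cylinders:
  fixes f :: "('d::finite, 'p::prime_card) laurent"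
  shows "countable (dual_cylinder f ` {P. finite P \<and> P \<subseteq> UNIV \<times> {z. z ^ CARD('p) = 1}})"
proof -
  have "finite {z :: complex. z ^ CARD('p) = 1}"
    by (rule finite_roots_unity) (simp add: Suc_leI)
  then have "countable ((UNIV :: ('d, 'p) laurent set) \<times> {z :: complex. z ^ CARD('p) = 1})"
    by (intro countable_SIGMA countable_laurent countable_finite)
  then have "countable {P. finite P \<and> P \<subseteq> (UNIV :: ('d, 'p) laurent set) \<times> {z :: complex. z ^ CARD('p) = 1}}"
    by (simp add: countable_Collect_finite_subset conj_commute)
  then show ?thesis by (rule countable_image)
qed

text \<open>An open set is the union of the cylinders inside it, and countably many suffice because
  the ring is countable and only p-th roots of unity occur as values. Conversely cylinders are
  closed, as point conditions on continuous coordinates.\<close>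

lemma sigma_sets_dual_cylinders:
  fixes f :: "('d::finite, 'p::prime_card) laurent"
  shows "sigma_sets (carrier (dual_group f)) {U. openin (dual_group_topology f) U} =
    sigma_sets (carrier (dual_group f)) (dual_cylinder f ` {P. finite P})"
proof (rule sigma_sets_eqI)
  let ?X = "carrier (dual_group f)"
  fix U assume "U \<in> {U. openin (dual_group_topology f) U}"
  then have U: "openin (dual_group_topology f) U" by simp
  let ?C = "dual_cylinder f ` {P. finite P \<and> P \<subseteq> UNIV \<times> {z. z ^ CARD('p) = 1}}"
  have UX: "U \<subseteq> ?X" using openin_subset[OF U] by (simp add: topspace_dual_group)
  have "U = \<Union>{C \<in> ?C. C \<subseteq> U}"
  proof (intro subset_antisym subsetI)
    fix \<xi> assume \<xi>: "\<xi> \<in> U"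
    obtain E where E: "finite E" "\<And>\<eta>. \<eta> \<in> ?X \<Longrightarrow>
        (\<And>a. a \<in> E \<Longrightarrow> \<eta> (laurent_class f a) = \<xi> (laurent_class f a)) \<Longrightarrow> \<eta> \<in> U"
      using openin_dual_topology_cylinder[OF U \<xi>] by blast
    define P where "P = (\<lambda>a. (a, \<xi> (laurent_class f a))) ` E"
    have "finite P" "P \<subseteq> UNIV \<times> {z. z ^ CARD('p) = 1}"
      using E(1) UX \<xi> dual_group_eval_root by (auto simp: P_def)
    then have "dual_cylinder f P \<in> ?C" by blast
    moreover have "dual_cylinder f P \<subseteq> U" using E(2) by (auto simp: dual_cylinder_def P_def)
    moreover have "\<xi> \<in> dual_cylinder f P" using UX \<xi> by (auto simp: dual_cylinder_def P_def)
    ultimately show "\<xi> \<in> \<Union>{C \<in> ?C. C \<subseteq> U}" by blast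
  qed blast
  moreover have "\<Union>{C \<in> ?C. C \<subseteq> U} \<in> sigma_sets ?X (dual_cylinder f ` {P. finite P})"
  proof (rule sigma_sets_UNION)
    show "countable {C \<in> ?C. C \<subseteq> U}"
      using countable_dual_cylinders by (rule countable_subset[rotated]) blast
    show "C \<in> sigma_sets ?X (dual_cylinder f ` {P. finite P})" if "C \<in> {C \<in> ?C. C \<subseteq> U}" for C
      using that by (intro sigma_sets.Basic) blast
  qed
  ultimately show "U \<in> sigma_sets ?X (dual_cylinder f ` {P. finite P})" by simp
next
  let ?X = "carrier (dual_group f)"
  let ?T = "dual_group_topology f"
  fix C assume "C \<in> dual_cylinder f ` {P. finite P}"
  then obtain P where P: "finite P" "C = dual_cylinder f P" by blast
  have cont: "continuous_map ?T euclidean (\<lambda>\<xi>. \<xi> (laurent_class f a))" for a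
    unfolding dual_group_topology_def dual_topology_def
    by (intro continuous_map_from_subtopology continuous_map_product_projection)
      (simp add: carrier_principal_quotient)
  have "closedin ?T {\<xi> \<in> topspace ?T. \<xi> (laurent_class f a) \<in> {z}}" for a z
    using cont by (rule closedin_continuous_map_preimage) (simp add: closed_closedin[symmetric])
  then have "closedin ?T (\<Inter>(a, z)\<in>P. {\<xi> \<in> topspace ?T. \<xi> (laurent_class f a) \<in> {z}})" if "P \<noteq> {}"
    using that P(1) by (intro closedin_Inter) auto
  moreover have "C = (\<Inter>(a, z)\<in>P. {\<xi> \<in> topspace ?T. \<xi> (laurent_class f a) \<in> {z}})" if "P \<noteq> {}"
    using that unfolding P(2) dual_cylinder_def topspace_dual_group by auto
  moreover have "C = topspace ?T" if "P = {}"
    using that unfolding P(2) dual_cylinder_def topspace_dual_group by simp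
  ultimately have "closedin ?T C" by (cases "P = {}") auto
  then have "openin ?T (?X - C)" "C \<subseteq> ?X"
    by (auto simp: closedin_def topspace_dual_group)
  then have "?X - (?X - C) \<in> sigma_sets ?X {U. openin ?T U}"
    by (intro sigma_sets.Compl sigma_sets.Basic) simp
  moreover have "?X - (?X - C) = C" using \<open>C \<subseteq> ?X\<close> by blast
  ultimately show "C \<in> sigma_sets ?X {U. openin ?T U}" by simp
qed

section \<open>Haar measure makes the dual group a character action\<close>

context
  fixes f :: "('d::finite, 'p::prime_card) laurent"
    and \<mu> :: "(('d, 'p) laurent set \<Rightarrow> complex) measure"
  assumes haar: "normalized_haar_measure (dual_group f) (dual_group_topology f) \<mu>"
begin

lemma haar_space: "space \<mu> = carrier (dual_group f)"
  using haar by (simp add: normalized_haar_measure_def topspace_dual_group)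

lemma haar_sets: "sets \<mu> = sigma_sets (carrier (dual_group f)) (dual_cylinder f ` {P. finite P})"
  using haar sigma_sets_dual_cylinders[of f] by (simp add: normalized_haar_measure_def topspace_dual_group)

lemma haar_prob_space: "prob_space \<mu>"
  using haar unfolding normalized_haar_measure_def by (intro prob_spaceI) blast

lemma dual_cylinder_sets: "finite P \<Longrightarrow> dual_cylinder f P \<in> sets \<mu>"
  unfolding haar_sets by (rule sigma_sets.Basic) simp

lemma mult_dual_group:
  assumes "\<xi> \<in> carrier (dual_group f)" "\<eta> \<in> carrier (dual_group f)"
  shows "\<xi> \<otimes>\<^bsub>dual_group f\<^esub> \<eta> \<in> carrier (dual_group f)"
    and "(\<xi> \<otimes>\<^bsub>dual_group f\<^esub> \<eta>) (laurent_class f a) = \<xi> (laurent_class f a) * \<eta> (laurent_class f a)"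
proof -
  have mult: "\<xi> \<otimes>\<^bsub>dual_group f\<^esub> \<eta> = (\<lambda>m\<in>range (laurent_class f). \<xi> m * \<eta> m)"
    by (simp add: dual_group_def pontryagin_dual_def carrier_principal_quotient)
  show "(\<xi> \<otimes>\<^bsub>dual_group f\<^esub> \<eta>) (laurent_class f a) = \<xi> (laurent_class f a) * \<eta> (laurent_class f a)" for a
    by (simp add: mult)
  then show "\<xi> \<otimes>\<^bsub>dual_group f\<^esub> \<eta> \<in> carrier (dual_group f)"
    using assms unfolding carrier_dual_group by (auto simp: mult norm_mult)
qed

lemma dual_group_inverse:
  assumes "\<xi> \<in> carrier (dual_group f)"
  obtains \<eta> where "\<eta> \<in> carrier (dual_group f)" "\<And>a. \<eta> (laurent_class f a) * \<xi> (laurent_class f a) = 1"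
proof
  define \<eta> where "\<eta> = (\<lambda>m\<in>range (laurent_class f). inverse (\<xi> m))"
  show "\<eta> \<in> carrier (dual_group f)"
    using assms unfolding carrier_dual_group by (auto simp: \<eta>_def norm_inverse)
  fix a
  have "norm (\<xi> (laurent_class f a)) = 1" using assms unfolding carrier_dual_group by blast
  then have "\<xi> (laurent_class f a) \<noteq> 0" by auto
  then show "\<eta> (laurent_class f a) * \<xi> (laurent_class f a) = 1" by (simp add: \<eta>_def)
qed

lemma dual_group_eqI:
  assumes "\<xi> \<in> carrier (dual_group f)" "\<eta> \<in> carrier (dual_group f)"
    "\<And>a. \<xi> (laurent_class f a) = \<eta> (laurent_class f a)"
  shows "\<xi> = \<eta>"
proof (rule extensionalityI)
  show "\<xi> \<in> extensional (range (laurent_class f))" "\<eta> \<in> extensional (range (laurent_class f))"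
    using assms(1,2) unfolding carrier_dual_group by blast+
qed (use assms(3) in auto)

lemma translation_measurable:
  assumes "\<xi> \<in> carrier (dual_group f)"
  shows "(\<lambda>\<eta>. \<xi> \<otimes>\<^bsub>dual_group f\<^esub> \<eta>) \<in> measurable \<mu> \<mu>"
proof (rule measurable_sigma_sets[OF haar_sets])
  show "dual_cylinder f ` {P. finite P} \<subseteq> Pow (carrier (dual_group f))" by (auto simp: dual_cylinder_def)
  show "(\<lambda>\<eta>. \<xi> \<otimes>\<^bsub>dual_group f\<^esub> \<eta>) \<in> space \<mu> \<rightarrow> carrier (dual_group f)"
    using mult_dual_group(1)[OF assms] by (auto simp: haar_space)
  fix C assume "C \<in> dual_cylinder f ` {P. finite P}"
  then obtain P where P: "finite P" "C = dual_cylinder f P" by blast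
  have nz: "\<xi> (laurent_class f a) \<noteq> 0" for a
  proof -
    have "norm (\<xi> (laurent_class f a)) = 1" using assms unfolding carrier_dual_group by blast
    then show ?thesis by auto
  qed
  have eq: "\<xi> (laurent_class f a) * y = z \<longleftrightarrow> y = z / \<xi> (laurent_class f a)" for a y z
    using nz[of a] by (auto simp: field_simps)
  have "(\<lambda>\<eta>. \<xi> \<otimes>\<^bsub>dual_group f\<^esub> \<eta>) -` C \<inter> space \<mu> =
      dual_cylinder f ((\<lambda>(a, z). (a, z / \<xi> (laurent_class f a))) ` P)"
  proof -
    have "(\<forall>(a, z)\<in>(\<lambda>(a, z). (a, z / \<xi> (laurent_class f a))) ` P. \<eta> (laurent_class f a) = z) \<longleftrightarrow>
        (\<forall>(a, z)\<in>P. \<xi> (laurent_class f a) * \<eta> (laurent_class f a) = z)" for \<eta> :: "('d, 'p) laurent set \<Rightarrow> complex"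
      by (simp add: split_beta eq)
    then show ?thesis
      using mult_dual_group[OF assms] unfolding P(2) dual_cylinder_def haar_space by auto
  qed
  then show "(\<lambda>\<eta>. \<xi> \<otimes>\<^bsub>dual_group f\<^esub> \<eta>) -` C \<inter> space \<mu> \<in> sets \<mu>"
    using P(1) by (simp add: dual_cylinder_sets)
qed

text \<open>Invariance is available for images; the preimage under translation by
  \<open>\<xi>\<close> is the image under translation by its inverse \<open>\<zeta>\<close>.\<close>

lemma distr_translation:
  assumes \<xi>: "\<xi> \<in> carrier (dual_group f)"
  shows "distr \<mu> \<mu> (\<lambda>\<eta>. \<xi> \<otimes>\<^bsub>dual_group f\<^esub> \<eta>) = \<mu>"
proof (rule measure_eqI)
  fix A assume "A \<in> sets (distr \<mu> \<mu> (\<lambda>\<eta>. \<xi> \<otimes>\<^bsub>dual_group f\<^esub> \<eta>))"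
  then have A: "A \<in> sets \<mu>" by simp
  obtain \<zeta> where \<zeta>: "\<zeta> \<in> carrier (dual_group f)"
    "\<And>a. \<zeta> (laurent_class f a) * \<xi> (laurent_class f a) = 1"
    using dual_group_inverse[OF \<xi>] by blast
  have cancel: "\<zeta> \<otimes>\<^bsub>dual_group f\<^esub> (\<xi> \<otimes>\<^bsub>dual_group f\<^esub> \<eta>) = \<eta>"
    "\<xi> \<otimes>\<^bsub>dual_group f\<^esub> (\<zeta> \<otimes>\<^bsub>dual_group f\<^esub> \<eta>) = \<eta>" if \<eta>: "\<eta> \<in> carrier (dual_group f)" for \<eta>
  proof -
    show "\<zeta> \<otimes>\<^bsub>dual_group f\<^esub> (\<xi> \<otimes>\<^bsub>dual_group f\<^esub> \<eta>) = \<eta>"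
      using \<xi> \<zeta> \<eta> by (intro dual_group_eqI) (simp_all add: mult_dual_group flip: mult.assoc)
    show "\<xi> \<otimes>\<^bsub>dual_group f\<^esub> (\<zeta> \<otimes>\<^bsub>dual_group f\<^esub> \<eta>) = \<eta>"
      using \<xi> \<zeta> \<eta> by (intro dual_group_eqI)
        (simp_all add: mult_dual_group mult.commute[of "\<xi> _" "\<zeta> _"] flip: mult.assoc)
  qed
  have AX: "A \<subseteq> carrier (dual_group f)" using sets.sets_into_space[OF A] by (simp add: haar_space)
  have "(\<lambda>\<eta>. \<xi> \<otimes>\<^bsub>dual_group f\<^esub> \<eta>) -` A \<inter> space \<mu> = (\<lambda>\<eta>. \<zeta> \<otimes>\<^bsub>dual_group f\<^esub> \<eta>) ` A"
  proof (intro subset_antisym subsetI)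
    fix \<eta> assume "\<eta> \<in> (\<lambda>\<eta>. \<xi> \<otimes>\<^bsub>dual_group f\<^esub> \<eta>) -` A \<inter> space \<mu>"
    then have "\<xi> \<otimes>\<^bsub>dual_group f\<^esub> \<eta> \<in> A" "\<eta> \<in> carrier (dual_group f)" by (auto simp: haar_space)
    then show "\<eta> \<in> (\<lambda>\<eta>. \<zeta> \<otimes>\<^bsub>dual_group f\<^esub> \<eta>) ` A" using cancel(1)[of \<eta>] by (metis image_eqI)
  next
    fix \<eta> assume "\<eta> \<in> (\<lambda>\<eta>. \<zeta> \<otimes>\<^bsub>dual_group f\<^esub> \<eta>) ` A"
    then obtain \<kappa> where "\<kappa> \<in> A" "\<eta> = \<zeta> \<otimes>\<^bsub>dual_group f\<^esub> \<kappa>" by blast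
    then show "\<eta> \<in> (\<lambda>\<eta>. \<xi> \<otimes>\<^bsub>dual_group f\<^esub> \<eta>) -` A \<inter> space \<mu>"
      using AX cancel(2)[of \<kappa>] mult_dual_group(1)[OF \<zeta>(1), of \<kappa>] by (auto simp: haar_space)
  qed
  then show "emeasure (distr \<mu> \<mu> (\<lambda>\<eta>. \<xi> \<otimes>\<^bsub>dual_group f\<^esub> \<eta>)) A = emeasure \<mu> A"
    using haar A \<zeta>(1) by (simp add: emeasure_distr translation_measurable[OF \<xi>] normalized_haar_measure_def)
qed simp

lemma haar_character_action:
  "character_action \<mu> f (\<lambda>a \<xi>. \<xi> (laurent_class f a)) (algebraic_action f)"
proof -
  interpret prob_space \<mu> by (rule haar_prob_space)
  have meas: "(\<lambda>\<xi>. \<xi> (laurent_class f a)) \<in> borel_measurable \<mu>" for a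
  proof (rule borel_measurable_simple_function, unfold simple_function_def, intro conjI ballI)
    have "finite {z :: complex. z ^ CARD('p) = 1}"
      by (rule finite_roots_unity) (simp add: Suc_leI)
    then show "finite ((\<lambda>\<xi>. \<xi> (laurent_class f a)) ` space \<mu>)"
      by (rule finite_subset[rotated]) (auto simp: haar_space dual_group_eval_root)
    fix z
    have "(\<lambda>\<xi>. \<xi> (laurent_class f a)) -` {z} \<inter> space \<mu> = dual_cylinder f {(a, z)}"
      by (auto simp: dual_cylinder_def haar_space)
    then show "(\<lambda>\<xi>. \<xi> (laurent_class f a)) -` {z} \<inter> space \<mu> \<in> sets \<mu>" by (simp add: dual_cylinder_sets)
  qed
  show ?thesis
  proof unfold_locales
    fix a b :: "('d, 'p) laurent" and \<xi> n
    show "\<xi> (laurent_class f (a + b)) = \<xi> (laurent_class f a) * \<xi> (laurent_class f b)"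
      if "\<xi> \<in> space \<mu>" using that unfolding haar_space carrier_dual_group by blast
    show "\<xi> (laurent_class f a) = 1" if "f dvd a" "\<xi> \<in> space \<mu>"
      using that dual_group_eval_dvd by (simp add: haar_space)
    show "algebraic_action f n \<xi> \<in> space \<mu>" if "\<xi> \<in> space \<mu>"
      using that algebraic_action_carrier by (simp add: haar_space)
    show "algebraic_action f n \<xi> (laurent_class f a) = \<xi> (laurent_class f (laurent_monom n * a))"
      by (rule algebraic_action_eval)
    \<comment> \<open>Translating by a \<open>\<xi>\<close> that separates the class of
      \<open>a\<close> from that of 0 multiplies the integral by a number other than 1 without
      changing it.\<close>
    show "integral\<^sup>L \<mu> (\<lambda>\<xi>. \<xi> (laurent_class f a)) = 0" if a: "\<not> f dvd a"
    proof -
      obtain \<xi> where \<xi>: "\<xi> \<in> carrier (dual_group f)" "\<xi> (laurent_class f a) \<noteq> 1"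
        using dual_group_separates[OF a] .
      have "integral\<^sup>L \<mu> (\<lambda>\<eta>. \<eta> (laurent_class f a)) =
          integral\<^sup>L (distr \<mu> \<mu> (\<lambda>\<eta>. \<xi> \<otimes>\<^bsub>dual_group f\<^esub> \<eta>)) (\<lambda>\<eta>. \<eta> (laurent_class f a))"
        by (simp only: distr_translation[OF \<xi>(1)])
      also have "\<dots> = integral\<^sup>L \<mu> (\<lambda>\<eta>. (\<xi> \<otimes>\<^bsub>dual_group f\<^esub> \<eta>) (laurent_class f a))"
        by (rule integral_distr[OF translation_measurable[OF \<xi>(1)] meas])
      also have "\<dots> = integral\<^sup>L \<mu> (\<lambda>\<eta>. \<xi> (laurent_class f a) * \<eta> (laurent_class f a))"
        by (intro Bochner_Integration.integral_cong refl mult_dual_group(2) \<xi>(1)) (simp add: haar_space)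
      also have "\<dots> = \<xi> (laurent_class f a) * integral\<^sup>L \<mu> (\<lambda>\<eta>. \<eta> (laurent_class f a))" by simp
      finally show ?thesis using \<xi>(2) by (simp add: mult_cancel_right1)
    qed
    show "sets \<mu> = sigma_sets (space \<mu>)
        ((\<lambda>P. {\<xi> \<in> space \<mu>. \<forall>(a, z)\<in>P. \<xi> (laurent_class f a) = z}) ` {P. finite P})"
      unfolding haar_space haar_sets dual_cylinder_def ..
  qed
qed

end

section \<open>Orders of mixing\<close>

text \<open>The finitely many differences eventually leave any finite \<open>K\<close>, and
  \<open>Q\<close> still holds at some later index.\<close>

lemma moving_apart_frequently_far_apart:
  assumes mov: "moving_apart r n" and freq: "frequently (\<lambda>j. Q (n j)) sequentially"
  shows "far_apart {..<r} Q"
  unfolding far_apart_def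
proof (intro allI impI)
  fix K :: "(int ^ 'a) set" assume K: "finite K"
  have "eventually (\<lambda>j. \<forall>(s, t)\<in>{..<r} \<times> {..<r}. s \<noteq> t \<longrightarrow> n j s - n j t \<notin> K) sequentially"
  proof (intro eventually_ball_finite ballI)
    fix st assume st: "st \<in> {..<r} \<times> {..<r}"
    obtain s t where s: "st = (s, t)" by (cases st)
    have "eventually (\<lambda>j. n j s - n j t \<notin> K) sequentially" if "s \<noteq> t"
    proof -
      have "filterlim (\<lambda>j. n j s - n j t) cofinite sequentially"
        using mov st s that unfolding moving_apart_def by auto
      moreover have "eventually (\<lambda>x. x \<notin> K) cofinite" using K by (simp add: eventually_cofinite)
      ultimately show ?thesis by (rule filterlim_iff[THEN iffD1, rule_format])
    qed
    then show "eventually (\<lambda>j. case st of (s, t) \<Rightarrow> s \<noteq> t \<longrightarrow> n j s - n j t \<notin> K) sequentially"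
      by (cases "s = t") (auto simp: s elim: eventually_mono)
  qed simp
  with freq have "frequently (\<lambda>j. Q (n j) \<and>
      (\<forall>(s, t)\<in>{..<r} \<times> {..<r}. s \<noteq> t \<longrightarrow> n j s - n j t \<notin> K)) sequentially"
    by (rule frequently_eventually_frequently)
  from frequently_ex[OF this] obtain j
    where "Q (n j)" "\<forall>(s, t)\<in>{..<r} \<times> {..<r}. s \<noteq> t \<longrightarrow> n j s - n j t \<notin> K" by blast
  then show "\<exists>n. Q n \<and> (\<forall>s\<in>{..<r}. \<forall>t\<in>{..<r}. s \<noteq> t \<longrightarrow> n s - n t \<notin> K)"
    by (intro exI[of _ "n j"]) auto
qed

text \<open>Each difference is \<open>k\<close> times a fixed nonzero vector, hence injective in
  \<open>k\<close>, and meets a finite set only finitely often.\<close>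

lemma moving_apart_multiples:
  fixes D :: "nat \<Rightarrow> int ^ 'd::finite"
  assumes "inj_on D {..<r}"
  shows "moving_apart r (\<lambda>k s. int k *s D s)"
  unfolding moving_apart_def
proof (intro allI impI)
  fix s t assume st: "s < r" "t < r" "s \<noteq> t"
  then have "D s \<noteq> D t" using assms by (auto dest: inj_onD)
  then obtain i where i: "D s $ i \<noteq> D t $ i" by (auto simp: vec_eq_iff)
  have "inj (\<lambda>k. int k *s D s - int k *s D t)"
  proof (rule injI)
    fix k l assume "int k *s D s - int k *s D t = int l *s D s - int l *s D t"
    then have "(int k *s D s - int k *s D t) $ i = (int l *s D s - int l *s D t) $ i" by simp
    then have "int k * (D s $ i - D t $ i) = int l * (D s $ i - D t $ i)" by (simp add: algebra_simps)
    then show "k = l" using i by simp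
  qed
  then have fin: "finite {k. int k *s D s - int k *s D t \<in> K}" if "finite K" for K
    using finite_vimageI[OF that, of "\<lambda>k. int k *s D s - int k *s D t"] by (simp add: vimage_def)
  show "filterlim (\<lambda>k. int k *s D s - int k *s D t) cofinite sequentially"
    unfolding filterlim_iff cofinite_eq_sequentially[symmetric] eventually_cofinite
  proof (intro allI impI)
    fix P :: "int ^ 'd \<Rightarrow> bool" assume "finite {x. \<not> P x}"
    from fin[OF this] show "finite {k. \<not> P (int k *s D s - int k *s D t)}" by simp
  qed
qed

lemma mixing_of_order_imp_mixing_shape:
  fixes F :: "(int ^ 'd::finite) set"
  assumes mix: "mixing_of_order \<mu> \<alpha> r" and F: "finite F" "card F = r"
  shows "mixing_shape \<mu> \<alpha> F"
  unfolding mixing_shape_def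
proof (intro allI impI)
  fix A assume A: "\<forall>n\<in>F. A n \<in> sets \<mu>"
  obtain D where D: "bij_betw D {..<r} F"
    using ex_bij_betw_nat_finite[OF F(1)] F(2) by (auto simp: atLeast0LessThan)
  have F': "F = D ` {..<r}" and inj: "inj_on D {..<r}" using D by (auto simp: bij_betw_def)
  have "(\<lambda>k. measure \<mu> (\<Inter>s<r. \<alpha> (int k *s D s) -` A (D s) \<inter> space \<mu>))
      \<longlonglongrightarrow> (\<Prod>s<r. measure \<mu> (A (D s)))"
    using mix moving_apart_multiples[OF inj] A F' unfolding mixing_of_order_def by auto
  then show "(\<lambda>k. measure \<mu> (\<Inter>n\<in>F. \<alpha> (int k *s n) -` A n \<inter> space \<mu>)) \<longlonglongrightarrow> (\<Prod>n\<in>F. measure \<mu> (A n))"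
    unfolding F' image_image prod.reindex[OF inj] comp_def .
qed

context character_action
begin

text \<open>Extending the coefficients by 0 from the image of \<open>D\<close> to \<open>F\<close>
  passes the obstruction on from a small shape to every larger one.\<close>

lemma not_mixing_shape_if_relation:
  assumes J: "finite J" "inj_on D J" "j \<in> J" "\<not> f dvd b j"
    and rel: "infinite {k. relation_at f J b (\<lambda>i. int k *s D i)}"
    and F: "finite F" "D ` J \<subseteq> F"
  shows "\<not> mixing_shape M \<alpha> F"
proof
  assume mix: "mixing_shape M \<alpha> F"
  define a where "a n = (if n \<in> D ` J then b (the_inv_into J D n) else 0)" for n
  have aD: "a (D i) = b i" if "i \<in> J" for i
    using that J(2) by (simp add: a_def the_inv_into_f_f)
  have "(\<Sum>n\<in>F. a n * laurent_monom (int k *s n)) = (\<Sum>i\<in>J. b i * laurent_monom (int k *s D i))" for k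
  proof -
    have "(\<Sum>n\<in>F. a n * laurent_monom (int k *s n)) = (\<Sum>n\<in>D ` J. a n * laurent_monom (int k *s n))"
      using F by (intro sum.mono_neutral_right) (auto simp: a_def)
    then show ?thesis by (simp add: sum.reindex[OF J(2)] aD)
  qed
  then have "frequently (\<lambda>k. f dvd (\<Sum>n\<in>F. a n * laurent_monom (int k *s n))) sequentially"
    using rel by (simp add: relation_at_def frequently_cofinite flip: cofinite_eq_sequentially)
  moreover have "D j \<in> F" "\<not> f dvd a (D j)" using J(3,4) F(2) aD[OF J(3)] by auto
  ultimately obtain A where "\<And>n. A n \<in> sets M"
    "\<not> ((\<lambda>k. measure M (\<Inter>n\<in>F. \<alpha> (int k *s n) -` A n \<inter> space M)) \<longlonglongrightarrow> (\<Prod>n\<in>F. measure M (A n)))"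
    using not_tendsto_if_relation[OF F(1), of "D j" a "\<lambda>k n. int k *s n"] by blast
  then show False using mix unfolding mixing_shape_def by blast
qed

text \<open>By contraposition: a failure yields a relation along infinitely many multiples of a
  shape. It may have fewer than \<open>r\<close> points, so it is padded to exactly
  \<open>r\<close>, which is possible in an infinite lattice.\<close>

lemma mixing_of_order_if_all_shapes:
  assumes f: "prime_elem f" and r: "r \<ge> 1"
    and shapes: "\<And>F. finite F \<Longrightarrow> card F = r \<Longrightarrow> mixing_shape M \<alpha> F"
  shows "mixing_of_order M \<alpha> r"
  unfolding mixing_of_order_def
proof (intro allI impI)
  fix n :: "nat \<Rightarrow> nat \<Rightarrow> int ^ 'd" and A
  assume n: "moving_apart r n" and A: "\<forall>s<r. A s \<in> sets M"
  show "(\<lambda>j. measure M (\<Inter>s<r. \<alpha> (n j s) -` A s \<inter> space M)) \<longlonglongrightarrow> (\<Prod>s<r. measure M (A s))"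
  proof (rule measure_Int_tendsto)
    show "r > 0" using r by simp
    show "A s \<in> sets M" if "s < r" for s using A that by blast
    fix a s assume s: "s < r" "\<not> f dvd a s"
    show "eventually (\<lambda>j. \<not> relation_at f {..<r} a (n j)) sequentially"
    proof (rule ccontr)
      assume "\<not> eventually (\<lambda>j. \<not> relation_at f {..<r} a (n j)) sequentially"
      then have "frequently (\<lambda>j. relation_at f {..<r} a (n j)) sequentially" by (simp add: frequently_def)
      from moving_apart_frequently_far_apart[OF n this]
      have far: "far_apart {..<r} (relation_at f {..<r} a)" .
      obtain J D b i where J: "J \<subseteq> {..<r}" "inj_on D J" "i \<in> J" "\<not> f dvd b i"
        "infinite {k. relation_at f J b (\<lambda>i. int k *s D i)}"
        using far_apart_relation_imp_shape_relation[OF f finite_lessThan far lessThan_iff[THEN iffD2, OF s(1)] s(2)] .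
      have finJ: "finite J" using J(1) finite_subset by blast
      have card: "card (D ` J) \<le> r" using card_mono[OF finite_lessThan J(1)] card_image[OF J(2)] by simp
      have "inj (\<lambda>k :: int. (\<chi> _. k) :: int ^ 'd)" by (simp add: inj_def vec_eq_iff)
      then have "infinite (range (\<lambda>k :: int. (\<chi> _. k) :: int ^ 'd))"
        using finite_imageD infinite_UNIV_int by blast
      then have "infinite (UNIV :: (int ^ 'd) set)" using infinite_super[OF subset_UNIV] by blast
      then have "infinite (UNIV - D ` J)" using finJ by (simp add: Diff_infinite_finite)
      from infinite_arbitrarily_large[OF this, of "r - card (D ` J)"]
      obtain B where B: "finite B" "card B = r - card (D ` J)" "B \<subseteq> UNIV - D ` J" by blast
      define F where "F = D ` J \<union> B"
      have "card F = card (D ` J) + card B"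
        unfolding F_def using finJ B by (intro card_Un_disjoint) auto
      then have F: "D ` J \<subseteq> F" "finite F" "card F = r"
        using card B finJ by (auto simp: F_def)
      have "\<not> mixing_shape M \<alpha> F"
        by (rule not_mixing_shape_if_relation[OF finJ J(2-5) F(2,1)])
      then show False using shapes[OF F(2,3)] by blast
    qed
  qed
qed

end

theorem corollary5:
  fixes f :: "('d::finite, 'p::prime_card) laurent"
    and \<mu> :: "(('d, 'p) laurent set \<Rightarrow> complex) measure"
  assumes irr: "irreducible f"
    and haar: "normalized_haar_measure (dual_group f) (dual_group_topology f) \<mu>"
    and tight: "tight (newton_polytope f)"
  shows "shape_mixing_order \<mu> (algebraic_action f) = mixing_order \<mu> (algebraic_action f)"
proof -
  interpret character_action \<mu> f "\<lambda>a \<xi>. \<xi> (laurent_class f a)" "algebraic_action f"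
    using haar by (rule haar_character_action)
  have "prime_elem f" using irr by (rule laurent_irreducible_imp_prime_elem)
  \<comment> \<open>The equivalence holds for each \<open>r\<close> separately, so both suprema are
    taken over the same set.\<close>
  then have "(\<forall>F. finite F \<and> card F = r \<longrightarrow> mixing_shape \<mu> (algebraic_action f) F) \<longleftrightarrow>
      mixing_of_order \<mu> (algebraic_action f) r" if "r \<ge> 1" for r
    using mixing_of_order_if_all_shapes[OF _ that] mixing_of_order_imp_mixing_shape by blast
  then show ?thesis unfolding shape_mixing_order_def mixing_order_def
    by (intro arg_cong[where f = Sup]) blast
qed

end
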